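(* Let $(X,\mathcal A,\mu,T)$ be a conservative ergodic infinite measure preserving system (as in the context) satisfying properties (P1) and (P2) stated in the context. Let $N$ be a $T$-point process with moments of all orders defined on an ergodic system $(\Omega,\mathscr F,\mathbb P,S)$. Then $N$ is a SuShi.
   Context: Setting. $X$ is a complete separable metric space with Borel $\sigma$-algebra $\mathcal A$; $\mu$ is a measure on $(X,\mathcal A)$ that is boundedly finite (finite on bounded Borel sets), with $\mu(X)=\infty$; $T:X\to X$ is invertible and preserves $\mu$, and $(X,\mathcal A,\mu,T)$ is conservative and ergodic. Put $\mathcal A_f=\{A\in\mathcal A: 0<\mu(A)<\infty\}$. $X^*$ is the set of boundedly finite simple counting measures $\xi=\sum_{i\in I}\delta_{x_i}$ ($I$ at most countable, $x_i\ne x_j$ for $i\neq j$), identified with the corresponding sets of points, and $\mathcal A^*$ is the $\sigma$-algebra on $X^*$ generated by the maps $\xi\mapsto \xi(A)$, $A$ bounded Borel. $T_*\xi=\xi\circ T^{-1}$ is the pushforward. $T$-point process. $(\Omega,\mathscr F,\mathbb P)$ is a probability space and $S$ an invertible measure preserving transformation of it. A $T$-point process defined on $(\Omega,\mathscr F,\mathbb P,S)$ is a measurable map $N:\Omega\to X^*$ such that (i) for each $A\in\mathcal A$ with $\mu(A)=0$, $N(\omega)(A)=0$ for $\mathbb P$-a.e. $\omega$; (ii) for $\mathbb P$-a.e. $\omega$, for all $A\in\mathcal A$, $N(S\omega)(A)=N(\omega)(T^{-1}A)$. It has moments of all orders if $\mathbb E[N(A)^n]<\infty$ for all $n\ge1$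 and $A\in\mathcal A_f$. Its intensity is the measure $A\mapsto\mathbb E[N(A)]$. Poisson. $N$ is a Poisson point process of intensity $\alpha\mu$ if for all $k\ge 1$ and mutually disjoint $A_1,\dots,A_k\in\mathcal A_f$, the variables $N(A_1),\dots,N(A_k)$ are independent and Poisson distributed with parameters $\alpha\mu(A_1),\dots,\alpha\mu(A_k)$. A Poisson $T$-point process is a $T$-point process that is a Poisson point process. SuShi (superposition of shifted Poisson processes). A process $N$ on $(\Omega,\mathscr F,\mathbb P,S)$ is a SuShi if there are a countable family $(N_i)_{i\in I}$ of independent Poisson $T$-point processes, of respective intensities $\alpha_i\mu$, defined on $(\Omega,\mathscr F,\mathbb P,S)$, and finite subsets $J_i\subset\mathbb Z$ ($i\in I$) with $\sum_{i\in I}\alpha_i\,\#J_i<\infty$, such that $N(\omega)=\sum_{i\in I}\sum_{j\in J_i}T_*^j(N_i(\omega))$ for $\mathbb{P}$-a.e. $\omega$. Properties (P1), (P2). For $n\ge1$, let $\mathscr P_n$ be the set of partitions of $\{1,\dots,n\}$. For $\pi\in\mathscr P_n$ and $\kappa=(k_i)_{1\le i\le n}$ a family of integers, $m_\pi^\kappa$ is the measure on $X^n$ with $m_\pi^\kappa(A_1\times\cdots\times A_n)=\prod_{P\in\pi}\mu\left(\bigcap_{i\in P}T^{-k_i}A_i\right)$. $\kappa$ is $\pi$-compatible if $k_i=0$ whenever $i$ is the smallest element of an atom of $\pi$. (P1): for each $n\ge1$, the product system $(X^n,\mathcal A^{\otimes n},\mu^{\otimes n},T^{\times n})$ is ergodic.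 (P2): for each $n\ge1$, if $\sigma$ is a boundedly finite, $T^{\times n}$-invariant measure on $X^n$ whose marginals are absolutely continuous with respect to $\mu$, then $\sigma$ is conservative and its ergodic components are all (up to positive multiplicative constants) of the form $m_\pi^\kappa$ for some $\pi\in\mathscr P_n$ and some $\pi$-compatible family $\kappa$. *)

theory Defs
  imports "HOL-Probability.Probability"
begin

section \<open>Invertible measure preserving systems\<close>

definition automorphism :: "'b measure \<Rightarrow> ('b \<Rightarrow> 'b) \<Rightarrow> bool" where
  "automorphism M T \<longleftrightarrow>
     bij_betw T (space M) (space M) \<and> T \<in> measurable M M \<and>
     inv_into (space M) T \<in> measurable M M \<and> distr M M T = M"

definition conservative :: "'b measure \<Rightarrow> ('b \<Rightarrow> 'b) \<Rightarrow> bool" where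
  "conservative M T \<longleftrightarrow>
     (\<forall>W\<in>sets M. disjoint_family (\<lambda>n::nat. (T ^^ n) -` W \<inter> space M) \<longrightarrow> emeasure M W = 0)"

definition ergodic :: "'b measure \<Rightarrow> ('b \<Rightarrow> 'b) \<Rightarrow> bool" where
  "ergodic M T \<longleftrightarrow>
     (\<forall>A\<in>sets M. T -` A \<inter> space M = A \<longrightarrow> emeasure M A = 0 \<or> emeasure M (space M - A) = 0)"

definition int_iterate :: "('b \<Rightarrow> 'b) \<Rightarrow> int \<Rightarrow> 'b \<Rightarrow> 'b" where
  "int_iterate T k = (if 0 \<le> k then T ^^ nat k else inv T ^^ nat (- k))"

definition boundedly_finite :: "'a::polish_space measure \<Rightarrow> bool" where
  "boundedly_finite \<mu> \<longleftrightarrow>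
     sets \<mu> = sets borel \<and> (\<forall>A\<in>sets borel. bounded A \<longrightarrow> emeasure \<mu> A < \<infinity>)"

definition infinite_system :: "'a::polish_space measure \<Rightarrow> ('a \<Rightarrow> 'a) \<Rightarrow> bool" where
  "infinite_system \<mu> T \<longleftrightarrow>
     boundedly_finite \<mu> \<and> emeasure \<mu> UNIV = \<infinity> \<and>
     automorphism \<mu> T \<and> conservative \<mu> T \<and> ergodic \<mu> T"

definition finite_pos_sets :: "'a::polish_space measure \<Rightarrow> 'a set set" where
  "finite_pos_sets \<mu> = {A \<in> sets borel. 0 < emeasure \<mu> A \<and> emeasure \<mu> A < \<infinity>}"

section \<open>Measure-valued maps and point processes\<close>

text \<open>The \<open>\<sigma>\<close>-algebra on a set \<open>K\<close> of measures generated by the maps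
  \<open>\<xi> \<mapsto> \<xi>(A)\<close>, \<open>A \<in> C\<close>. As a value of type \<open>measure\<close> it carries the zero measure,
  which plays no role.\<close>

definition evaluation_space :: "'b measure set \<Rightarrow> 'b set set \<Rightarrow> 'b measure measure" where
  "evaluation_space K C =
     sigma K {{\<xi> \<in> K. emeasure \<xi> A \<in> B} |A B. A \<in> C \<and> B \<in> sets (borel :: ennreal measure)}"

text \<open>The sum of the unit masses at the points of \<open>P\<close>, as a Borel measure.\<close>

definition counting_measure :: "'a::polish_space set \<Rightarrow> 'a measure" where
  "counting_measure P = distr (count_space P) borel (\<lambda>x. x)"

lemma emeasure_counting_measure:
  "A \<in> sets borel \<Longrightarrow> emeasure (counting_measure P) A = emeasure (count_space P) (A \<inter> P)"
  by (simp add: counting_measure_def emeasure_distr)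

definition configurations :: "'a::polish_space measure set" where
  "configurations = {\<xi>. boundedly_finite \<xi> \<and> (\<exists>P. countable P \<and> \<xi> = counting_measure P)}"

definition configuration_space :: "'a::polish_space measure measure" where
  "configuration_space = evaluation_space configurations {A \<in> sets borel. bounded A}"

definition T_point_process ::
  "'a::polish_space measure \<Rightarrow> ('a \<Rightarrow> 'a) \<Rightarrow> 'w measure \<Rightarrow> ('w \<Rightarrow> 'w) \<Rightarrow> ('w \<Rightarrow> 'a measure) \<Rightarrow> bool" where
  "T_point_process \<mu> T P S N \<longleftrightarrow>
     N \<in> measurable P configuration_space \<and>
     (\<forall>A\<in>sets borel. emeasure \<mu> A = 0 \<longrightarrow> (AE \<omega> in P. emeasure (N \<omega>) A = 0)) \<and>
     (AE \<omega> in P. \<forall>A\<in>sets borel. emeasure (N (S \<omega>)) A = emeasure (N \<omega>) (T -` A))"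

definition all_moments :: "'a::polish_space measure \<Rightarrow> 'w measure \<Rightarrow> ('w \<Rightarrow> 'a measure) \<Rightarrow> bool" where
  "all_moments \<mu> P N \<longleftrightarrow>
     (\<forall>n\<ge>1. \<forall>A\<in>finite_pos_sets \<mu>. (\<integral>\<^sup>+ \<omega>. emeasure (N \<omega>) A ^ n \<partial>P) < \<infinity>)"

definition poisson_process ::
  "'a::polish_space measure \<Rightarrow> 'w measure \<Rightarrow> real \<Rightarrow> ('w \<Rightarrow> 'a measure) \<Rightarrow> bool" where
  "poisson_process \<mu> P \<alpha> N \<longleftrightarrow>
     0 < \<alpha> \<and>
     (\<forall>k\<ge>1. \<forall>A :: nat \<Rightarrow> 'a set.
        (\<forall>i\<in>{1..k}. A i \<in> finite_pos_sets \<mu>) \<and> disjoint_family_on A {1..k} \<longrightarrow>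
        prob_space.indep_vars P (\<lambda>_. borel) (\<lambda>i \<omega>. emeasure (N \<omega>) (A i)) {1..k} \<and>
        (\<forall>i\<in>{1..k}. distr P borel (\<lambda>\<omega>. emeasure (N \<omega>) (A i)) =
           distr (measure_pmf (poisson_pmf (\<alpha> * measure \<mu> (A i)))) borel
             (of_nat :: nat \<Rightarrow> ennreal)))"

text \<open>The index set of the countable family is taken to be a set of natural numbers. The
  superposition is an equality of measures, so multiplicities are counted.\<close>

definition SuShi ::
  "'a::polish_space measure \<Rightarrow> ('a \<Rightarrow> 'a) \<Rightarrow> 'w measure \<Rightarrow> ('w \<Rightarrow> 'w) \<Rightarrow> ('w \<Rightarrow> 'a measure) \<Rightarrow> bool" where
  "SuShi \<mu> T P S N \<longleftrightarrow>
     (\<exists>(I :: nat set) (N' :: nat \<Rightarrow> 'w \<Rightarrow> 'a measure) (\<alpha> :: nat \<Rightarrow> real) (J :: nat \<Rightarrow> int set).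
        (\<forall>i\<in>I. T_point_process \<mu> T P S (N' i) \<and> poisson_process \<mu> P (\<alpha> i) (N' i) \<and> finite (J i)) \<and>
        prob_space.indep_vars P (\<lambda>_. configuration_space) N' I \<and>
        (\<lambda>i. \<alpha> i * real (card (J i))) summable_on I \<and>
        (AE \<omega> in P. \<forall>A\<in>sets borel.
           emeasure (N \<omega>) A =
             (\<Sum>\<^sub>\<infinity>i\<in>I. \<Sum>j\<in>J i. emeasure (distr (N' i \<omega>) borel (int_iterate T j)) A)))"

section \<open>Product systems and properties (P1), (P2)\<close>

text \<open>\<open>X^n\<close> is the space of the product \<open>\<sigma>\<close>-algebra \<open>PiM {1..n} (\<lambda>_. borel)\<close>, that is, the set of
  functions on \<open>{1..n}\<close>, extended by \<open>undefined\<close>.\<close>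

definition product_map :: "nat \<Rightarrow> ('a \<Rightarrow> 'a) \<Rightarrow> (nat \<Rightarrow> 'a) \<Rightarrow> nat \<Rightarrow> 'a" where
  "product_map n T x = (\<lambda>i\<in>{1..n}. T (x i))"

text \<open>A subset of \<open>X^n\<close> is bounded iff all its coordinate projections are bounded.\<close>

definition boundedly_finite_measures :: "nat \<Rightarrow> (nat \<Rightarrow> 'a::polish_space) measure set" where
  "boundedly_finite_measures n =
     {\<sigma>. sets \<sigma> = sets (PiM {1..n} (\<lambda>_. borel)) \<and>
         (\<forall>A\<in>sets \<sigma>. (\<forall>i\<in>{1..n}. bounded ((\<lambda>x. x i) ` A)) \<longrightarrow> emeasure \<sigma> A < \<infinity>)}"

text \<open>The ergodic decomposition is a mixing measure \<open>\<rho>\<close> on the space of boundedly finite measures,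
  concentrated on nonzero invariant ergodic measures (the components), whose barycentre is \<open>\<sigma>\<close>.\<close>

definition ergodic_decomposition ::
  "nat \<Rightarrow> ('a::polish_space \<Rightarrow> 'a) \<Rightarrow> (nat \<Rightarrow> 'a) measure \<Rightarrow> (nat \<Rightarrow> 'a) measure measure \<Rightarrow> bool" where
  "ergodic_decomposition n T \<sigma> \<rho> \<longleftrightarrow>
     sets \<rho> = sets (evaluation_space (boundedly_finite_measures n) (sets (PiM {1..n} (\<lambda>_. borel)))) \<and>
     sigma_finite_measure \<rho> \<and>
     (AE \<nu> in \<rho>. emeasure \<nu> (space \<nu>) \<noteq> 0 \<and> distr \<nu> \<nu> (product_map n T) = \<nu> \<and>
        ergodic \<nu> (product_map n T)) \<and>
     (\<forall>A\<in>sets \<sigma>. emeasure \<sigma> A = (\<integral>\<^sup>+ \<nu>. emeasure \<nu> A \<partial>\<rho>))"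

definition compatible :: "nat set set \<Rightarrow> (nat \<Rightarrow> int) \<Rightarrow> bool" where
  "compatible \<pi> \<kappa> \<longleftrightarrow> (\<forall>Q\<in>\<pi>. \<kappa> (Min Q) = 0)"

text \<open>\<open>is_partition_measure \<mu> T n \<pi> \<kappa> m\<close> says that \<open>m\<close> is the measure \<open>m_\<pi>^\<kappa>\<close>, which is determined
  by its values on measurable rectangles.\<close>

definition is_partition_measure ::
  "'a::polish_space measure \<Rightarrow> ('a \<Rightarrow> 'a) \<Rightarrow> nat \<Rightarrow> nat set set \<Rightarrow> (nat \<Rightarrow> int) \<Rightarrow> (nat \<Rightarrow> 'a) measure \<Rightarrow> bool" where
  "is_partition_measure \<mu> T n \<pi> \<kappa> m \<longleftrightarrow>
     sets m = sets (PiM {1..n} (\<lambda>_. borel)) \<and>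
     (\<forall>A. (\<forall>i\<in>{1..n}. A i \<in> sets borel) \<longrightarrow>
        emeasure m (PiE {1..n} A) = (\<Prod>Q\<in>\<pi>. emeasure \<mu> (\<Inter>i\<in>Q. int_iterate T (\<kappa> i) -` A i)))"

definition P1 :: "'a::polish_space measure \<Rightarrow> ('a \<Rightarrow> 'a) \<Rightarrow> bool" where
  "P1 \<mu> T \<longleftrightarrow> (\<forall>n\<ge>1. ergodic (PiM {1..n} (\<lambda>_. \<mu>)) (product_map n T))"

definition P2 :: "'a::polish_space measure \<Rightarrow> ('a \<Rightarrow> 'a) \<Rightarrow> bool" where
  "P2 \<mu> T \<longleftrightarrow>
     (\<forall>n\<ge>1. \<forall>\<sigma>\<in>boundedly_finite_measures n.
        distr \<sigma> \<sigma> (product_map n T) = \<sigma> \<and>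
        (\<forall>i\<in>{1..n}. absolutely_continuous \<mu> (distr \<sigma> borel (\<lambda>x. x i))) \<longrightarrow>
        conservative \<sigma> (product_map n T) \<and>
        (\<exists>\<rho>. ergodic_decomposition n T \<sigma> \<rho> \<and>
           (AE \<nu> in \<rho>. \<exists>c \<pi> \<kappa> m. 0 < c \<and> c < \<infinity> \<and> partition_on {1..n} \<pi> \<and> compatible \<pi> \<kappa> \<and>
              is_partition_measure \<mu> T n \<pi> \<kappa> m \<and> \<nu> = scale_measure c m)))"

end

theory Submission
  imports Defs
begin

text \<open>
  Call the points of \<open>N(\<omega>)\<close> that lie on a common \<open>T\<close>-orbit a cluster. The pattern
  \<open>{k. T^k x \<in> N(\<omega>)}\<close> of the cluster of a point \<open>x\<close> moves with the point: as \<open>N(S\<omega>) = T_* N(\<omega>)\<close>,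
  the point \<open>T x\<close> of \<open>N(S\<omega>)\<close> has the same pattern. So the points with a given pattern form an
  equivariant random set, and its intensity is a multiple of \<open>\<mu>\<close>.

  Clusters are finite. Let \<open>c_k\<close> be the intensity of the points \<open>x\<close> of \<open>N\<close> for which \<open>T^k x\<close> is a
  point of \<open>N\<close> as well. If \<open>D\<close> is a tower of height much larger than \<open>k\<close>, then \<open>D\<close> and its
  \<open>k\<close>-th translate almost coincide, so \<open>E[N(D)^2]\<close> is at least of the order of \<open>\<mu>(D)\<close> times a long partial
  sum of the \<open>c_k\<close>. If \<open>\<Sum> c_k\<close> were infinite, a union of towers of summable measure would have an
  infinite second moment (lemma \<open>pair_intensity_summable\<close>). Hence the expected size of a cluster is
  finite. Call its first point the root and the pattern \<open>J\<close> seen from the root its shape. The roots of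
  shape \<open>J\<close> form a process \<open>N_J\<close>, and \<open>N\<close> is the sum of the \<open>T^j_* N_J\<close> over all shapes \<open>J\<close> and \<open>j \<in> J\<close>
  (lemma \<open>points_decomposition\<close>).

  The \<open>N_J\<close> are independent Poisson processes. Different roots lie on different orbits. Therefore the
  factorial moment measure of \<open>n\<close> root processes, an invariant measure on \<open>X^n\<close>, does not charge the tuples
  with two coordinates on one orbit, whereas \<open>m_\<pi>^\<kappa>\<close> is concentrated on such tuples as soon as \<open>\<pi>\<close>
  has an atom with two elements. By (P2) the moment measure is a multiple of \<open>\<mu>^n\<close> (lemma
  \<open>invariant_measure_on_distinct_orbits\<close>). For \<open>n = 2\<close> this bounds the quadratic distance
  between the quotients \<open>N_J(A) / \<mu>(A)\<close> for different sets \<open>A\<close>: along sets of rapidly growing measure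
  they converge, the limit is \<open>S\<close>-invariant, hence constant, and so it is the intensity \<open>\<alpha>_J\<close>
  (lemma \<open>law_of_large_numbers\<close>). Placing one point after the other in sets of large measure
  identifies the multiple of \<open>\<mu>^n\<close> as the product of the intensities (lemma \<open>factorial_moment\<close>). These are the factorial moments of independent Poisson
  variables, and an alternating series recovers the joint law of the counts (lemma \<open>joint_poisson_law\<close>).
  Finally the events that a set contains no point generate the \<open>\<sigma>\<close>-algebra of configurations,
  which turns the product formula for these events into independence of the processes.
\<close>

section \<open>Counting points\<close>

text \<open>The value \<open>\<infinity>\<close> on infinite sets makes counts additive and monotone without finiteness
  conditions.\<close>

definition ecard :: "'b set \<Rightarrow> ennreal" where
  "ecard A = emeasure (count_space UNIV) A"

lemma ecard_finite: "finite A \<Longrightarrow> ecard A = of_nat (card A)"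
  by (simp add: ecard_def emeasure_count_space)

lemma ecard_infinite: "infinite A \<Longrightarrow> ecard A = \<infinity>"
  by (simp add: ecard_def emeasure_count_space)

lemma ecard_empty [simp]: "ecard {} = 0"
  by (simp add: ecard_def)

lemma ecard_singleton [simp]: "ecard {x} = 1"
  by (simp add: ecard_finite)

lemma ecard_mono: "A \<subseteq> B \<Longrightarrow> ecard A \<le> ecard B"
  unfolding ecard_def by (rule emeasure_mono) auto

lemma ecard_eq_0_iff [simp]: "ecard A = 0 \<longleftrightarrow> A = {}"
  by (simp add: ecard_def emeasure_count_space_eq_0)

lemma ecard_finite_iff: "ecard A < \<top> \<longleftrightarrow> finite A"
  by (cases "finite A") (auto simp: ecard_finite ecard_infinite of_nat_less_top)

lemma ecard_eq_1_iff: "ecard A = 1 \<longleftrightarrow> (\<exists>x. A = {x})"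
proof (cases "finite A")
  case True
  then have "ecard A = 1 \<longleftrightarrow> card A = 1"
    by (metis ecard_finite of_nat_1 of_nat_eq_iff)
  then show ?thesis by (simp add: card_1_singleton_iff)
next
  case False
  then show ?thesis by (auto simp: ecard_infinite)
qed

lemma ecard_image: "inj_on f A \<Longrightarrow> ecard (f ` A) = ecard A"
  by (cases "finite A") (auto simp: ecard_finite ecard_infinite card_image finite_image_iff)

lemma ecard_bij_betw: "bij_betw f A B \<Longrightarrow> ecard A = ecard B"
  by (metis bij_betw_def ecard_image)

lemma ecard_Un_disjoint: "A \<inter> B = {} \<Longrightarrow> ecard (A \<union> B) = ecard A + ecard B"
  unfolding ecard_def by (rule plus_emeasure[symmetric]) auto

lemma ecard_UN_disjoint:
  "disjoint_family F \<Longrightarrow> ecard (\<Union>i::nat. F i) = (\<Sum>i. ecard (F i))"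
  unfolding ecard_def by (rule suminf_emeasure[symmetric]) auto

lemma ecard_UN_disjoint_finite:
  "finite I \<Longrightarrow> disjoint_family_on F I \<Longrightarrow> ecard (\<Union>i\<in>I. F i) = (\<Sum>i\<in>I. ecard (F i))"
  unfolding ecard_def by (rule sum_emeasure[symmetric]) auto

lemma ecard_nat: "ecard {i::nat. Q i} = (\<Sum>i. indicator {i. Q i} i)"
proof -
  have "ecard {i::nat. Q i} = (\<integral>\<^sup>+ i. indicator {i. Q i} i \<partial>count_space UNIV)"
    by (simp add: ecard_def)
  then show ?thesis by (simp add: nn_integral_count_space_nat)
qed

text \<open>A count over a countable index set is a series of indicators.\<close>

lemma measurable_ecard_countable:
  assumes S: "countable S" and Q: "\<And>j. j \<in> S \<Longrightarrow> {\<omega> \<in> space M. Q \<omega> j} \<in> sets M"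
  shows "(\<lambda>\<omega>. ecard {j \<in> S. Q \<omega> j}) \<in> borel_measurable M"
proof -
  define E where "E i = (if i \<in> to_nat_on S ` S then {\<omega> \<in> space M. Q \<omega> (from_nat_into S i)} else {})" for i
  have E: "E i \<in> sets M" for i
    using Q S by (auto simp: E_def)
  have eq: "ecard {j \<in> S. Q \<omega> j} = (\<Sum>i. indicator (E i) \<omega>)" if "\<omega> \<in> space M" for \<omega>
  proof -
    have "to_nat_on S ` {j \<in> S. Q \<omega> j} = {i. \<omega> \<in> E i}"
      using that S by (auto simp: E_def)
    moreover have "inj_on (to_nat_on S) {j \<in> S. Q \<omega> j}"
      using S by (rule inj_on_subset[OF inj_on_to_nat_on]) auto
    ultimately have "ecard {j \<in> S. Q \<omega> j} = ecard {i. \<omega> \<in> E i}"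
      by (metis ecard_image)
    then show ?thesis by (simp add: ecard_nat indicator_def)
  qed
  have "(\<lambda>\<omega>. \<Sum>i. indicator (E i) \<omega> :: ennreal) \<in> borel_measurable M"
    using E by measurable
  then show ?thesis using eq by (simp cong: measurable_cong)
qed

lemma emeasure_counting: "A \<in> sets borel \<Longrightarrow> emeasure (counting_measure R) A = ecard (R \<inter> A)"
  by (cases "finite (R \<inter> A)")
    (simp_all add: emeasure_counting_measure ecard_finite ecard_infinite Int_commute[of A])

section \<open>Random locally finite sets\<close>

text \<open>A countable base of bounded open sets. Bounded sets contain finitely many points of a
  configuration, so small cells isolate its points.\<close>

definition cell :: "nat \<Rightarrow> 'a::polish_space set" where
  "cell = (SOME C. (\<forall>j. open (C j) \<and> bounded (C j)) \<and>
     (\<forall>x U. open U \<longrightarrow> x \<in> U \<longrightarrow> (\<exists>j. x \<in> C j \<and> C j \<subseteq> U)))"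

lemma cell_props:
  "(\<forall>j. open (cell j :: 'a::polish_space set) \<and> bounded (cell j :: 'a set)) \<and>
   (\<forall>(x::'a) U. open U \<longrightarrow> x \<in> U \<longrightarrow> (\<exists>j. x \<in> cell j \<and> cell j \<subseteq> U))"
proof -
  obtain B :: "'a set set" where B: "countable B" "topological_basis B"
    using ex_countable_basis by blast
  define B' where "B' = {b \<in> B. bounded b}"
  have ex: "\<exists>b\<in>B'. x \<in> b \<and> b \<subseteq> U" if "open U" "x \<in> U" for x :: 'a and U
  proof -
    have "open (U \<inter> ball x 1)" "x \<in> U \<inter> ball x 1" using that by auto
    then obtain b where "b \<in> B" "x \<in> b" "b \<subseteq> U \<inter> ball x 1"
      using B(2) by (meson topological_basisE)
    then show ?thesis unfolding B'_def
      by (metis (no_types, lifting) bounded_ball bounded_subset le_inf_iff mem_Collect_eq)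
  qed
  have ne: "B' \<noteq> {}" using ex[of UNIV undefined] by auto
  have cnt: "countable B'" using B(1) by (auto simp: B'_def)
  have "(\<forall>j. open (from_nat_into B' j) \<and> bounded (from_nat_into B' j)) \<and>
   (\<forall>x U. open U \<longrightarrow> x \<in> U \<longrightarrow> (\<exists>j. x \<in> from_nat_into B' j \<and> from_nat_into B' j \<subseteq> U))"
  proof (intro conjI allI impI)
    fix j
    have "from_nat_into B' j \<in> B'" by (rule from_nat_into[OF ne])
    then show "open (from_nat_into B' j)" "bounded (from_nat_into B' j)"
      using B(2) by (auto simp: B'_def topological_basis_open)
  next
    fix x :: 'a and U assume "open U" "x \<in> U"
    then obtain b where "b \<in> B'" "x \<in> b" "b \<subseteq> U" using ex by blast
    then show "\<exists>j. x \<in> from_nat_into B' j \<and> from_nat_into B' j \<subseteq> U"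
      using from_nat_into_surj[OF cnt] by metis
  qed
  then have "\<exists>C :: nat \<Rightarrow> 'a set. (\<forall>j. open (C j) \<and> bounded (C j)) \<and>
     (\<forall>x U. open U \<longrightarrow> x \<in> U \<longrightarrow> (\<exists>j. x \<in> C j \<and> C j \<subseteq> U))"
    by (rule exI[where x="from_nat_into B'"])
  then show ?thesis unfolding cell_def by (rule someI_ex)
qed

lemma open_cell: "open (cell j)" and bounded_cell: "bounded (cell j)"
  and cell_base: "open U \<Longrightarrow> x \<in> U \<Longrightarrow> \<exists>j. x \<in> cell j \<and> cell j \<subseteq> U"
  using cell_props by blast+

lemma cell_borel [measurable, simp]: "cell j \<in> sets borel"
  by (simp add: open_cell)

lemma cell_separate:
  fixes x y :: "'a::polish_space"
  assumes "x \<noteq> y"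
  shows "\<exists>i j. x \<in> cell i \<and> y \<in> cell j \<and> (cell i \<inter> cell j :: 'a set) = {}"
proof -
  obtain U V where UV: "open U" "open V" "x \<in> U" "y \<in> V" and disj: "U \<inter> V = {}"
    using hausdorff[OF assms] by blast
  obtain i where i: "x \<in> cell i" "cell i \<subseteq> U"
    using cell_base[OF UV(1,3)] by blast
  obtain j where j: "y \<in> cell j" "cell j \<subseteq> V"
    using cell_base[OF UV(2,4)] by blast
  have "(cell i \<inter> cell j :: 'a set) = {}" using Int_mono[OF i(2) j(2)] disj by simp
  then show ?thesis using i(1) j(1) by blast
qed

lemma UN_cell: "(\<Union>j. cell j) = UNIV"
  using cell_base[of UNIV] by blast

definition locally_finite :: "'a::metric_space set \<Rightarrow> bool" where
  "locally_finite R \<longleftrightarrow> (\<forall>B. bounded B \<longrightarrow> finite (R \<inter> B))"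

lemma locally_finite_subset: "locally_finite R \<Longrightarrow> R' \<subseteq> R \<Longrightarrow> locally_finite R'"
  unfolding locally_finite_def by (meson Int_mono finite_subset order_refl)

lemma locally_finite_countable: "locally_finite (R::'a::polish_space set) \<Longrightarrow> countable R"
proof -
  assume "locally_finite R"
  then have "countable (\<Union>j. R \<inter> cell j)"
    by (intro countable_UN) (auto simp: locally_finite_def bounded_cell intro: countable_finite)
  then show ?thesis by (metis Int_UN_distrib UN_cell inf_top_right)
qed

lemma locally_finite_isolated:
  assumes R: "locally_finite R" and x: "x \<in> R"
  shows "\<exists>j. R \<inter> cell j = {x}"
proof -
  have fin: "finite (R \<inter> ball x 1 - {x})"
    using R by (auto simp: locally_finite_def)
  have "open (ball x 1 - (R \<inter> ball x 1 - {x}))"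
    using fin by (intro open_Diff open_ball finite_imp_closed)
  then obtain j where "x \<in> cell j" "cell j \<subseteq> ball x 1 - (R \<inter> ball x 1 - {x})"
    using cell_base[of "ball x 1 - (R \<inter> ball x 1 - {x})" x] by auto
  then have "R \<inter> cell j = {x}" using x by auto
  then show ?thesis by blast
qed

text \<open>Simple point processes, as random sets instead of random measures.\<close>

definition random_set :: "'w measure \<Rightarrow> ('w \<Rightarrow> 'a::polish_space set) \<Rightarrow> bool" where
  "random_set M R \<longleftrightarrow> (\<forall>\<omega>\<in>space M. locally_finite (R \<omega>)) \<and>
     (\<forall>A\<in>sets borel. (\<lambda>\<omega>. ecard (R \<omega> \<inter> A)) \<in> borel_measurable M)"

lemma random_set_locally_finite: "random_set M R \<Longrightarrow> \<omega> \<in> space M \<Longrightarrow> locally_finite (R \<omega>)"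
  by (simp add: random_set_def)

lemma random_set_measurable:
  "random_set M R \<Longrightarrow> A \<in> sets borel \<Longrightarrow> (\<lambda>\<omega>. ecard (R \<omega> \<inter> A)) \<in> borel_measurable M"
  by (simp add: random_set_def)

text \<open>Every point is alone in some cell. The index \<open>j\<close> is used when cell \<open>j\<close> contains exactly one
  point and no earlier cell singles out the same point. Both conditions concern counts only, and so does
  the position of the point within the cell.\<close>

lemma random_set_enumeration:
  fixes R :: "'w \<Rightarrow> 'a::polish_space set"
  assumes R: "random_set M R"
  obtains D x where "\<And>j::nat. D j \<in> sets M" "\<And>j. x j \<in> measurable M borel"
    "\<And>\<omega>. \<omega> \<in> space M \<Longrightarrow> R \<omega> = (\<lambda>j. x j \<omega>) ` {j. \<omega> \<in> D j}"
    "\<And>\<omega>. \<omega> \<in> space M \<Longrightarrow> inj_on (\<lambda>j. x j \<omega>) {j. \<omega> \<in> D j}"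
proof -
  note [measurable] = random_set_measurable[OF R]
  define s where "s j \<omega> \<longleftrightarrow> ecard (R \<omega> \<inter> cell j) = 1" for j \<omega>
  define D where "D j = {\<omega> \<in> space M. s j \<omega> \<and>
      (\<forall>i<j. \<not> (s i \<omega> \<and> ecard (R \<omega> \<inter> (cell i \<inter> cell j)) = 1))}" for j
  define x where "x j \<omega> = (if \<omega> \<in> D j then the_elem (R \<omega> \<inter> cell j) else undefined)" for j \<omega>
  have D [measurable]: "D j \<in> sets M" for j
    unfolding D_def s_def by measurable
  have xR: "R \<omega> \<inter> cell j = {x j \<omega>}" if "\<omega> \<in> D j" for \<omega> j
    using that by (auto simp: x_def D_def s_def ecard_eq_1_iff)
  have x: "x j \<in> measurable M borel" for j
  proof (rule measurableI)
    fix A :: "'a set" assume [measurable]: "A \<in> sets borel"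
    have "x j -` A \<inter> space M = {\<omega> \<in> D j. ecard (R \<omega> \<inter> (cell j \<inter> A)) = 1} \<union>
        (if undefined \<in> A then space M - D j else {})"
    proof (intro set_eqI)
      fix \<omega>
      show "\<omega> \<in> x j -` A \<inter> space M \<longleftrightarrow> \<omega> \<in> {\<omega> \<in> D j. ecard (R \<omega> \<inter> (cell j \<inter> A)) = 1} \<union>
        (if undefined \<in> A then space M - D j else {})"
      proof (cases "\<omega> \<in> D j")
        case True
        then have sp: "\<omega> \<in> space M" by (auto simp: D_def)
        have "R \<omega> \<inter> (cell j \<inter> A) = {x j \<omega>} \<inter> A" using xR[OF True] by auto
        then have "ecard (R \<omega> \<inter> (cell j \<inter> A)) = 1 \<longleftrightarrow> x j \<omega> \<in> A"
          by (cases "x j \<omega> \<in> A") auto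
        then show ?thesis using True sp by auto
      next
        case False
        then show ?thesis by (auto simp: x_def)
      qed
    qed
    also have "\<dots> \<in> sets M"
    proof -
      have "{\<omega> \<in> D j. ecard (R \<omega> \<inter> (cell j \<inter> A)) = 1} =
          D j \<inter> {\<omega> \<in> space M. ecard (R \<omega> \<inter> (cell j \<inter> A)) = 1}"
        by (auto simp: D_def)
      also have "\<dots> \<in> sets M" by measurable
      finally show ?thesis by auto
    qed
    finally show "x j -` A \<inter> space M \<in> sets M" .
  qed simp
  have inj: "inj_on (\<lambda>j. x j \<omega>) {j. \<omega> \<in> D j}" for \<omega>
  proof (rule linorder_inj_onI)
    fix i j assume ij: "i < j" "i \<in> {j. \<omega> \<in> D j}" "j \<in> {j. \<omega> \<in> D j}"
    show "x i \<omega> \<noteq> x j \<omega>"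
    proof
      assume "x i \<omega> = x j \<omega>"
      then have "R \<omega> \<inter> (cell i \<inter> cell j) = {x j \<omega>}" using xR[of \<omega> i] xR[of \<omega> j] ij by auto
      then have "ecard (R \<omega> \<inter> (cell i \<inter> cell j)) = 1" by simp
      moreover have "s i \<omega>" using ij by (auto simp: D_def)
      ultimately show False using ij by (auto simp: D_def)
    qed
  qed auto
  have "R \<omega> = (\<lambda>j. x j \<omega>) ` {j. \<omega> \<in> D j}" if sp: "\<omega> \<in> space M" for \<omega>
  proof
    show "(\<lambda>j. x j \<omega>) ` {j. \<omega> \<in> D j} \<subseteq> R \<omega>" using xR by auto
    show "R \<omega> \<subseteq> (\<lambda>j. x j \<omega>) ` {j. \<omega> \<in> D j}"
    proof
      fix y assume y: "y \<in> R \<omega>"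
      define j where "j = (LEAST j. R \<omega> \<inter> cell j = {y})"
      have j: "R \<omega> \<inter> cell j = {y}"
        unfolding j_def by (rule LeastI_ex)
          (rule locally_finite_isolated[OF random_set_locally_finite[OF R sp] y])
      have "\<not> (s i \<omega> \<and> ecard (R \<omega> \<inter> (cell i \<inter> cell j)) = 1)" if "i < j" for i
      proof
        assume "s i \<omega> \<and> ecard (R \<omega> \<inter> (cell i \<inter> cell j)) = 1"
        then obtain a b where a: "R \<omega> \<inter> cell i = {a}" and b: "R \<omega> \<inter> (cell i \<inter> cell j) = {b}"
          by (auto simp: s_def ecard_eq_1_iff)
        have "b = y" using b j by auto
        moreover have "b = a" using a b by auto
        ultimately have "R \<omega> \<inter> cell i = {y}" using a by simp
        then show False using that not_less_Least unfolding j_def by blast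
      qed
      then have "\<omega> \<in> D j" using sp j by (auto simp: D_def s_def)
      moreover have "x j \<omega> = y" using xR[OF calculation] j by auto
      ultimately show "y \<in> (\<lambda>j. x j \<omega>) ` {j. \<omega> \<in> D j}" by auto
    qed
  qed
  then show ?thesis using that[of D x] D x inj by blast
qed

lemma random_set_member:
  fixes R :: "'w \<Rightarrow> 'a::polish_space set"
  assumes R: "random_set M R" and y [measurable]: "y \<in> measurable M borel"
  shows "{\<omega> \<in> space M. y \<omega> \<in> R \<omega>} \<in> sets M"
proof -
  obtain D x where [measurable]: "\<And>j::nat. D j \<in> sets M" "\<And>j. x j \<in> measurable M borel"
    and e: "\<And>\<omega>. \<omega> \<in> space M \<Longrightarrow> R \<omega> = (\<lambda>j. x j \<omega>) ` {j. \<omega> \<in> D j}"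
    using random_set_enumeration[OF R] by metis
  have "{\<omega> \<in> space M. y \<omega> \<in> R \<omega>} = (\<Union>j. D j \<inter> {\<omega> \<in> space M. x j \<omega> = y \<omega>})"
    using sets.sets_into_space[of "D _" M] by (auto simp: e image_iff) metis+
  also have "\<dots> \<in> sets M" by measurable
  finally show ?thesis .
qed

lemma random_set_filter:
  fixes R :: "'w \<Rightarrow> 'a::polish_space set"
  assumes R: "random_set M R"
    and \<Phi>: "\<And>x. x \<in> measurable M borel \<Longrightarrow> {\<omega> \<in> space M. \<Phi> \<omega> (x \<omega>)} \<in> sets M"
  shows "random_set M (\<lambda>\<omega>. {x \<in> R \<omega>. \<Phi> \<omega> x})"
  unfolding random_set_def
proof (intro conjI ballI)
  fix \<omega> assume "\<omega> \<in> space M"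
  then show "locally_finite {x \<in> R \<omega>. \<Phi> \<omega> x}"
    by (intro locally_finite_subset[OF random_set_locally_finite[OF R]]) auto
next
  fix A :: "'a set" assume [measurable]: "A \<in> sets borel"
  obtain D x where D [measurable]: "\<And>j::nat. D j \<in> sets M" and x [measurable]: "\<And>j. x j \<in> measurable M borel"
    and e: "\<And>\<omega>. \<omega> \<in> space M \<Longrightarrow> R \<omega> = (\<lambda>j. x j \<omega>) ` {j. \<omega> \<in> D j}"
    and i: "\<And>\<omega>. \<omega> \<in> space M \<Longrightarrow> inj_on (\<lambda>j. x j \<omega>) {j. \<omega> \<in> D j}"
    using random_set_enumeration[OF R] by metis
  define Q where "Q \<omega> j \<longleftrightarrow> \<omega> \<in> D j \<and> \<Phi> \<omega> (x j \<omega>) \<and> x j \<omega> \<in> A" for \<omega> j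
  have [measurable]: "{\<omega> \<in> space M. \<Phi> \<omega> (x j \<omega>)} \<in> sets M" for j by (rule \<Phi>) simp
  have "{\<omega> \<in> space M. Q \<omega> j} = D j \<inter> {\<omega> \<in> space M. \<Phi> \<omega> (x j \<omega>)} \<inter> {\<omega> \<in> space M. x j \<omega> \<in> A}" for j
    by (auto simp: Q_def)
  also have "\<dots> j \<in> sets M" for j by measurable
  finally have "(\<lambda>\<omega>. ecard {j \<in> UNIV. Q \<omega> j}) \<in> borel_measurable M"
    by (intro measurable_ecard_countable) auto
  moreover have "ecard ({x \<in> R \<omega>. \<Phi> \<omega> x} \<inter> A) = ecard {j \<in> UNIV. Q \<omega> j}" if "\<omega> \<in> space M" for \<omega>
  proof (rule ecard_bij_betw[symmetric])
    show "bij_betw (\<lambda>j. x j \<omega>) {j \<in> UNIV. Q \<omega> j} ({x \<in> R \<omega>. \<Phi> \<omega> x} \<inter> A)"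
      unfolding bij_betw_def
    proof
      show "inj_on (\<lambda>j. x j \<omega>) {j \<in> UNIV. Q \<omega> j}"
        by (rule inj_on_subset[OF i[OF that]]) (auto simp: Q_def)
      show "(\<lambda>j. x j \<omega>) ` {j \<in> UNIV. Q \<omega> j} = {x \<in> R \<omega>. \<Phi> \<omega> x} \<inter> A"
        unfolding e[OF that] by (auto simp: Q_def)
    qed
  qed
  ultimately show "(\<lambda>\<omega>. ecard ({x \<in> R \<omega>. \<Phi> \<omega> x} \<inter> A)) \<in> borel_measurable M"
    by (simp cong: measurable_cong)
qed

text \<open>In terms of enumerations, tuples of points correspond to tuples of indices, of which there
  are countably many.\<close>

lemma random_set_tuples_measurable:
  fixes R :: "'i \<Rightarrow> 'w \<Rightarrow> 'a::polish_space set"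
  assumes I: "finite I" and R: "\<And>i. i \<in> I \<Longrightarrow> random_set M (R i)"
    and B [measurable]: "B \<in> sets (PiM I (\<lambda>_. borel))"
  shows "(\<lambda>\<omega>. ecard (PiE I (\<lambda>i. R i \<omega>) \<inter> B)) \<in> borel_measurable M"
proof -
  have "\<exists>D x. i \<in> I \<longrightarrow> (\<forall>j::nat. D j \<in> sets M) \<and> (\<forall>j. x j \<in> measurable M borel) \<and>
     (\<forall>\<omega>\<in>space M. R i \<omega> = (\<lambda>j. x j \<omega>) ` {j. \<omega> \<in> D j}) \<and>
     (\<forall>\<omega>\<in>space M. inj_on (\<lambda>j. x j \<omega>) {j. \<omega> \<in> D j})" for i
    using random_set_enumeration[OF R[of i]] by metis
  then obtain D x where D: "\<And>i j::nat. i \<in> I \<Longrightarrow> D i j \<in> sets M"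
    and x: "\<And>i j. i \<in> I \<Longrightarrow> x i j \<in> measurable M borel"
    and e: "\<And>i \<omega>. i \<in> I \<Longrightarrow> \<omega> \<in> space M \<Longrightarrow> R i \<omega> = (\<lambda>j. x i j \<omega>) ` {j. \<omega> \<in> D i j}"
    and inj: "\<And>i \<omega>. i \<in> I \<Longrightarrow> \<omega> \<in> space M \<Longrightarrow> inj_on (\<lambda>j. x i j \<omega>) {j. \<omega> \<in> D i j}"
    by metis
  define t where "t \<omega> j = (\<lambda>i\<in>I. x i (j i) \<omega>)" for \<omega> j
  define Q where "Q \<omega> j \<longleftrightarrow> (\<forall>i\<in>I. \<omega> \<in> D i (j i)) \<and> t \<omega> j \<in> B" for \<omega> j
  define S where "S = PiE I (\<lambda>_. UNIV :: nat set)"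
  have "{\<omega> \<in> space M. Q \<omega> j} \<in> sets M" for j
  proof -
    have [measurable]: "(\<lambda>\<omega>. t \<omega> j) \<in> measurable M (PiM I (\<lambda>_. borel))"
      unfolding t_def using x by (intro measurable_restrict) auto
    have "{\<omega> \<in> space M. Q \<omega> j} = {\<omega> \<in> space M. \<forall>i\<in>I. \<omega> \<in> D i (j i)} \<inter> {\<omega> \<in> space M. t \<omega> j \<in> B}"
      by (auto simp: Q_def)
    moreover have [measurable]: "{\<omega> \<in> space M. \<forall>i\<in>I. \<omega> \<in> D i (j i)} \<in> sets M"
    proof (rule sets.sets_Collect_finite_All[OF _ I])
      fix i assume "i \<in> I"
      then have "{\<omega> \<in> space M. \<omega> \<in> D i (j i)} = D i (j i)"
        using sets.sets_into_space[OF D] by auto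
      then show "{\<omega> \<in> space M. \<omega> \<in> D i (j i)} \<in> sets M" using D \<open>i \<in> I\<close> by simp
    qed
    moreover have "{\<omega> \<in> space M. t \<omega> j \<in> B} \<in> sets M" by measurable
    ultimately show ?thesis by auto
  qed
  moreover have "countable S" unfolding S_def using I by (intro countable_PiE) auto
  ultimately have "(\<lambda>\<omega>. ecard {j \<in> S. Q \<omega> j}) \<in> borel_measurable M"
    by (intro measurable_ecard_countable) auto
  moreover have "ecard (PiE I (\<lambda>i. R i \<omega>) \<inter> B) = ecard {j \<in> S. Q \<omega> j}" if sp: "\<omega> \<in> space M" for \<omega>
  proof (rule ecard_bij_betw[symmetric])
    show "bij_betw (t \<omega>) {j \<in> S. Q \<omega> j} (PiE I (\<lambda>i. R i \<omega>) \<inter> B)"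
      unfolding bij_betw_def
    proof
      show "inj_on (t \<omega>) {j \<in> S. Q \<omega> j}"
      proof (rule inj_onI)
        fix j k assume jk: "j \<in> {j \<in> S. Q \<omega> j}" "k \<in> {j \<in> S. Q \<omega> j}" "t \<omega> j = t \<omega> k"
        show "j = k"
        proof (rule PiE_ext)
          show "j \<in> PiE I (\<lambda>_. UNIV)" "k \<in> PiE I (\<lambda>_. UNIV)" using jk by (auto simp: S_def)
          fix i assume i: "i \<in> I"
          have "x i (j i) \<omega> = x i (k i) \<omega>" using jk(3) i by (metis t_def restrict_apply')
          then show "j i = k i"
            using inj[OF i sp] jk i by (auto simp: Q_def inj_on_def)
        qed
      qed
      show "t \<omega> ` {j \<in> S. Q \<omega> j} = PiE I (\<lambda>i. R i \<omega>) \<inter> B"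
      proof
        show "t \<omega> ` {j \<in> S. Q \<omega> j} \<subseteq> PiE I (\<lambda>i. R i \<omega>) \<inter> B"
          using e[OF _ sp] by (auto simp: Q_def t_def)
        show "PiE I (\<lambda>i. R i \<omega>) \<inter> B \<subseteq> t \<omega> ` {j \<in> S. Q \<omega> j}"
        proof
          fix y assume y: "y \<in> PiE I (\<lambda>i. R i \<omega>) \<inter> B"
          have "\<exists>k. i \<in> I \<longrightarrow> y i = x i k \<omega> \<and> \<omega> \<in> D i k" for i
            using y e[OF _ sp, of i] by (auto simp: PiE_iff)
          then obtain k where k: "\<And>i. i \<in> I \<Longrightarrow> y i = x i (k i) \<omega> \<and> \<omega> \<in> D i (k i)" by metis
          have ty: "t \<omega> (restrict k I) = y"
            using y k by (auto simp: t_def PiE_iff extensional_def fun_eq_iff)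
          have "restrict k I \<in> {j \<in> S. Q \<omega> j}"
            using k y ty by (auto simp: S_def Q_def)
          then show "y \<in> t \<omega> ` {j \<in> S. Q \<omega> j}" using ty by force
        qed
      qed
    qed
  qed
  ultimately show ?thesis by (simp cong: measurable_cong)
qed

section \<open>Invertible infinite measure preserving systems\<close>

locale infinite_measure_system =
  fixes \<mu> :: "'a::polish_space measure" and T :: "'a \<Rightarrow> 'a"
  assumes system: "infinite_system \<mu> T"
begin

abbreviation it :: "int \<Rightarrow> 'a \<Rightarrow> 'a" where "it \<equiv> int_iterate T"

lemma sets_mu [measurable_cong, simp]: "sets \<mu> = sets borel"
  and mu_bounded: "A \<in> sets borel \<Longrightarrow> bounded A \<Longrightarrow> emeasure \<mu> A < \<infinity>"
  and mu_UNIV: "emeasure \<mu> UNIV = \<infinity>"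
  and mu_automorphism: "automorphism \<mu> T"
  and mu_conservative: "conservative \<mu> T"
  and mu_ergodic: "ergodic \<mu> T"
  using system by (auto simp: infinite_system_def boundedly_finite_def)

lemma space_mu [simp]: "space \<mu> = UNIV"
  by (metis sets_eq_imp_space_eq sets_mu space_borel)

lemma bij_T: "bij T"
  using mu_automorphism by (simp add: automorphism_def)

lemma T_measurable [measurable]: "T \<in> borel \<rightarrow>\<^sub>M borel"
  and [measurable]: "inv T \<in> borel \<rightarrow>\<^sub>M borel"
  using mu_automorphism by (simp_all add: automorphism_def cong: measurable_cong_sets)

lemma it_0 [simp]: "it 0 x = x"
  by (simp add: int_iterate_def)

lemma it_plus_1: "it (k + 1) x = T (it k x)"
proof (cases "0 \<le> k")
  case True
  then have "nat (k + 1) = Suc (nat k)" by simp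
  with True show ?thesis by (simp add: int_iterate_def)
next
  case False
  then obtain n where k: "k = - int (Suc n)"
    by (metis int_cases not_le of_nat_0_le_iff)
  have surj: "T (inv T y) = y" for y
    using bij_T by (simp add: bij_is_surj surj_f_inv_f)
  show ?thesis
  proof (cases n)
    case 0 then show ?thesis by (simp add: k int_iterate_def surj)
  next
    case (Suc n')
    then have "nat (- k) = Suc n" "nat (- (k + 1)) = n" "\<not> 0 \<le> k + 1" by (auto simp: k)
    then show ?thesis using False by (simp add: int_iterate_def surj)
  qed
qed

lemma it_1: "it 1 x = T x"
  using it_plus_1[of 0 x] by simp

lemma it_add: "it (a + b) x = it a (it b x)"
proof (induction a arbitrary: x rule: int_induct[where k=0])
  case base then show ?case by simp
next
  case (step1 a)
  have "it (a + 1 + b) x = it ((a + b) + 1) x" by (simp add: algebra_simps)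
  then show ?case using step1 by (simp add: it_plus_1)
next
  case (step2 a)
  have "T (it (a - 1 + b) x) = it ((a - 1 + b) + 1) x" by (rule it_plus_1[symmetric])
  also have "\<dots> = it a (it b x)" using step2 by (simp add: algebra_simps)
  also have "\<dots> = T (it (a - 1) (it b x))" using it_plus_1[of "a - 1"] by simp
  finally show ?case using bij_T by (simp add: bij_is_inj inj_eq)
qed

lemma it_minus_cancel [simp]: "it (- k) (it k x) = x" "it k (it (- k) x) = x"
  by (simp_all flip: it_add)

lemma it_eq_iff: "it k x = y \<longleftrightarrow> x = it (- k) y"
  by auto

lemma bij_it: "bij (it k)"
  by (rule o_bij[of "it (- k)"]) (auto simp: fun_eq_iff)

lemma it_eq_cancel [simp]: "it k x = it k y \<longleftrightarrow> x = y"
  using bij_it by (simp add: bij_is_inj inj_eq)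

lemma it_T: "it k (T x) = T (it k x)"
  by (metis it_1 it_add add.commute)

lemma it_measurable [measurable]: "it k \<in> borel \<rightarrow>\<^sub>M borel"
  by (cases "0 \<le> k") (simp_all add: int_iterate_def measurable_compose_n)

lemma emeasure_T_vimage: "A \<in> sets borel \<Longrightarrow> emeasure \<mu> (T -` A) = emeasure \<mu> A"
  using emeasure_distr[of T \<mu> \<mu> A] mu_automorphism by (auto simp: automorphism_def)

lemma it_vimage_sets [measurable, simp]: "A \<in> sets borel \<Longrightarrow> it k -` A \<in> sets borel"
  using measurable_sets[OF it_measurable, of A k] by simp

lemma it_vimage_plus_1: "it (k + 1) -` A = it k -` (T -` A)"
  by (auto simp: it_plus_1 it_T)

lemma T_vimage_sets [measurable, simp]: "A \<in> sets borel \<Longrightarrow> T -` A \<in> sets borel"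
  using measurable_sets[OF T_measurable, of A] by simp

lemma emeasure_it_vimage:
  assumes "A \<in> sets borel" shows "emeasure \<mu> (it k -` A) = emeasure \<mu> A"
  using assms
proof (induction k arbitrary: A rule: int_induct[where k=0])
  case base
  have "it 0 -` A = A" by auto
  then show ?case by simp
next
  case (step1 k)
  then show ?case using it_vimage_plus_1[of k A] emeasure_T_vimage[of A] by simp
next
  case (step2 k)
  have "it k -` (it (- 1) -` A) = it (k - 1) -` A"
    by (auto simp flip: it_add)
  moreover have "emeasure \<mu> (it (- 1) -` A) = emeasure \<mu> A"
  proof -
    have "T -` (it (- 1) -` A) = A" by (auto simp flip: it_1)
    then show ?thesis using emeasure_T_vimage[of "it (-1) -` A"] step2 by simp
  qed
  ultimately show ?case using step2(2)[of "it (- 1) -` A"] step2 by simp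
qed

lemma ergodicD:
  "A \<in> sets borel \<Longrightarrow> T -` A = A \<Longrightarrow> emeasure \<mu> A = 0 \<or> emeasure \<mu> (- A) = 0"
  using mu_ergodic by (auto simp: ergodic_def Compl_eq_Diff_UNIV)

lemma ex_finite_positive:
  obtains j where "0 < emeasure \<mu> (cell j)" "emeasure \<mu> (cell j) < \<infinity>"
proof -
  have "\<exists>j. emeasure \<mu> (cell j) \<noteq> 0"
  proof (rule ccontr)
    assume "\<nexists>j. emeasure \<mu> (cell j) \<noteq> 0"
    then have "emeasure \<mu> (\<Union>j. cell j) = 0"
      by (intro emeasure_UN_eq_0) auto
    then show False using mu_UNIV by (simp add: UN_cell)
  qed
  then show ?thesis using that mu_bounded bounded_cell cell_borel
    by (metis gr_zeroI)
qed

text \<open>If almost every point had period \<open>k\<close>, then the union of \<open>k\<close> translates of a set of finite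
  measure would be invariant and of finite measure.\<close>

lemma periodic_null:
  assumes k: "k \<noteq> 0"
  shows "emeasure \<mu> {x. it k x = x} = 0"
proof -
  have pos: "emeasure \<mu> {x. it k x = x} = 0" if k: "0 < k" for k
  proof -
    define Q where "Q = {x. it k x = x}"
    have Q [measurable]: "Q \<in> sets borel" unfolding Q_def by measurable
    have TQ: "T -` Q = Q"
      by (auto simp: Q_def it_T) (metis bij_T bij_is_inj injD)
    have False if nz: "emeasure \<mu> Q \<noteq> 0"
    proof -
      have Qc: "emeasure \<mu> (- Q) = 0" using ergodicD[OF Q TQ] nz by simp
      obtain j where j: "0 < emeasure \<mu> (cell j)" "emeasure \<mu> (cell j) < \<infinity>"
        by (rule ex_finite_positive)
      let ?A = "cell j :: 'a set"
      define W where "W = Q \<inter> (\<Union>i\<in>{0..<k}. it i -` ?A)"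
      have W [measurable]: "W \<in> sets borel" unfolding W_def by measurable
      have "T x \<in> W \<longleftrightarrow> x \<in> W" for x
      proof -
        have "(\<exists>i\<in>{0..<k}. it i (T x) \<in> ?A) \<longleftrightarrow> (\<exists>i\<in>{0..<k}. it i x \<in> ?A)" if x: "it k x = x"
        proof
          assume "\<exists>i\<in>{0..<k}. it i (T x) \<in> ?A"
          then obtain i where i: "0 \<le> i" "i < k" "it (i + 1) x \<in> ?A"
            by (auto simp: it_plus_1 it_T)
          show "\<exists>i\<in>{0..<k}. it i x \<in> ?A"
          proof (cases "i + 1 = k")
            case True
            then show ?thesis using i x k by (intro bexI[of _ 0]) auto
          next
            case False
            then show ?thesis using i by (intro bexI[of _ "i + 1"]) auto
          qed
        next
          assume "\<exists>i\<in>{0..<k}. it i x \<in> ?A"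
          then obtain i where i: "0 \<le> i" "i < k" "it i x \<in> ?A" by auto
          show "\<exists>i\<in>{0..<k}. it i (T x) \<in> ?A"
          proof (cases "i = 0")
            case True
            have "it (k - 1) (T x) = it k x" by (metis it_1 it_add diff_add_cancel)
            then show ?thesis using i x k True by (intro bexI[of _ "k - 1"]) auto
          next
            case False
            have "it (i - 1) (T x) = it i x" by (metis it_1 it_add diff_add_cancel)
            then show ?thesis using i False by (intro bexI[of _ "i - 1"]) auto
          qed
        qed
        moreover have "T x \<in> Q \<longleftrightarrow> x \<in> Q" using TQ by auto
        ultimately show ?thesis by (auto simp: W_def Q_def)
      qed
      then have "T -` W = W" by auto
      moreover have "emeasure \<mu> W < \<infinity>"
      proof -
        have "emeasure \<mu> W \<le> emeasure \<mu> (\<Union>i\<in>{0..<k}. it i -` ?A)"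
          unfolding W_def by (rule emeasure_mono) auto
        also have "\<dots> \<le> (\<Sum>i\<in>{0..<k}. emeasure \<mu> (it i -` ?A))"
          by (rule emeasure_subadditive_finite) auto
        also have "\<dots> < \<infinity>" using j
          by (simp add: emeasure_it_vimage ennreal_mult_less_top of_nat_less_top)
        finally show ?thesis .
      qed
      moreover have "0 < emeasure \<mu> W"
      proof -
        have "emeasure \<mu> ?A \<le> emeasure \<mu> (W \<union> - Q)"
          using k by (intro emeasure_mono) (auto simp: W_def intro!: bexI[of _ 0])
        also have "\<dots> \<le> emeasure \<mu> W + emeasure \<mu> (- Q)"
          by (rule emeasure_subadditive) auto
        finally show ?thesis using j Qc by auto
      qed
      moreover have "emeasure \<mu> UNIV \<le> emeasure \<mu> W + emeasure \<mu> (- W)"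
        using emeasure_subadditive[of W \<mu> "- W"] by (simp add: Compl_partition)
      ultimately show False using ergodicD[OF W] mu_UNIV by (auto simp: top_unique)
    qed
    then show ?thesis by (auto simp: Q_def)
  qed
  show ?thesis
  proof (cases "0 < k")
    case True then show ?thesis by (rule pos)
  next
    case False
    have "{x. it k x = x} = {x. it (- k) x = x}" by (auto simp: it_eq_iff[of k])
    then show ?thesis using pos[of "- k"] False k by simp
  qed
qed

definition aperiodic :: "'a \<Rightarrow> bool" where
  "aperiodic x \<longleftrightarrow> (\<forall>k. it k x = x \<longrightarrow> k = 0)"

lemma aperiodic_inj: "aperiodic x \<Longrightarrow> it i x = it j x \<longleftrightarrow> i = j"
proof
  assume x: "aperiodic x" and eq: "it i x = it j x"
  have "it (- j + i) x = it (- j) (it j x)" unfolding it_add eq ..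
  then have "it (- j + i) x = x" by simp
  then show "i = j" using x unfolding aperiodic_def by force
qed simp

lemma aperiodic_borel [measurable]: "{x. \<not> aperiodic x} \<in> sets borel"
  unfolding aperiodic_def by measurable

lemma not_aperiodic_null: "emeasure \<mu> {x. \<not> aperiodic x} = 0"
proof -
  have "{x. \<not> aperiodic x} = (\<Union>k\<in>- {0}. {x. it k x = x})"
    by (auto simp: aperiodic_def)
  also have "\<dots> \<in> null_sets \<mu>"
    by (intro null_sets_UN') (auto simp: periodic_null)
  finally show ?thesis by auto
qed

text \<open>An aperiodic atom would be a wandering set of positive measure.\<close>

lemma singleton_null: "emeasure \<mu> {x} = 0"
proof (cases "aperiodic x")
  case False
  then have "emeasure \<mu> {x} \<le> emeasure \<mu> {x. \<not> aperiodic x}"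
    by (intro emeasure_mono) auto
  then show ?thesis using not_aperiodic_null by simp
next
  case True
  have it_nat: "(T ^^ n) y = it (int n) y" for n y
    by (simp add: int_iterate_def)
  have "disjoint_family (\<lambda>n::nat. (T ^^ n) -` {x} \<inter> space \<mu>)"
    unfolding disjoint_family_on_def
  proof (intro ballI impI)
    fix m n :: nat assume "m \<noteq> n"
    have False if "it (int m) y = x" "it (int n) y = x" for y
    proof -
      have "y = it (- int m) x" "y = it (- int n) x"
        using that by (metis it_minus_cancel(1))+
      then have "- int m = - int n" using aperiodic_inj[OF True, of "- int m" "- int n"] by simp
      then show False using \<open>m \<noteq> n\<close> by simp
    qed
    then show "(T ^^ m) -` {x} \<inter> space \<mu> \<inter> ((T ^^ n) -` {x} \<inter> space \<mu>) = {}"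
      by (auto simp: it_nat)
  qed
  then show ?thesis using mu_conservative by (auto simp: conservative_def)
qed

lemma small_cell:
  fixes x :: 'a
  assumes e: "0 < e" obtains j where "x \<in> cell j" "emeasure \<mu> (cell j) < e"
proof -
  define U where "U n = ball x (1 / real (Suc n))" for n
  have "(\<lambda>n. emeasure \<mu> (U n)) \<longlonglongrightarrow> emeasure \<mu> (\<Inter>n. U n)"
  proof (rule Lim_emeasure_decseq)
    show "range U \<subseteq> sets \<mu>" by (auto simp: U_def)
    show "decseq U" unfolding U_def
      by (intro decseq_SucI subset_ball) (simp add: frac_le)
    show "emeasure \<mu> (U n) \<noteq> \<infinity>" for n
      using mu_bounded[of "U n"] by (simp add: U_def less_top)
  qed
  moreover have "(\<Inter>n. U n) = {x}"
  proof
    show "(\<Inter>n. U n) \<subseteq> {x}"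
    proof
      fix y assume y: "y \<in> (\<Inter>n. U n)"
      have "dist x y < e" if e0: "0 < e" for e
      proof -
        obtain n where "1 / real (Suc n) < e"
          using reals_Archimedean[OF e0] by (auto simp: inverse_eq_divide)
        moreover have "dist x y < 1 / real (Suc n)" using y by (auto simp: U_def)
        ultimately show ?thesis by simp
      qed
      then have "dist x y = 0" using zero_less_dist_iff[of x y] by (metis less_irrefl zero_le_dist order_le_less)
      then show "y \<in> {x}" by simp
    qed
  qed (auto simp: U_def)
  ultimately have "(\<lambda>n. emeasure \<mu> (U n)) \<longlonglongrightarrow> 0"
    by (simp add: singleton_null)
  then have "\<forall>\<^sub>F n in sequentially. emeasure \<mu> (U n) < e"
    using e by (rule order_tendstoD)
  then obtain n where n: "emeasure \<mu> (U n) < e"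
    by (auto simp: eventually_sequentially)
  obtain j where "x \<in> cell j" "cell j \<subseteq> U n"
    using cell_base[of "U n" x] by (auto simp: U_def)
  moreover have "emeasure \<mu> (cell j) \<le> emeasure \<mu> (U n)"
    by (rule emeasure_mono) (use calculation in \<open>auto simp: U_def\<close>)
  ultimately show ?thesis using n that by (meson order_le_less_trans)
qed

text \<open>As points are null, cells of measure less than \<open>t / 2\<close> cover the space. Adding them one by
  one, the measure of the union reaches \<open>t / 2\<close> before it exceeds \<open>t\<close>.\<close>

lemma subset_of_measure:
  assumes A [measurable]: "A \<in> sets borel" and t: "0 < (t::real)" "ennreal t \<le> emeasure \<mu> A"
  obtains F where "F \<in> sets borel" "F \<subseteq> A" "ennreal (t / 2) \<le> emeasure \<mu> F" "emeasure \<mu> F \<le> ennreal t"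
proof -
  define P where "P j = (if emeasure \<mu> (cell j) < ennreal (t / 2) then A \<inter> cell j else {})" for j
  define F where "F n = (\<Union>j<n. P j)" for n :: nat
  have P [measurable]: "P j \<in> sets borel" for j by (auto simp: P_def)
  have F [measurable]: "F n \<in> sets borel" for n by (auto simp: F_def)
  have "(\<lambda>n. emeasure \<mu> (F n)) \<longlonglongrightarrow> emeasure \<mu> (\<Union>n. F n)"
  proof (rule Lim_emeasure_incseq)
    show "incseq F" unfolding F_def incseq_def by (intro allI impI UN_mono) auto
  qed auto
  moreover have "(\<Union>n. F n) = A"
  proof
    show "A \<subseteq> (\<Union>n. F n)"
    proof
      fix x assume "x \<in> A"
      obtain j where "x \<in> cell j" "emeasure \<mu> (cell j) < ennreal (t / 2)"
        using small_cell[of "ennreal (t/2)" x] t by auto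
      then have "x \<in> F (Suc j)" using \<open>x \<in> A\<close> by (auto simp: F_def P_def)
      then show "x \<in> (\<Union>n. F n)" by blast
    qed
  qed (auto simp: F_def P_def split: if_splits)
  moreover have "ennreal (t / 2) < emeasure \<mu> A"
    using t by (intro less_le_trans[OF _ t(2)]) (simp add: ennreal_less_iff)
  ultimately have "\<forall>\<^sub>F n in sequentially. ennreal (t / 2) < emeasure \<mu> (F n)"
    by (intro order_tendstoD) auto
  then have ex: "\<exists>n. ennreal (t / 2) \<le> emeasure \<mu> (F n)"
    by (metis eventually_sequentially order_refl less_imp_le)
  define n where "n = (LEAST n. ennreal (t / 2) \<le> emeasure \<mu> (F n))"
  have n: "ennreal (t / 2) \<le> emeasure \<mu> (F n)"
    unfolding n_def by (rule LeastI_ex[OF ex])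
  have "n \<noteq> 0"
  proof
    assume "n = 0"
    then have "ennreal (t / 2) \<le> 0" using n by (simp add: F_def)
    then show False using t by (simp add: ennreal_eq_0_iff)
  qed
  then obtain k where k: "n = Suc k" by (cases n) auto
  have "emeasure \<mu> (F k) \<le> ennreal (t / 2)"
    using not_less_Least[of k "\<lambda>n. ennreal (t / 2) \<le> emeasure \<mu> (F n)"] k
    by (auto simp: n_def)
  moreover have "emeasure \<mu> (P k) \<le> ennreal (t / 2)"
  proof (cases "emeasure \<mu> (cell k) < ennreal (t / 2)")
    case True
    have "emeasure \<mu> (P k) \<le> emeasure \<mu> (cell k)"
      by (rule emeasure_mono) (auto simp: P_def)
    then show ?thesis using True by simp
  qed (simp add: P_def)
  moreover have "emeasure \<mu> (F n) \<le> emeasure \<mu> (F k) + emeasure \<mu> (P k)"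
    unfolding k using emeasure_subadditive[of "F k" \<mu> "P k"]
    by (simp add: F_def lessThan_Suc Un_commute)
  ultimately have "emeasure \<mu> (F n) \<le> ennreal (t / 2) + ennreal (t / 2)"
    by (meson add_mono order_trans)
  also have "\<dots> = ennreal t" using t by (simp flip: ennreal_plus)
  finally show ?thesis
    using that[of "F n"] n \<open>(\<Union>n. F n) = A\<close> by auto
qed

text \<open>A greedy choice over the base: each step adds the part of a cell that does not return to the
  cell before time \<open>m\<close> and that is not within time \<open>m\<close> of what was chosen before. Finitely many
  translates of the resulting set cover almost the whole space, so its measure is infinite.\<close>

lemma separated_set:
  fixes m :: int
  obtains G where "G \<in> sets borel" "\<And>i. 0 < i \<Longrightarrow> i < m \<Longrightarrow> G \<inter> it i -` G = {}"
    "emeasure \<mu> G = \<infinity>"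
proof -
  define E where "E j = {x \<in> cell j. \<forall>i\<in>{1..<m}. it i x \<notin> cell j}" for j
  have E [measurable]: "E j \<in> sets borel" for j unfolding E_def by measurable
  define G where "G = rec_nat {} (\<lambda>j G. G \<union> (E j - (\<Union>i\<in>{-m..m}. it i -` G)))"
  have G0: "G 0 = {}" and GS: "G (Suc j) = G j \<union> (E j - (\<Union>i\<in>{-m..m}. it i -` G j))" for j
    by (simp_all add: G_def)
  have Gm [measurable]: "G j \<in> sets borel" for j
    by (induction j) (auto simp: G0 GS)
  have mono: "G i \<subseteq> G j" if "i \<le> j" for i j
    using that by (rule lift_Suc_mono_le[rotated]) (auto simp: GS)
  have sep: "it i x \<notin> G j" if "0 < i" "i < m" "x \<in> G j" for i j x
    using that
  proof (induction j arbitrary: x i)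
    case 0 then show ?case by (simp add: G0)
  next
    case (Suc j)
    show ?case
    proof
      assume y: "it i x \<in> G (Suc j)"
      consider "x \<in> G j" "it i x \<in> G j" | "x \<in> G j" "it i x \<notin> G j"
        | "x \<notin> G j" "it i x \<in> G j" | "x \<notin> G j" "it i x \<notin> G j" by blast
      then show False
      proof cases
        case 1 then show False using Suc by blast
      next
        case 2
        then have "it (- i) (it i x) \<notin> G j"
          using y Suc.prems by (auto simp: GS simp del: it_minus_cancel)
        then show False using 2 by simp
      next
        case 3
        then show False using Suc.prems by (auto simp: GS)
      next
        case 4
        then show False using y Suc.prems by (auto simp: GS E_def)
      qed
    qed
  qed
  define H where "H = (\<Union>j. G j)"
  have H [measurable]: "H \<in> sets borel" by (auto simp: H_def)
  have sepH: "H \<inter> it i -` H = {}" if "0 < i" "i < m" for i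
  proof -
    have False if "x \<in> G j" "it i x \<in> G k" for x j k
    proof -
      have "x \<in> G (max j k)" "it i x \<in> G (max j k)"
        using that mono[of j "max j k"] mono[of k "max j k"] by auto
      then show False using sep \<open>0 < i\<close> \<open>i < m\<close> by blast
    qed
    then show ?thesis by (auto simp: H_def)
  qed
  have cover: "x \<in> H \<union> (\<Union>i\<in>{-m..m}. it i -` H)" if x: "aperiodic x" for x
  proof -
    have "open (- ((\<lambda>i. it i x) ` {1..<m}))"
      by (intro open_Compl finite_imp_closed) auto
    moreover have "x \<in> - ((\<lambda>i. it i x) ` {1..<m})"
      using x by (auto simp: aperiodic_def) (metis less_irrefl zero_less_one order_less_le_trans)
    ultimately obtain j where "x \<in> cell j" "cell j \<subseteq> - ((\<lambda>i. it i x) ` {1..<m})"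
      using cell_base by metis
    then have "x \<in> E j" by (auto simp: E_def)
    then have "x \<in> G (Suc j) \<or> x \<in> (\<Union>i\<in>{-m..m}. it i -` G j)" by (auto simp: GS)
    then show ?thesis unfolding H_def by blast
  qed
  have "emeasure \<mu> H = \<infinity>"
  proof (rule ccontr)
    assume fin: "emeasure \<mu> H \<noteq> \<infinity>"
    have "emeasure \<mu> UNIV \<le> emeasure \<mu> ({x. \<not> aperiodic x} \<union> (H \<union> (\<Union>i\<in>{-m..m}. it i -` H)))"
      using cover by (intro emeasure_mono) auto
    also have "\<dots> \<le> emeasure \<mu> {x. \<not> aperiodic x} + (emeasure \<mu> H + (\<Sum>i\<in>{-m..m}. emeasure \<mu> (it i -` H)))"
      by (intro order_trans[OF emeasure_subadditive] add_mono order_refl emeasure_subadditive_finite) auto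
    also have "\<dots> < \<infinity>"
      using fin by (simp add: emeasure_it_vimage not_aperiodic_null ennreal_mult_less_top of_nat_less_top less_top)
    finally show False using mu_UNIV by simp
  qed
  with H sepH show ?thesis by (rule that)
qed

text \<open>The levels of the tower are the first \<open>m\<close> translates of a subset of a separated set. Its
  translate by \<open>k \<le> m / 2\<close> shares at least half of the levels with it, and its total measure is
  at least \<open>e / 2\<close>.\<close>

lemma tower:
  fixes m :: nat and e :: real
  assumes m: "0 < m" and e: "0 < e"
  obtains D where "D \<in> sets borel" "emeasure \<mu> D \<le> ennreal e"
    "\<And>k::nat. 2 * k \<le> m \<Longrightarrow> ennreal (e / 4) \<le> emeasure \<mu> (D \<inter> it (int k) -` D)"
proof -
  obtain G where G [measurable]: "G \<in> sets borel"
    and sep: "\<And>i. 0 < i \<Longrightarrow> i < int m \<Longrightarrow> G \<inter> it i -` G = {}" and inf: "emeasure \<mu> G = \<infinity>"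
    using separated_set[of "int m"] by blast
  obtain F where F [measurable]: "F \<in> sets borel" and FG: "F \<subseteq> G"
    and lo: "ennreal (e / m / 2) \<le> emeasure \<mu> F" and hi: "emeasure \<mu> F \<le> ennreal (e / m)"
    using subset_of_measure[OF G, of "e / m"] m e inf by auto
  define D where "D = (\<Union>i<m. it (int i) -` F)"
  have D [measurable]: "D \<in> sets borel" by (auto simp: D_def)
  have disj: "disjoint_family_on (\<lambda>i. it (int i) -` F) {..<m}"
  proof -
    have *: False if "i < j" "j < m" "it (int i) x \<in> F" "it (int j) x \<in> F" for i j x
    proof -
      have "it (int j - int i) (it (int i) x) \<in> G"
        using that FG by (auto simp flip: it_add)
      then show False using sep[of "int j - int i"] that FG by auto
    qed
    show ?thesis unfolding disjoint_family_on_def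
    proof (intro ballI impI equals0I)
      fix i j x assume "i \<in> {..<m}" "j \<in> {..<m}" "i \<noteq> j" "x \<in> it (int i) -` F \<inter> it (int j) -` F"
      then show False using *[of i j x] *[of j i x] by (cases "i < j") auto
    qed
  qed
  have sumF: "emeasure \<mu> (\<Union>i\<in>I. it (int i) -` F) = of_nat (card I) * emeasure \<mu> F" if "I \<subseteq> {..<m}" for I
  proof -
    have "emeasure \<mu> (\<Union>i\<in>I. it (int i) -` F) = (\<Sum>i\<in>I. emeasure \<mu> (it (int i) -` F))"
      using that disjoint_family_on_mono[OF that disj]
      by (intro sum_emeasure[symmetric]) (auto intro: finite_subset)
    then show ?thesis by (simp add: emeasure_it_vimage)
  qed
  have "emeasure \<mu> D = of_nat m * emeasure \<mu> F" unfolding D_def using sumF[of "{..<m}"] by simp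
  also have "\<dots> \<le> of_nat m * ennreal (e / m)" by (intro mult_left_mono hi) simp
  also have "\<dots> = ennreal e" using m e by (simp add: ennreal_of_nat_eq_real_of_nat flip: ennreal_mult)
  finally have 1: "emeasure \<mu> D \<le> ennreal e" .
  have 2: "ennreal (e / 4) \<le> emeasure \<mu> (D \<inter> it (int k) -` D)" if k: "2 * k \<le> m" for k
  proof -
    have "(\<Union>i\<in>{k..<m}. it (int i) -` F) \<subseteq> D \<inter> it (int k) -` D"
    proof
      fix x assume "x \<in> (\<Union>i\<in>{k..<m}. it (int i) -` F)"
      then obtain i where i: "k \<le> i" "i < m" "it (int i) x \<in> F" by auto
      have "it (int (i - k)) (it (int k) x) = it (int i) x"
        using i by (simp flip: it_add add: of_nat_diff)
      then have "it (int k) x \<in> D" unfolding D_def using i by (auto intro!: bexI[of _ "i - k"])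
      moreover have "x \<in> D" using i by (auto simp: D_def)
      ultimately show "x \<in> D \<inter> it (int k) -` D" by simp
    qed
    then have "emeasure \<mu> (\<Union>i\<in>{k..<m}. it (int i) -` F) \<le> emeasure \<mu> (D \<inter> it (int k) -` D)"
      by (intro emeasure_mono) auto
    moreover have "emeasure \<mu> (\<Union>i\<in>{k..<m}. it (int i) -` F) = of_nat (m - k) * emeasure \<mu> F"
      by (subst sumF) auto
    moreover have "ennreal (e / 4) \<le> of_nat (m - k) * emeasure \<mu> F"
    proof -
      have "e / 4 \<le> real (m - k) * (e / m / 2)"
      proof -
        have "real (m - k) = real m - real k" using k by (simp add: of_nat_diff)
        then have "real m \<le> 2 * real (m - k)"
          using of_nat_mono[OF k, where 'a = real] by simp
        moreover have "e / 4 \<le> a * (e / m / 2)" if "real m \<le> 2 * a" for a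
          using mult_left_mono[OF that, of e] e m by (simp add: field_simps)
        ultimately show ?thesis by blast
      qed
      moreover have "of_nat l * ennreal (e / m / 2) = ennreal (real l * (e / m / 2))" for l :: nat
        using e by (subst ennreal_mult) (auto simp: ennreal_of_nat_eq_real_of_nat)
      ultimately have "ennreal (e / 4) \<le> of_nat (m - k) * ennreal (e / m / 2)"
        by (metis ennreal_leI)
      also have "\<dots> \<le> of_nat (m - k) * emeasure \<mu> F" by (intro mult_left_mono lo) simp
      finally show ?thesis .
    qed
    ultimately show ?thesis by simp
  qed
  show ?thesis using that[OF D 1 2] .
qed

end

section \<open>Invariant measures on distinct orbits\<close>

(* Keeps the index sets {1..n} of the product spaces in this form. *)
declare One_nat_def [simp del]

lemma measurable_evaluation:
  assumes "A \<in> C" shows "(\<lambda>\<xi>. emeasure \<xi> A) \<in> borel_measurable (evaluation_space K C)"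
proof (rule measurableI)
  fix B :: "ennreal set" assume "B \<in> sets borel"
  then show "(\<lambda>\<xi>. emeasure \<xi> A) -` B \<inter> space (evaluation_space K C) \<in> sets (evaluation_space K C)"
    using assms unfolding evaluation_space_def
    by (auto simp: space_measure_of_conv intro!: in_measure_of)
qed simp

context infinite_measure_system
begin

definition meets_orbit_twice :: "nat \<Rightarrow> (nat \<Rightarrow> 'a) \<Rightarrow> bool" where
  "meets_orbit_twice n x \<longleftrightarrow> (\<exists>i\<in>{1..n}. \<exists>j\<in>{1..n}. \<exists>k. i \<noteq> j \<and> it k (x i) = x j)"

lemma meets_orbit_twice_sets [measurable]:
  "{x \<in> space (PiM {1..n} (\<lambda>_. borel)). meets_orbit_twice n x} \<in> sets (PiM {1..n} (\<lambda>_. borel :: 'a measure))"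
proof -
  have "{x \<in> space (PiM {1..n} (\<lambda>_. borel :: 'a measure)). meets_orbit_twice n x} =
    (\<Union>i\<in>{1..n}. \<Union>j\<in>{1..n} - {i}. \<Union>k. {x \<in> space (PiM {1..n} (\<lambda>_. borel)). it k (x i) = x j})"
    (is "?L = ?R")
  proof (intro equalityI subsetI)
    fix x assume "x \<in> ?L"
    then obtain i j k where "x \<in> space (PiM {1..n} (\<lambda>_. borel :: 'a measure))"
      "i \<in> {1..n}" "j \<in> {1..n}" "i \<noteq> j" "it k (x i) = x j"
      unfolding meets_orbit_twice_def by blast
    then show "x \<in> ?R" by blast
  next
    fix x assume "x \<in> ?R"
    then obtain i j k where "x \<in> space (PiM {1..n} (\<lambda>_. borel :: 'a measure))"
      "i \<in> {1..n}" "j \<in> {1..n}" "i \<noteq> j" "it k (x i) = x j"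
      by blast
    then show "x \<in> ?L" unfolding meets_orbit_twice_def by blast
  qed
  also have "\<dots> \<in> sets (PiM {1..n} (\<lambda>_. borel))"
  proof (intro sets.countable_UN'')
    fix i j k assume [measurable]: "i \<in> {1..n}" and "j \<in> {1..n} - {i}"
    then have [measurable]: "j \<in> {1..n}" by auto
    show "{x \<in> space (PiM {1..n} (\<lambda>_. borel :: 'a measure)). it k (x i) = x j} \<in> sets (PiM {1..n} (\<lambda>_. borel))"
      by measurable
  qed auto
  finally show ?thesis .
qed

text \<open>If \<open>i\<close> and \<open>j\<close> belong to one atom, then \<open>m\<close> does not charge the tuples for which
  \<open>T^(-\<kappa> i) x_i\<close> and \<open>T^(-\<kappa> j) x_j\<close> lie in disjoint cells: the corresponding rectangle has an empty
  factor. In all other tuples these two points agree, so \<open>x_i\<close> and \<open>x_j\<close> are on one orbit.\<close>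

lemma partition_measure_two_in_atom:
  assumes m: "is_partition_measure \<mu> T n \<pi> \<kappa> m" and \<pi>: "partition_on {1..n} \<pi>"
    and Q: "Q \<in> \<pi>" "i \<in> Q" "j \<in> Q" "i \<noteq> j"
    and null: "emeasure m {x \<in> space (PiM {1..n} (\<lambda>_. borel)). meets_orbit_twice n x} = 0"
  shows "emeasure m (space m) = 0"
proof -
  have sets_m [measurable_cong]: "sets m = sets (PiM {1..n} (\<lambda>_. borel))"
    using m by (simp add: is_partition_measure_def)
  then have space_m: "space m = space (PiM {1..n} (\<lambda>_. borel))" by (rule sets_eq_imp_space_eq)
  have ij: "i \<in> {1..n}" "j \<in> {1..n}" using \<pi> Q by (auto simp: partition_on_def)
  have fin: "finite \<pi>" using \<pi> finite_elements[OF _ \<pi>] by auto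
  define A where "A a b l = (if l = i then it (- \<kappa> i) -` cell a else if l = j then it (- \<kappa> j) -` cell b else UNIV)"
    for a b :: nat and l :: nat
  have 0: "PiE {1..n} (A a b) \<in> null_sets m" if "(cell a \<inter> cell b :: 'a set) = {}" for a b
  proof
    have A [measurable]: "A a b l \<in> sets borel" for l by (auto simp: A_def)
    then show "PiE {1..n} (A a b) \<in> sets m" unfolding sets_m by (intro sets_PiM_I_finite) auto
    have "(\<Inter>l\<in>Q. it (\<kappa> l) -` A a b l) \<subseteq> it (\<kappa> i) -` A a b i \<inter> it (\<kappa> j) -` A a b j"
      using Q by auto
    also have "\<dots> = {}" using that Q by (auto simp: A_def)
    finally have "emeasure \<mu> (\<Inter>l\<in>Q. it (\<kappa> l) -` A a b l) = 0" by simp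
    then have "(\<Prod>Q\<in>\<pi>. emeasure \<mu> (\<Inter>l\<in>Q. it (\<kappa> l) -` A a b l)) = 0"
      using fin Q by (intro prod_zero) auto
    then show "emeasure m (PiE {1..n} (A a b)) = 0"
      using m A by (simp add: is_partition_measure_def)
  qed
  define Z where "Z = {(a, b). (cell a \<inter> cell b :: 'a set) = {}}"
  have "space m \<subseteq> {x \<in> space (PiM {1..n} (\<lambda>_. borel)). meets_orbit_twice n x} \<union>
     (\<Union>(a, b)\<in>Z. PiE {1..n} (A a b))"
  proof
    fix x assume x: "x \<in> space m"
    show "x \<in> {x \<in> space (PiM {1..n} (\<lambda>_. borel)). meets_orbit_twice n x} \<union>
     (\<Union>(a, b)\<in>Z. PiE {1..n} (A a b))"
    proof (cases "it (- \<kappa> i) (x i) = it (- \<kappa> j) (x j)")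
      case True
      then have "it (\<kappa> j) (it (- \<kappa> i) (x i)) = x j" by simp
      then have "it (\<kappa> j + - \<kappa> i) (x i) = x j" unfolding it_add .
      then have "meets_orbit_twice n x" using ij Q unfolding meets_orbit_twice_def by blast
      then show ?thesis using x space_m by auto
    next
      case False
      then obtain a b where "it (- \<kappa> i) (x i) \<in> cell a" "it (- \<kappa> j) (x j) \<in> cell b"
        "(cell a \<inter> cell b :: 'a set) = {}"
        using cell_separate by metis
      then have "x \<in> PiE {1..n} (A a b)" "(a, b) \<in> Z"
        using x space_m by (auto simp: A_def Z_def space_PiM PiE_iff)
      then show ?thesis by blast
    qed
  qed
  moreover have "(\<Union>(a, b)\<in>Z. PiE {1..n} (A a b)) \<in> null_sets m"
    using 0 by (intro null_sets_UN') (auto simp: Z_def)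
  moreover have "{x \<in> space (PiM {1..n} (\<lambda>_. borel)). meets_orbit_twice n x} \<in> null_sets m"
    using null by (intro null_setsI) auto
  ultimately have "space m \<in> null_sets m"
    by (meson null_sets.Un null_sets_subset sets.top)
  then show ?thesis by auto
qed

text \<open>With singleton atoms the shifts disappear by invariance of \<open>\<mu>\<close>.\<close>

lemma partition_measure_singletons:
  assumes m: "is_partition_measure \<mu> T n \<pi> \<kappa> m" and \<pi>: "partition_on {1..n} \<pi>"
    and single: "\<And>Q i j. Q \<in> \<pi> \<Longrightarrow> i \<in> Q \<Longrightarrow> j \<in> Q \<Longrightarrow> i = j"
    and A: "\<And>i. i \<in> {1..n} \<Longrightarrow> A i \<in> sets borel"
  shows "emeasure m (PiE {1..n} A) = (\<Prod>i\<in>{1..n}. emeasure \<mu> (A i))"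
proof -
  have "\<pi> = (\<lambda>i. {i}) ` {1..n}"
  proof
    show "\<pi> \<subseteq> (\<lambda>i. {i}) ` {1..n}"
    proof
      fix Q assume Q: "Q \<in> \<pi>"
      then obtain i where "i \<in> Q" using \<pi> by (metis partition_on_def ex_in_conv)
      then have "Q = {i}" "i \<in> {1..n}" using single[OF Q] Q \<pi> by (auto simp: partition_on_def)
      then show "Q \<in> (\<lambda>i. {i}) ` {1..n}" by blast
    qed
    show "(\<lambda>i. {i}) ` {1..n} \<subseteq> \<pi>"
    proof
      fix Q assume "Q \<in> (\<lambda>i. {i}) ` {1..n}"
      then obtain i where i: "Q = {i}" "i \<in> {1..n}" by blast
      then have "i \<in> \<Union> \<pi>" using \<pi> by (simp add: partition_on_def)
      then obtain Q' where "Q' \<in> \<pi>" "i \<in> Q'" by auto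
      then have "Q' = {i}" using single by blast
      then show "Q \<in> \<pi>" using i \<open>Q' \<in> \<pi>\<close> by simp
    qed
  qed
  then have "emeasure m (PiE {1..n} A) = (\<Prod>i\<in>{1..n}. emeasure \<mu> (it (\<kappa> i) -` A i))"
    using m A by (simp add: is_partition_measure_def prod.reindex inj_on_def)
  then show ?thesis using A by (simp add: emeasure_it_vimage)
qed

text \<open>Almost every ergodic component inherits the null set of \<open>\<sigma>\<close>, so its atoms are singletons and
  it is a multiple of the product measure on rectangles. The multiples need not be chosen measurably:
  each rectangle is compared with a fixed cube before the components are integrated.\<close>

lemma invariant_measure_on_distinct_orbits:
  assumes P2: "P2 \<mu> T" and n: "1 \<le> n" and \<sigma>: "\<sigma> \<in> boundedly_finite_measures n"
    and inv: "distr \<sigma> \<sigma> (product_map n T) = \<sigma>"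
    and ac: "\<And>i. i \<in> {1..n} \<Longrightarrow> absolutely_continuous \<mu> (distr \<sigma> borel (\<lambda>x. x i))"
    and null: "emeasure \<sigma> {x \<in> space (PiM {1..n} (\<lambda>_. borel)). meets_orbit_twice n x} = 0"
  obtains c where "c < \<infinity>" "\<And>A. (\<And>i. i \<in> {1..n} \<Longrightarrow> A i \<in> sets borel) \<Longrightarrow>
      emeasure \<sigma> (PiE {1..n} A) = c * (\<Prod>i\<in>{1..n}. emeasure \<mu> (A i))"
proof -
  let ?M = "PiM {1..n} (\<lambda>_. borel :: 'a measure)"
  let ?V = "{x \<in> space ?M. meets_orbit_twice n x}"
  have sets_\<sigma>: "sets \<sigma> = sets ?M" using \<sigma> by (simp add: boundedly_finite_measures_def)
  obtain \<rho> where dec: "ergodic_decomposition n T \<sigma> \<rho>"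
    and comp: "AE \<nu> in \<rho>. \<exists>c \<pi> \<kappa> m. 0 < c \<and> c < \<infinity> \<and> partition_on {1..n} \<pi> \<and> compatible \<pi> \<kappa> \<and>
              is_partition_measure \<mu> T n \<pi> \<kappa> m \<and> \<nu> = scale_measure c m"
    using P2 n \<sigma> inv ac unfolding P2_def by blast
  have sets_\<rho>: "sets \<rho> = sets (evaluation_space (boundedly_finite_measures n) (sets ?M))"
    and nonzero: "AE \<nu> in \<rho>. emeasure \<nu> (space \<nu>) \<noteq> 0"
    and mix: "\<And>A. A \<in> sets ?M \<Longrightarrow> emeasure \<sigma> A = (\<integral>\<^sup>+ \<nu>. emeasure \<nu> A \<partial>\<rho>)"
    using dec sets_\<sigma> unfolding ergodic_decomposition_def by auto
  have meas [measurable]: "(\<lambda>\<nu>. emeasure \<nu> A) \<in> borel_measurable \<rho>" if "A \<in> sets ?M" for A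
    using measurable_evaluation[OF that] by (simp cong: measurable_cong_sets add: sets_\<rho>)
  have V: "?V \<in> sets ?M" by measurable
  have "(\<lambda>\<nu>. emeasure \<nu> ?V) \<in> borel_measurable \<rho>" using V by simp
  moreover have "(\<integral>\<^sup>+ \<nu>. emeasure \<nu> ?V \<partial>\<rho>) = 0" using null mix[OF V] by simp
  ultimately have "AE \<nu> in \<rho>. emeasure \<nu> ?V = 0" by (simp add: nn_integral_0_iff_AE)
  then have prod: "AE \<nu> in \<rho>. \<exists>c. \<forall>A. (\<forall>i\<in>{1..n}. A i \<in> sets borel) \<longrightarrow>
      emeasure \<nu> (PiE {1..n} A) = c * (\<Prod>i\<in>{1..n}. emeasure \<mu> (A i))"
    using comp nonzero
  proof eventually_elim
    case (elim \<nu>)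
    then obtain c \<pi> \<kappa> m where c: "0 < c" and \<pi>: "partition_on {1..n} \<pi>"
      and m: "is_partition_measure \<mu> T n \<pi> \<kappa> m" and \<nu>: "\<nu> = scale_measure c m" by auto
    have "emeasure m ?V = 0" using elim(1) c by (auto simp: \<nu>)
    moreover have "emeasure m (space m) \<noteq> 0" using elim(3) by (auto simp: \<nu> space_scale_measure)
    ultimately
    have "i = j" if "Q \<in> \<pi>" "i \<in> Q" "j \<in> Q" for Q i j
      using partition_measure_two_in_atom[OF m \<pi> that] by blast
    then show ?case using partition_measure_singletons[OF m \<pi>] by (auto simp: \<nu>)
  qed
  obtain b where b: "0 < emeasure \<mu> (cell b)" "emeasure \<mu> (cell b) < \<infinity>"
    by (rule ex_finite_positive)
  let ?B = "PiE {1..n} (\<lambda>_. cell b :: 'a set)"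
  have B: "?B \<in> sets ?M" by (intro sets_PiM_I_finite) auto
  have Bfin: "emeasure \<sigma> ?B < \<infinity>"
  proof -
    have "bounded ((\<lambda>x. x i) ` ?B)" if "i \<in> {1..n}" for i
      using that by (intro bounded_subset[OF bounded_cell[of b]]) auto
    then show ?thesis using \<sigma> B sets_\<sigma> by (auto simp: boundedly_finite_measures_def)
  qed
  let ?d = "emeasure \<mu> (cell b) ^ n"
  have d: "?d \<noteq> 0" "?d \<noteq> \<infinity>" using b by (auto simp: power_eq_top_ennreal)
  have "emeasure \<sigma> (PiE {1..n} A) = emeasure \<sigma> ?B / ?d * (\<Prod>i\<in>{1..n}. emeasure \<mu> (A i))"
    if A: "\<And>i. i \<in> {1..n} \<Longrightarrow> A i \<in> sets borel" for A
  proof -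
    let ?A = "PiE {1..n} A" and ?p = "\<Prod>i\<in>{1..n}. emeasure \<mu> (A i)"
    have As: "?A \<in> sets ?M" using A by (intro sets_PiM_I_finite) auto
    have "emeasure \<sigma> ?A * ?d = (\<integral>\<^sup>+ \<nu>. emeasure \<nu> ?A * ?d \<partial>\<rho>)"
      by (simp add: mix[OF As] nn_integral_multc[OF meas[OF As]])
    also have "\<dots> = (\<integral>\<^sup>+ \<nu>. emeasure \<nu> ?B * ?p \<partial>\<rho>)"
    proof (rule nn_integral_cong_AE)
      show "AE \<nu> in \<rho>. emeasure \<nu> ?A * ?d = emeasure \<nu> ?B * ?p"
        using prod
      proof eventually_elim
        case (elim \<nu>)
        then obtain c where c: "\<And>A. (\<forall>i\<in>{1..n}. A i \<in> sets borel) \<Longrightarrow>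
            emeasure \<nu> (PiE {1..n} A) = c * (\<Prod>i\<in>{1..n}. emeasure \<mu> (A i))" by blast
        then show ?case using A by (simp add: c[of A] c[of "\<lambda>_. cell b"] mult_ac)
      qed
    qed
    also have "\<dots> = emeasure \<sigma> ?B * ?p"
      by (simp add: mix[OF B] nn_integral_multc[OF meas[OF B]])
    finally have eq: "emeasure \<sigma> ?A * ?d = emeasure \<sigma> ?B * ?p" .
    have "emeasure \<sigma> ?A = emeasure \<sigma> ?A * ?d / ?d"
      using d by (simp add: ennreal_mult_divide_eq)
    also have "\<dots> = emeasure \<sigma> ?B / ?d * ?p"
      unfolding eq by (simp add: divide_ennreal_def mult_ac)
    finally show ?thesis .
  qed
  moreover have "emeasure \<sigma> ?B / ?d < \<infinity>"
    using Bfin d by (simp add: less_top[symmetric] ennreal_divide_eq_top_iff)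
  ultimately show ?thesis using that by blast
qed

end

section \<open>Intensity of tuples of points\<close>

text \<open>Tuples of distinct points; the intensity of their number is a factorial moment.\<close>

definition tuples :: "nat \<Rightarrow> (nat \<Rightarrow> 'w \<Rightarrow> 'a set) \<Rightarrow> 'w \<Rightarrow> (nat \<Rightarrow> 'a) set" where
  "tuples n R \<omega> = {x \<in> PiE {1..n} (\<lambda>i. R i \<omega>). inj_on x {1..n}}"

lemma tuples_measurable:
  fixes R :: "nat \<Rightarrow> 'w \<Rightarrow> 'a::polish_space set"
  assumes R: "\<And>i. i \<in> {1..n} \<Longrightarrow> random_set M (R i)"
    and B [measurable]: "B \<in> sets (PiM {1..n} (\<lambda>_. borel))"
  shows "(\<lambda>\<omega>. ecard (tuples n R \<omega> \<inter> B)) \<in> borel_measurable M"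
proof -
  let ?M = "PiM {1..n} (\<lambda>_. borel :: 'a measure)"
  have "{x \<in> space ?M. inj_on x {1..n}} = space ?M - (\<Union>i\<in>{1..n}. \<Union>j\<in>{1..n} - {i}. {x \<in> space ?M. x i = x j})"
    by (auto simp: inj_on_def)
  also have "\<dots> \<in> sets ?M"
  proof (intro sets.Diff sets.top sets.finite_UN finite_atLeastAtMost finite_Diff)
    fix i j assume [measurable]: "i \<in> {1..n}" and "j \<in> {1..n} - {i}"
    then have [measurable]: "j \<in> {1..n}" by auto
    show "{x \<in> space ?M. x i = x j} \<in> sets ?M" by measurable
  qed
  finally have [measurable]: "{x \<in> space ?M. inj_on x {1..n}} \<in> sets ?M" .
  have "tuples n R \<omega> \<inter> B = PiE {1..n} (\<lambda>i. R i \<omega>) \<inter> (B \<inter> {x \<in> space ?M. inj_on x {1..n}})" for \<omega>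
    using sets.sets_into_space[OF B] by (auto simp: tuples_def)
  then show ?thesis using random_set_tuples_measurable[where I = "{1..n}" and R = R, OF _ R] by simp
qed

lemma ecard_tuples_le:
  assumes R: "\<And>i. i \<in> {1..n} \<Longrightarrow> R i \<omega> \<subseteq> Q" and B: "\<And>x i. x \<in> B \<Longrightarrow> i \<in> {1..n} \<Longrightarrow> x i \<in> C"
    and fin: "finite (Q \<inter> C)"
  shows "ecard (tuples n R \<omega> \<inter> B) \<le> ecard (Q \<inter> C) ^ n"
proof -
  have "tuples n R \<omega> \<inter> B \<subseteq> PiE {1..n} (\<lambda>_. Q \<inter> C)"
  proof
    fix x assume x: "x \<in> tuples n R \<omega> \<inter> B"
    then have xR: "x \<in> PiE {1..n} (\<lambda>i. R i \<omega>)" by (simp add: tuples_def)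
    show "x \<in> PiE {1..n} (\<lambda>_. Q \<inter> C)"
    proof (rule PiE_I)
      fix i assume i: "i \<in> {1..n}"
      then show "x i \<in> Q \<inter> C" using PiE_mem[OF xR i] R[OF i] B[of x i] x by auto
    next
      fix i assume "i \<notin> {1..n}"
      with xR show "x i = undefined" by (rule PiE_arb)
    qed
  qed
  then have "ecard (tuples n R \<omega> \<inter> B) \<le> ecard (PiE {1..n} (\<lambda>_. Q \<inter> C))" by (rule ecard_mono)
  then show ?thesis using fin by (simp add: ecard_finite finite_PiE card_PiE)
qed

locale ergodic_process = infinite_measure_system \<mu> T + prob_space P
  for \<mu> :: "'a::polish_space measure" and T :: "'a \<Rightarrow> 'a" and P :: "'w measure" +
  fixes S :: "'w \<Rightarrow> 'w" and N :: "'w \<Rightarrow> 'a measure"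
  assumes property2: "P2 \<mu> T"
    and S_automorphism: "automorphism P S" and S_ergodic: "ergodic P S"
    and N_process: "T_point_process \<mu> T P S N" and N_moments: "all_moments \<mu> P N"
begin

text \<open>A simple configuration is recovered from its atoms.\<close>

definition points :: "'w \<Rightarrow> 'a set" where
  "points \<omega> = {x. emeasure (N \<omega>) {x} \<noteq> 0}"

lemma N_configuration: "\<omega> \<in> space P \<Longrightarrow> N \<omega> \<in> configurations"
proof -
  have "N \<in> P \<rightarrow>\<^sub>M configuration_space" using N_process by (simp add: T_point_process_def)
  moreover have "space configuration_space = (configurations :: 'a measure set)"
    by (simp add: configuration_space_def evaluation_space_def space_measure_of_conv)
  ultimately show "\<omega> \<in> space P \<Longrightarrow> N \<omega> \<in> configurations"
    by (metis measurable_space)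
qed

lemma N_eq_counting: "\<omega> \<in> space P \<Longrightarrow> N \<omega> = counting_measure (points \<omega>)"
proof -
  assume "\<omega> \<in> space P"
  then obtain Q where Q: "N \<omega> = counting_measure Q"
    using N_configuration by (auto simp: configurations_def)
  have "points \<omega> = Q"
    by (auto simp: points_def Q emeasure_counting_measure emeasure_count_space_eq_0)
  then show ?thesis using Q by simp
qed

lemma emeasure_N: "\<omega> \<in> space P \<Longrightarrow> A \<in> sets borel \<Longrightarrow> emeasure (N \<omega>) A = ecard (points \<omega> \<inter> A)"
  by (simp add: N_eq_counting emeasure_counting)

lemma random_set_points: "random_set P points"
  unfolding random_set_def
proof (intro conjI ballI)
  fix \<omega> assume \<omega>: "\<omega> \<in> space P"
  show "locally_finite (points \<omega>)" unfolding locally_finite_def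
  proof (intro allI impI)
    fix B :: "'a set" assume "bounded B"
    then obtain a r where B: "B \<subseteq> cball a r" by (auto simp: bounded_subset_cball)
    have "emeasure (N \<omega>) (cball a r) < \<infinity>"
      using N_configuration[OF \<omega>] by (auto simp: configurations_def boundedly_finite_def)
    then have "finite (points \<omega> \<inter> cball a r)" by (simp add: emeasure_N[OF \<omega>] ecard_finite_iff)
    then show "finite (points \<omega> \<inter> B)" using B by (meson Int_mono finite_subset order_refl)
  qed
next
  fix A :: "'a set" assume A: "A \<in> sets borel"
  define E where "E = (\<lambda>j. A \<inter> disjointed cell j)"
  have dm: "disjointed cell j \<in> sets (borel :: 'a measure)" for j
  proof -
    have "range (disjointed cell) \<subseteq> sets (borel :: 'a measure)"
      by (rule sets.range_disjointed_sets) auto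
    then show ?thesis by auto
  qed
  have E: "E j \<in> sets borel" for j using A dm by (auto simp: E_def)
  have "(\<lambda>\<omega>. emeasure (N \<omega>) (E j)) \<in> borel_measurable P" for j
  proof (rule measurable_compose[of N P configuration_space])
    show "N \<in> P \<rightarrow>\<^sub>M configuration_space" using N_process by (simp add: T_point_process_def)
    have "bounded (E j)" using disjointed_subset[of cell j]
      by (intro bounded_subset[OF bounded_cell[of j]]) (auto simp: E_def)
    then show "(\<lambda>\<xi>. emeasure \<xi> (E j)) \<in> borel_measurable configuration_space"
      unfolding configuration_space_def using E by (intro measurable_evaluation) auto
  qed
  then have "(\<lambda>\<omega>. \<Sum>j. emeasure (N \<omega>) (E j)) \<in> borel_measurable P" by measurable
  moreover have "ecard (points \<omega> \<inter> A) = (\<Sum>j. emeasure (N \<omega>) (E j))" if "\<omega> \<in> space P" for \<omega>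
  proof -
    have "points \<omega> \<inter> A = (\<Union>j. points \<omega> \<inter> E j)"
      using UN_disjointed_eq[of "cell :: nat \<Rightarrow> 'a set"] UN_cell by (auto simp: E_def)
    moreover have "disjoint_family (\<lambda>j. points \<omega> \<inter> E j)"
      using disjoint_family_disjointed[of cell] by (auto simp: E_def disjoint_family_on_def)
    ultimately show ?thesis using ecard_UN_disjoint[of "\<lambda>j. points \<omega> \<inter> E j"]
      by (simp add: emeasure_N[OF that E])
  qed
  ultimately show "(\<lambda>\<omega>. ecard (points \<omega> \<inter> A)) \<in> borel_measurable P"
    by (simp cong: measurable_cong)
qed

lemma S_measurable [measurable]: "S \<in> P \<rightarrow>\<^sub>M P" and distr_S: "distr P P S = P"
  using S_automorphism by (auto simp: automorphism_def)

lemma nn_integral_S: "f \<in> borel_measurable P \<Longrightarrow> (\<integral>\<^sup>+ \<omega>. f (S \<omega>) \<partial>P) = (\<integral>\<^sup>+ \<omega>. f \<omega> \<partial>P)"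
  using nn_integral_distr[of S P P f] distr_S by simp

lemma AE_S: assumes "AE \<omega> in P. Q \<omega>" shows "AE \<omega> in P. Q (S \<omega>)"
proof (rule AE_distrD[OF S_measurable])
  show "AE \<omega> in distr P P S. Q \<omega>" by (subst distr_S) (rule assms)
qed

lemma points_null:
  assumes "A \<in> sets borel" "emeasure \<mu> A = 0" shows "AE \<omega> in P. points \<omega> \<inter> A = {}"
proof -
  have "AE \<omega> in P. emeasure (N \<omega>) A = 0"
    using N_process assms by (auto simp: T_point_process_def)
  then show ?thesis using AE_space by eventually_elim (use assms in \<open>simp add: emeasure_N\<close>)
qed

lemma AE_aperiodic_points: "AE \<omega> in P. \<forall>x\<in>points \<omega>. aperiodic x"
  using points_null[OF aperiodic_borel not_aperiodic_null] by eventually_elim auto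

lemma points_S: "AE \<omega> in P. points (S \<omega>) = T ` points \<omega>"
proof -
  have "AE \<omega> in P. \<forall>A\<in>sets borel. emeasure (N (S \<omega>)) A = emeasure (N \<omega>) (T -` A)"
    using N_process by (auto simp: T_point_process_def)
  then show ?thesis
  proof eventually_elim
    case (elim \<omega>)
    have "x \<in> points (S \<omega>) \<longleftrightarrow> x \<in> T ` points \<omega>" for x
    proof -
      have "T -` {x} = {inv T x}"
        by (simp add: bij_vimage_eq_inv_image bij_T)
      then have "x \<in> points (S \<omega>) \<longleftrightarrow> inv T x \<in> points \<omega>" using elim by (simp add: points_def)
      also have "\<dots> \<longleftrightarrow> x \<in> T ` points \<omega>"
        by (auto simp: image_iff) (metis bij_T bij_inv_eq_iff)+
      finally show ?thesis .
    qed
    then show ?case by blast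
  qed
qed

lemma moment_finite:
  assumes A: "A \<in> sets borel" "emeasure \<mu> A < \<infinity>"
  shows "(\<integral>\<^sup>+ \<omega>. ecard (points \<omega> \<inter> A) ^ n \<partial>P) < \<infinity>"
proof (cases "n = 0 \<or> emeasure \<mu> A = 0")
  case True
  then show ?thesis
  proof
    assume "n = 0" then show ?thesis by (simp add: emeasure_space_1)
  next
    assume "emeasure \<mu> A = 0"
    have "(\<integral>\<^sup>+ \<omega>. ecard (points \<omega> \<inter> A) ^ n \<partial>P) \<le> (\<integral>\<^sup>+ \<omega>. 1 \<partial>P)"
    proof (rule nn_integral_mono_AE)
      show "AE \<omega> in P. ecard (points \<omega> \<inter> A) ^ n \<le> 1"
        using points_null[OF A(1) \<open>emeasure \<mu> A = 0\<close>]
        by eventually_elim (cases n; simp)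
    qed
    also have "\<dots> < \<infinity>" by (simp add: emeasure_space_1)
    finally show ?thesis .
  qed
next
  case False
  then have "A \<in> finite_pos_sets \<mu>" using A by (auto simp: finite_pos_sets_def intro: gr_zeroI)
  moreover have "1 \<le> n" using False by linarith
  ultimately have "(\<integral>\<^sup>+ \<omega>. emeasure (N \<omega>) A ^ n \<partial>P) < \<infinity>"
    by (rule N_moments[unfolded all_moments_def, rule_format, rotated])
  then show ?thesis using A by (simp add: emeasure_N cong: nn_integral_cong)
qed

text \<open>Subsets of the points that are selected in a measurable and equivariant way.\<close>

definition factor_set :: "('w \<Rightarrow> 'a set) \<Rightarrow> bool" where
  "factor_set R \<longleftrightarrow> random_set P R \<and> (\<forall>\<omega>\<in>space P. R \<omega> \<subseteq> points \<omega>) \<and>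
     (AE \<omega> in P. R (S \<omega>) = T ` R \<omega>)"

lemma factor_set_random: "factor_set R \<Longrightarrow> random_set P R"
  and factor_set_subset: "factor_set R \<Longrightarrow> \<omega> \<in> space P \<Longrightarrow> R \<omega> \<subseteq> points \<omega>"
  and factor_set_S: "factor_set R \<Longrightarrow> AE \<omega> in P. R (S \<omega>) = T ` R \<omega>"
  by (simp_all add: factor_set_def)

lemma product_map_tuples:
  assumes "\<And>i. i \<in> {1..n} \<Longrightarrow> R i (S \<omega>) = T ` R i \<omega>"
  shows "product_map n T ` tuples n R \<omega> = tuples n R (S \<omega>)"
proof
  have inj: "inj T" using bij_T by (rule bij_is_inj)
  show "product_map n T ` tuples n R \<omega> \<subseteq> tuples n R (S \<omega>)"
  proof
    fix y assume "y \<in> product_map n T ` tuples n R \<omega>"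
    then obtain x where x: "x \<in> tuples n R \<omega>" "y = product_map n T x" by auto
    have "inj_on y {1..n}"
    proof (rule inj_onI)
      fix i j assume ij: "i \<in> {1..n}" "j \<in> {1..n}" "y i = y j"
      have eq: "x i = x j" using ij inj by (simp add: x product_map_def inj_eq)
      have "inj_on x {1..n}" using x(1) by (simp add: tuples_def)
      then show "i = j" using eq ij(1,2) by (rule inj_onD)
    qed
    moreover have "y i \<in> R i (S \<omega>)" if "i \<in> {1..n}" for i
    proof -
      have "x i \<in> R i \<omega>" using x(1) that by (auto simp: tuples_def)
      then show ?thesis using that assms by (auto simp: x product_map_def)
    qed
    ultimately show "y \<in> tuples n R (S \<omega>)" by (auto simp: x product_map_def tuples_def)
  qed
  show "tuples n R (S \<omega>) \<subseteq> product_map n T ` tuples n R \<omega>"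
  proof
    fix y assume y: "y \<in> tuples n R (S \<omega>)"
    define x where "x = (\<lambda>i\<in>{1..n}. inv T (y i))"
    have inv: "T (inv T z) = z" for z using bij_T by (rule bij_inv_eq_iff[THEN iffD1, OF _ refl])
    have yx: "y = product_map n T x"
      using y by (auto simp: x_def product_map_def fun_eq_iff inv tuples_def PiE_iff extensional_def)
    have "x i \<in> R i \<omega>" if "i \<in> {1..n}" for i
    proof -
      have "y i \<in> R i (S \<omega>)" using y that by (auto simp: tuples_def)
      then have "y i \<in> T ` R i \<omega>" using assms[OF that] by simp
      then obtain z where z: "z \<in> R i \<omega>" "y i = T z" by blast
      then have "x i = z" using that inj by (simp add: x_def)
      then show ?thesis using z by simp
    qed
    moreover have "inj_on x {1..n}"
    proof (rule inj_onI)
      fix i j assume ij: "i \<in> {1..n}" "j \<in> {1..n}" "x i = x j"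
      have eq: "y i = y j" unfolding yx product_map_def using ij by simp
      have "inj_on y {1..n}" using y by (simp add: tuples_def)
      then show "i = j" using eq ij(1,2) by (rule inj_onD)
    qed
    ultimately have "x \<in> tuples n R \<omega>" by (auto simp: tuples_def x_def)
    then show "y \<in> product_map n T ` tuples n R \<omega>" using yx by blast
  qed
qed

text \<open>The intensity of the tuples is an invariant measure on the product space, because \<open>S\<close>
  preserves \<open>P\<close> and factor sets are equivariant; the moments of \<open>N\<close> make it boundedly finite.\<close>

lemma tuples_intensity:
  assumes n: "1 \<le> n" and R: "\<And>i. i \<in> {1..n} \<Longrightarrow> factor_set (R i)"
    and orb: "AE \<omega> in P. \<forall>x\<in>tuples n R \<omega>. \<not> meets_orbit_twice n x"
  obtains c where "c < \<infinity>" "\<And>A. (\<And>i. i \<in> {1..n} \<Longrightarrow> A i \<in> sets borel) \<Longrightarrow>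
      (\<integral>\<^sup>+ \<omega>. ecard (tuples n R \<omega> \<inter> PiE {1..n} A) \<partial>P) = c * (\<Prod>i\<in>{1..n}. emeasure \<mu> (A i))"
proof -
  let ?M = "PiM {1..n} (\<lambda>_. borel :: 'a measure)"
  have meas [measurable]: "(\<lambda>\<omega>. ecard (tuples n R \<omega> \<inter> B)) \<in> borel_measurable P" if "B \<in> sets ?M" for B
    using that R by (intro tuples_measurable factor_set_random)
  define \<sigma> where "\<sigma> = measure_of (space ?M) (sets ?M) (\<lambda>B. \<integral>\<^sup>+ \<omega>. ecard (tuples n R \<omega> \<inter> B) \<partial>P)"
  have sets_\<sigma> [measurable_cong, simp]: "sets \<sigma> = sets ?M" and space_\<sigma>: "space \<sigma> = space ?M"
    by (simp_all add: \<sigma>_def)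
  have em: "emeasure \<sigma> B = (\<integral>\<^sup>+ \<omega>. ecard (tuples n R \<omega> \<inter> B) \<partial>P)" if "B \<in> sets ?M" for B
    unfolding \<sigma>_def
  proof (rule emeasure_measure_of_sigma)
    show "countably_additive (sets ?M) (\<lambda>B. \<integral>\<^sup>+ \<omega>. ecard (tuples n R \<omega> \<inter> B) \<partial>P)"
    proof (rule countably_additiveI)
      fix B :: "nat \<Rightarrow> _" assume B: "range B \<subseteq> sets ?M" "disjoint_family B" "(\<Union>i. B i) \<in> sets ?M"
      have "(\<Sum>i. \<integral>\<^sup>+ \<omega>. ecard (tuples n R \<omega> \<inter> B i) \<partial>P) = (\<integral>\<^sup>+ \<omega>. (\<Sum>i. ecard (tuples n R \<omega> \<inter> B i)) \<partial>P)"
        using B by (intro nn_integral_suminf[symmetric]) auto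
      also have "\<dots> = (\<integral>\<^sup>+ \<omega>. ecard (tuples n R \<omega> \<inter> (\<Union>i. B i)) \<partial>P)"
      proof (rule nn_integral_cong)
        fix \<omega>
        have "disjoint_family (\<lambda>i. tuples n R \<omega> \<inter> B i)"
          using B(2) unfolding disjoint_family_on_def by blast
        from ecard_UN_disjoint[OF this]
        show "(\<Sum>i. ecard (tuples n R \<omega> \<inter> B i)) = ecard (tuples n R \<omega> \<inter> (\<Union>i. B i))"
          unfolding Int_UN_distrib by (rule sym)
      qed
      finally show "(\<Sum>i. \<integral>\<^sup>+ \<omega>. ecard (tuples n R \<omega> \<inter> B i) \<partial>P) = (\<integral>\<^sup>+ \<omega>. ecard (tuples n R \<omega> \<inter> (\<Union>i. B i)) \<partial>P)" .
    qed
  qed (use that in \<open>auto simp: sets.sigma_algebra_axioms positive_def\<close>)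
  have bdd: "\<sigma> \<in> boundedly_finite_measures n"
    unfolding boundedly_finite_measures_def
  proof (intro CollectI conjI ballI impI)
    fix B assume B: "B \<in> sets \<sigma>" and bB: "\<forall>i\<in>{1..n}. bounded ((\<lambda>x. x i) ` B)"
    have "bounded (\<Union>i\<in>{1..n}. (\<lambda>x. x i) ` B)" using bB by (intro bounded_UN) auto
    then obtain a r where ar: "(\<Union>i\<in>{1..n}. (\<lambda>x. x i) ` B) \<subseteq> cball a r"
      by (auto simp: bounded_subset_cball)
    have "emeasure \<sigma> B \<le> (\<integral>\<^sup>+ \<omega>. ecard (points \<omega> \<inter> cball a r) ^ n \<partial>P)"
      unfolding em[OF B[unfolded sets_\<sigma>]]
    proof (rule nn_integral_mono)
      fix \<omega> assume \<omega>: "\<omega> \<in> space P"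
      have fin: "finite (points \<omega> \<inter> cball a r)"
        using random_set_locally_finite[OF random_set_points \<omega>] by (simp add: locally_finite_def)
      show "ecard (tuples n R \<omega> \<inter> B) \<le> ecard (points \<omega> \<inter> cball a r) ^ n"
      proof (rule ecard_tuples_le[OF _ _ fin])
        show "R i \<omega> \<subseteq> points \<omega>" if "i \<in> {1..n}" for i by (rule factor_set_subset[OF R[OF that] \<omega>])
        show "x i \<in> cball a r" if "x \<in> B" "i \<in> {1..n}" for x i using that ar by blast
      qed
    qed
    also have "\<dots> < \<infinity>" by (intro moment_finite mu_bounded) auto
    finally show "emeasure \<sigma> B < \<infinity>" .
  qed simp
  have pm [measurable]: "product_map n T \<in> ?M \<rightarrow>\<^sub>M ?M"
    unfolding product_map_def
    by (intro measurable_restrict measurable_compose[OF _ T_measurable] measurable_component_singleton)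
  have inv: "distr \<sigma> \<sigma> (product_map n T) = \<sigma>"
  proof (rule measure_eqI)
    fix B assume "B \<in> sets (distr \<sigma> \<sigma> (product_map n T))"
    then have B [measurable]: "B \<in> sets ?M" by simp
    let ?B = "product_map n T -` B \<inter> space ?M"
    have B' [measurable]: "?B \<in> sets ?M" by measurable
    have "AE \<omega> in P. \<forall>i\<in>{1..n}. R i (S \<omega>) = T ` R i \<omega>"
      using factor_set_S[OF R] by (intro AE_finite_allI) auto
    then have ae: "AE \<omega> in P. ecard (tuples n R (S \<omega>) \<inter> B) = ecard (tuples n R \<omega> \<inter> ?B)"
    proof eventually_elim
      case (elim \<omega>)
      have sub: "tuples n R \<omega> \<subseteq> space ?M" by (auto simp: tuples_def space_PiM)
      have "tuples n R (S \<omega>) \<inter> B = product_map n T ` (tuples n R \<omega> \<inter> ?B)"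
      proof -
        have img: "tuples n R (S \<omega>) = product_map n T ` tuples n R \<omega>"
          by (rule product_map_tuples[symmetric]) (use elim in blast)
        show ?thesis unfolding img using sub by auto
      qed
      moreover have "inj_on (product_map n T) (tuples n R \<omega> \<inter> ?B)"
      proof (rule inj_onI)
        fix x y assume xy: "x \<in> tuples n R \<omega> \<inter> ?B" "y \<in> tuples n R \<omega> \<inter> ?B"
          "product_map n T x = product_map n T y"
        show "x = y"
        proof (rule PiE_ext)
          show "x \<in> PiE {1..n} (\<lambda>i. R i \<omega>)" "y \<in> PiE {1..n} (\<lambda>i. R i \<omega>)"
            using xy by (auto simp: tuples_def)
          fix i assume "i \<in> {1..n}"
          then have "T (x i) = T (y i)" using xy(3) by (metis product_map_def restrict_apply')
          then show "x i = y i" using bij_T by (simp add: bij_is_inj inj_eq)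
        qed
      qed
      ultimately show ?case by (simp add: ecard_image)
    qed
    have "emeasure (distr \<sigma> \<sigma> (product_map n T)) B = emeasure \<sigma> ?B"
      by (subst emeasure_distr) (auto simp: space_\<sigma>)
    also have "\<dots> = (\<integral>\<^sup>+ \<omega>. ecard (tuples n R (S \<omega>) \<inter> B) \<partial>P)"
      unfolding em[OF B'] using ae by (intro nn_integral_cong_AE) auto
    also have "\<dots> = emeasure \<sigma> B" unfolding em[OF B]
      by (rule nn_integral_S) simp
    finally show "emeasure (distr \<sigma> \<sigma> (product_map n T)) B = emeasure \<sigma> B" .
  qed simp
  have ac: "absolutely_continuous \<mu> (distr \<sigma> borel (\<lambda>x. x i))" if i: "i \<in> {1..n}" for i
    unfolding absolutely_continuous_def
  proof
    fix A assume "A \<in> null_sets \<mu>"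
    then have A: "A \<in> sets borel" "emeasure \<mu> A = 0" by auto
    note [measurable] = A(1)
    have [measurable]: "(\<lambda>x. x i) \<in> ?M \<rightarrow>\<^sub>M borel" using i by (rule measurable_component_singleton)
    let ?B = "(\<lambda>x. x i) -` A \<inter> space ?M"
    have "AE \<omega> in P. ecard (tuples n R \<omega> \<inter> ?B) = 0"
      using points_null[OF A] AE_space
    proof eventually_elim
      case (elim \<omega>)
      then have "R i \<omega> \<inter> A = {}" using factor_set_subset[OF R[OF i]] by blast
      then show ?case using i by (auto simp: tuples_def)
    qed
    then have "emeasure \<sigma> ?B = 0"
      by (subst em) (auto simp: nn_integral_0_iff_AE)
    then show "A \<in> null_sets (distr \<sigma> borel (\<lambda>x. x i))"
      using A by (intro null_setsI) (auto simp: emeasure_distr space_\<sigma>)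
  qed
  have "AE \<omega> in P. ecard (tuples n R \<omega> \<inter> {x \<in> space ?M. meets_orbit_twice n x}) = 0"
    using orb by eventually_elim auto
  then have null: "emeasure \<sigma> {x \<in> space ?M. meets_orbit_twice n x} = 0"
    by (subst em) (auto simp: nn_integral_0_iff_AE)
  obtain c where c: "c < \<infinity>" "\<And>A. (\<And>i. i \<in> {1..n} \<Longrightarrow> A i \<in> sets borel) \<Longrightarrow>
      emeasure \<sigma> (PiE {1..n} A) = c * (\<Prod>i\<in>{1..n}. emeasure \<mu> (A i))"
    using invariant_measure_on_distinct_orbits[OF property2 n bdd inv ac null] by blast
  show ?thesis
  proof (rule that[OF c(1)])
    fix A :: "nat \<Rightarrow> 'a set" assume A: "\<And>i. i \<in> {1..n} \<Longrightarrow> A i \<in> sets borel"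
    then have "PiE {1..n} A \<in> sets ?M" by (intro sets_PiM_I_finite) auto
    then show "(\<integral>\<^sup>+ \<omega>. ecard (tuples n R \<omega> \<inter> PiE {1..n} A) \<partial>P) = c * (\<Prod>i\<in>{1..n}. emeasure \<mu> (A i))"
      using em[of "PiE {1..n} A"] c(2)[of A] A by simp
  qed
qed

text \<open>For \<open>n = 1\<close> no tuple meets an orbit twice.\<close>

lemma factor_set_intensity:
  assumes R: "factor_set R"
  obtains c where "c < \<infinity>" "\<And>A. A \<in> sets borel \<Longrightarrow> (\<integral>\<^sup>+ \<omega>. ecard (R \<omega> \<inter> A) \<partial>P) = c * emeasure \<mu> A"
proof -
  obtain c where c: "c < \<infinity>" "\<And>A. (\<And>i. i \<in> {1..1} \<Longrightarrow> A i \<in> sets borel) \<Longrightarrow>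
      (\<integral>\<^sup>+ \<omega>. ecard (tuples 1 (\<lambda>_. R) \<omega> \<inter> PiE {1..1} A) \<partial>P) = c * (\<Prod>i\<in>{1..1}. emeasure \<mu> (A i))"
    by (rule tuples_intensity[of 1 "\<lambda>_. R"]) (use R in \<open>auto simp: meets_orbit_twice_def\<close>)
  have "ecard (tuples 1 (\<lambda>_. R) \<omega> \<inter> PiE {1..1} (\<lambda>_. A)) = ecard (R \<omega> \<inter> A)" for \<omega> A
  proof (rule ecard_bij_betw)
    show "bij_betw (\<lambda>x. x 1) (tuples 1 (\<lambda>_. R) \<omega> \<inter> PiE {1..1} (\<lambda>_. A)) (R \<omega> \<inter> A)"
      by (rule bij_betwI[where g = "\<lambda>y. \<lambda>i\<in>{1::nat}. y"])
        (auto simp: tuples_def fun_eq_iff PiE_iff extensional_def)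
  qed
  then show ?thesis using that[OF c(1)] c(2)[of "\<lambda>_. _"] by simp
qed

end

section \<open>Clusters of points on a common orbit\<close>

lemma ecard_times: "ecard (X \<times> Y) = ecard X * ecard Y"
proof (cases "X = {} \<or> Y = {}")
  case False
  then show ?thesis
    by (cases "finite X"; cases "finite Y")
      (auto simp: ecard_finite ecard_infinite card_cartesian_product finite_cartesian_product_iff
        ennreal_mult_top ennreal_top_mult)
qed auto

context ergodic_process
begin

text \<open>The pattern of the cluster of \<open>x\<close>, seen from \<open>x\<close>.\<close>

definition offsets :: "'w \<Rightarrow> 'a \<Rightarrow> int set" where
  "offsets \<omega> x = {k. it k x \<in> points \<omega>}"

lemma offsets_it: "offsets \<omega> (it m x) = (\<lambda>k. k - m) ` offsets \<omega> x"
proof (intro equalityI subsetI)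
  fix k assume "k \<in> offsets \<omega> (it m x)"
  then have "k + m \<in> offsets \<omega> x" by (simp add: offsets_def it_add)
  then show "k \<in> (\<lambda>k. k - m) ` offsets \<omega> x" by (auto intro!: image_eqI[of _ _ "k + m"])
next
  fix k assume "k \<in> (\<lambda>k. k - m) ` offsets \<omega> x"
  then have "k + m \<in> offsets \<omega> x" by auto
  then show "k \<in> offsets \<omega> (it m x)" by (simp add: offsets_def it_add)
qed

lemma offsets_S:
  assumes "points (S \<omega>) = T ` points \<omega>" shows "offsets (S \<omega>) (T x) = offsets \<omega> x"
  using bij_T by (auto simp: offsets_def assms it_T bij_is_inj inj_image_mem_iff)

text \<open>Patterns are invariant under the joint action of \<open>S\<close> and \<open>T\<close>, so points may be selected by
  their patterns.\<close>

lemma factor_set_offsets: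
  assumes \<Phi>: "\<And>x. x \<in> P \<rightarrow>\<^sub>M borel \<Longrightarrow> {\<omega> \<in> space P. \<Phi> (offsets \<omega> (x \<omega>))} \<in> sets P"
  shows "factor_set (\<lambda>\<omega>. {x \<in> points \<omega>. \<Phi> (offsets \<omega> x)})"
  unfolding factor_set_def
proof (intro conjI ballI)
  show "random_set P (\<lambda>\<omega>. {x \<in> points \<omega>. \<Phi> (offsets \<omega> x)})"
    by (rule random_set_filter[OF random_set_points]) (rule \<Phi>)
  show "AE \<omega> in P. {x \<in> points (S \<omega>). \<Phi> (offsets (S \<omega>) x)} = T ` {x \<in> points \<omega>. \<Phi> (offsets \<omega> x)}"
    using points_S
  proof eventually_elim
    case (elim \<omega>)
    note offsets_S[OF elim]
    then show ?case unfolding elim by auto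
  qed
qed auto

lemma offset_measurable:
  assumes [measurable]: "x \<in> P \<rightarrow>\<^sub>M borel"
  shows "{\<omega> \<in> space P. k \<in> offsets \<omega> (x \<omega>)} \<in> sets P"
  unfolding offsets_def mem_Collect_eq
  by (rule random_set_member[OF random_set_points]) measurable

definition paired :: "int \<Rightarrow> 'w \<Rightarrow> 'a set" where
  "paired k \<omega> = {x \<in> points \<omega>. k \<in> offsets \<omega> x}"

lemma factor_set_paired: "factor_set (paired k)"
  unfolding paired_def by (rule factor_set_offsets) (rule offset_measurable)

definition pair_intensity :: "int \<Rightarrow> ennreal" where
  "pair_intensity k = (SOME c. \<forall>A\<in>sets borel. (\<integral>\<^sup>+ \<omega>. ecard (paired k \<omega> \<inter> A) \<partial>P) = c * emeasure \<mu> A)"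

lemma pair_intensity:
  "A \<in> sets borel \<Longrightarrow> (\<integral>\<^sup>+ \<omega>. ecard (paired k \<omega> \<inter> A) \<partial>P) = pair_intensity k * emeasure \<mu> A"
proof -
  have "\<exists>c. \<forall>A\<in>sets borel. (\<integral>\<^sup>+ \<omega>. ecard (paired k \<omega> \<inter> A) \<partial>P) = c * emeasure \<mu> A"
    using factor_set_intensity[OF factor_set_paired[of k]] by metis
  from someI_ex[OF this] show "A \<in> sets borel \<Longrightarrow> ?thesis"
    unfolding pair_intensity_def by blast
qed

lemma paired_minus: "paired (- k) \<omega> = it k ` paired k \<omega>"
proof (intro equalityI subsetI)
  fix y assume "y \<in> paired (- k) \<omega>"
  then have "it (- k) y \<in> paired k \<omega>" by (simp add: paired_def offsets_def)
  then show "y \<in> it k ` paired k \<omega>" by (auto intro!: image_eqI[of _ _ "it (- k) y"])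
qed (auto simp: paired_def offsets_def)

text \<open>Both intensities count the same pairs \<open>(x, T^k x)\<close>, once by each of their two points.\<close>

lemma pair_intensity_minus: "pair_intensity (- k) = pair_intensity k"
proof -
  obtain b where b: "0 < emeasure \<mu> (cell b)" "emeasure \<mu> (cell b) < \<infinity>"
    by (rule ex_finite_positive)
  have "paired (- k) \<omega> \<inter> cell b = it k ` (paired k \<omega> \<inter> it k -` cell b)" for \<omega>
    by (auto simp: paired_minus)
  then have "ecard (paired (- k) \<omega> \<inter> cell b) = ecard (paired k \<omega> \<inter> it k -` cell b)" for \<omega>
    by (simp add: ecard_image inj_on_def)
  then have "pair_intensity (- k) * emeasure \<mu> (cell b) = pair_intensity k * emeasure \<mu> (it k -` cell b)"
    by (simp flip: pair_intensity)
  then have "pair_intensity (- k) * emeasure \<mu> (cell b) = pair_intensity k * emeasure \<mu> (cell b)"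
    by (simp add: emeasure_it_vimage)
  then have "pair_intensity (- k) * emeasure \<mu> (cell b) / emeasure \<mu> (cell b)
      = pair_intensity k * emeasure \<mu> (cell b) / emeasure \<mu> (cell b)" by simp
  then show ?thesis using b by (simp add: ennreal_mult_divide_eq less_top[symmetric])
qed

text \<open>By aperiodicity the pairs \<open>(x, T^k x)\<close> with different \<open>k\<close> are different, and all of them lie
  in \<open>D \<times> D\<close>.\<close>

lemma sum_paired_le:
  assumes x: "\<forall>x\<in>points \<omega>. aperiodic x"
  shows "(\<Sum>k\<le>m. ecard (paired (int k) \<omega> \<inter> (D \<inter> it (int k) -` D))) \<le> ecard (points \<omega> \<inter> D) ^ 2"
proof -
  let ?X = "\<lambda>k. paired (int k) \<omega> \<inter> (D \<inter> it (int k) -` D)"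
  let ?g = "\<lambda>k x. (x, it (int k) x)"
  have "(\<Sum>k\<le>m. ecard (?X k)) = (\<Sum>k\<le>m. ecard (?g k ` ?X k))"
    by (intro sum.cong refl ecard_image[symmetric]) (auto simp: inj_on_def)
  also have "\<dots> = ecard (\<Union>k\<le>m. ?g k ` ?X k)"
  proof (rule ecard_UN_disjoint_finite[symmetric])
    show "disjoint_family_on (\<lambda>k. ?g k ` ?X k) {..m}"
      unfolding disjoint_family_on_def
    proof (intro ballI impI equals0I)
      fix i j p assume "i \<noteq> j" "p \<in> ?g i ` ?X i \<inter> ?g j ` ?X j"
      then obtain x where "x \<in> points \<omega>" "it (int i) x = it (int j) x"
        by (auto simp: paired_def)
      then show False using x \<open>i \<noteq> j\<close> by (auto simp: aperiodic_inj)
    qed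
  qed simp
  also have "\<dots> \<le> ecard ((points \<omega> \<inter> D) \<times> (points \<omega> \<inter> D))"
    by (rule ecard_mono) (auto simp: paired_def offsets_def)
  finally show ?thesis by (simp add: ecard_times power2_eq_square)
qed

text \<open>Otherwise there would be, for every \<open>j\<close>, a tower of measure at most \<open>2^(-j)\<close> that is so high
  that its second moment is at least \<open>j\<close>. The union of these towers would have finite measure and an
  infinite second moment.\<close>

lemma pair_intensity_summable: "(\<Sum>k. pair_intensity (int k)) < \<infinity>"
proof (rule ccontr)
  assume "\<not> ?thesis"
  then have inf: "(\<Sum>k. pair_intensity (int k)) = \<top>" unfolding infinity_ennreal_def less_top[symmetric] by (rule notnotD)
  let ?M = "\<lambda>D. \<integral>\<^sup>+ \<omega>. ecard (points \<omega> \<inter> D) ^ 2 \<partial>P"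
  have ex: "\<exists>D. D \<in> sets borel \<and> emeasure \<mu> D \<le> ennreal ((1/2) ^ j) \<and> ennreal (real j) \<le> ?M D" for j :: nat
  proof -
    have "(\<lambda>m. \<Sum>k\<le>m. pair_intensity (int k)) \<longlonglongrightarrow> \<top>"
      using summable_LIMSEQ'[of "\<lambda>k. pair_intensity (int k)"] inf by simp
    then have "\<forall>\<^sub>F m in sequentially. ennreal (real j * 4 * 2 ^ j) < (\<Sum>k\<le>m. pair_intensity (int k))"
      by (rule order_tendstoD) simp
    then obtain m where m: "ennreal (real j * 4 * 2 ^ j) < (\<Sum>k\<le>m. pair_intensity (int k))"
      unfolding eventually_sequentially by blast
    obtain D where D [measurable]: "D \<in> sets borel" and De: "emeasure \<mu> D \<le> ennreal ((1/2) ^ j)"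
      and tow: "\<And>k::nat. 2 * k \<le> 2 * m + 1 \<Longrightarrow> ennreal ((1/2) ^ j / 4) \<le> emeasure \<mu> (D \<inter> it (int k) -` D)"
      using tower[of "2 * m + 1" "(1/2) ^ j"] by auto
    have "ennreal (real j) = ennreal (real j * 4 * 2 ^ j) * ennreal ((1/2) ^ j / 4)"
      by (simp flip: ennreal_mult add: power_divide)
    also have "\<dots> \<le> (\<Sum>k\<le>m. pair_intensity (int k)) * ennreal ((1/2) ^ j / 4)"
      using m by (intro mult_right_mono) auto
    also have "\<dots> \<le> (\<Sum>k\<le>m. pair_intensity (int k) * emeasure \<mu> (D \<inter> it (int k) -` D))"
      unfolding sum_distrib_right using tow by (intro sum_mono mult_left_mono) auto
    also have "\<dots> = (\<Sum>k\<le>m. \<integral>\<^sup>+ \<omega>. ecard (paired (int k) \<omega> \<inter> (D \<inter> it (int k) -` D)) \<partial>P)"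
      by (intro sum.cong refl pair_intensity[symmetric]) measurable
    also have "\<dots> = (\<integral>\<^sup>+ \<omega>. (\<Sum>k\<le>m. ecard (paired (int k) \<omega> \<inter> (D \<inter> it (int k) -` D))) \<partial>P)"
      by (intro nn_integral_sum[symmetric] random_set_measurable factor_set_random factor_set_paired) measurable
    also have "\<dots> \<le> ?M D"
    proof (rule nn_integral_mono_AE)
      show "AE \<omega> in P. (\<Sum>k\<le>m. ecard (paired (int k) \<omega> \<inter> (D \<inter> it (int k) -` D))) \<le> ecard (points \<omega> \<inter> D) ^ 2"
        using AE_aperiodic_points by eventually_elim (rule sum_paired_le)
    qed
    finally show ?thesis using D De by blast
  qed
  then obtain D where D [measurable]: "\<And>j. D j \<in> sets borel"
    and De: "\<And>j. emeasure \<mu> (D j) \<le> ennreal ((1/2) ^ j)" and Dj: "\<And>j. ennreal (real j) \<le> ?M (D j)"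
    by metis
  have "emeasure \<mu> (\<Union>j. D j) \<le> (\<Sum>j. emeasure \<mu> (D j))"
    by (rule emeasure_subadditive_countably) auto
  also have "\<dots> \<le> (\<Sum>j. ennreal ((1/2) ^ j))" by (intro suminf_le De) auto
  also have "\<dots> = ennreal (\<Sum>j. (1/2) ^ j)" by (rule suminf_ennreal2) auto
  also have "\<dots> < \<infinity>" by simp
  finally have "?M (\<Union>j. D j) < \<infinity>" by (intro moment_finite) auto
  then obtain r where r: "?M (\<Union>j. D j) = ennreal r" "0 \<le> r" by (cases "?M (\<Union>j. D j)") auto
  obtain j :: nat where "r < real j" using reals_Archimedean2 by blast
  have "ennreal (real j) \<le> ?M (D j)" by (rule Dj)
  also have "\<dots> \<le> ?M (\<Union>j. D j)"
    by (intro nn_integral_mono power_mono ecard_mono) auto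
  finally show False using r \<open>r < real j\<close> by (simp add: ennreal_le_iff)
qed

text \<open>By summability, the expected number of pairs \<open>(x, T^k x)\<close> of points with \<open>x\<close> in a given cell is
  finite. The sign \<open>s\<close> selects the future or the past of \<open>x\<close>.\<close>

lemma AE_finite_paired:
  assumes s: "s = 1 \<or> s = - 1"
  shows "AE \<omega> in P. \<forall>x\<in>points \<omega>. finite {k::nat. s * int k \<in> offsets \<omega> x}"
proof -
  have eq: "pair_intensity (s * int k) = pair_intensity (int k)" for k
    using s pair_intensity_minus by auto
  have "AE \<omega> in P. \<forall>x\<in>points \<omega> \<inter> cell b. finite {k::nat. s * int k \<in> offsets \<omega> x}" for b
  proof -
    have [measurable]: "(\<lambda>\<omega>. ecard (paired k \<omega> \<inter> cell b)) \<in> borel_measurable P" for k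
      by (intro random_set_measurable factor_set_random factor_set_paired) simp
    have "(\<integral>\<^sup>+ \<omega>. (\<Sum>k. ecard (paired (s * int k) \<omega> \<inter> cell b)) \<partial>P)
        = (\<Sum>k. \<integral>\<^sup>+ \<omega>. ecard (paired (s * int k) \<omega> \<inter> cell b) \<partial>P)"
      by (rule nn_integral_suminf) measurable
    also have "\<dots> = (\<Sum>k. pair_intensity (int k)) * emeasure \<mu> (cell b)"
      by (simp add: pair_intensity eq)
    also have "\<dots> < \<infinity>"
      using pair_intensity_summable mu_bounded[OF cell_borel bounded_cell]
      by (auto simp: ennreal_mult_less_top)
    finally have "(\<integral>\<^sup>+ \<omega>. (\<Sum>k. ecard (paired (s * int k) \<omega> \<inter> cell b)) \<partial>P) \<noteq> \<infinity>"
      by simp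
    then have "AE \<omega> in P. (\<Sum>k. ecard (paired (s * int k) \<omega> \<inter> cell b)) \<noteq> \<infinity>"
      by (rule nn_integral_PInf_AE[rotated]) measurable
    then show ?thesis
    proof eventually_elim
      case (elim \<omega>)
      show ?case
      proof
        fix x assume x: "x \<in> points \<omega> \<inter> cell b"
        have "ecard {k::nat. s * int k \<in> offsets \<omega> x} \<le> (\<Sum>k. ecard (paired (s * int k) \<omega> \<inter> cell b))"
          unfolding ecard_nat
        proof (rule suminf_le)
          fix k show "indicator {k. s * int k \<in> offsets \<omega> x} k \<le> ecard (paired (s * int k) \<omega> \<inter> cell b)"
          proof (cases "s * int k \<in> offsets \<omega> x")
            case True
            then have "{x} \<subseteq> paired (s * int k) \<omega> \<inter> cell b" using x by (auto simp: paired_def)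
            from ecard_mono[OF this] show ?thesis using True by simp
          qed simp
        qed auto
        then show "finite {k::nat. s * int k \<in> offsets \<omega> x}"
          using elim by (simp add: less_top flip: ecard_finite_iff)
      qed
    qed
  qed
  then have "AE \<omega> in P. \<forall>b. \<forall>x\<in>points \<omega> \<inter> cell b. finite {k::nat. s * int k \<in> offsets \<omega> x}"
    by (simp add: AE_all_countable)
  then show ?thesis by eventually_elim (use UN_cell in blast)
qed

lemma AE_finite_offsets: "AE \<omega> in P. \<forall>x\<in>points \<omega>. finite (offsets \<omega> x)"
  using AE_finite_paired[of 1, simplified] AE_finite_paired[of "- 1", simplified]
proof eventually_elim
  case (elim \<omega>)
  show ?case
  proof
    fix x assume x: "x \<in> points \<omega>"
    have "offsets \<omega> x \<subseteq> int ` {k. int k \<in> offsets \<omega> x} \<union> (\<lambda>k. - int k) ` {k. - int k \<in> offsets \<omega> x}"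
    proof
      fix k assume k: "k \<in> offsets \<omega> x"
      show "k \<in> int ` {k. int k \<in> offsets \<omega> x} \<union> (\<lambda>k. - int k) ` {k. - int k \<in> offsets \<omega> x}"
      proof (cases "0 \<le> k")
        case True
        then show ?thesis using k by (auto intro!: image_eqI[of _ _ "nat k"])
      next
        case False
        then show ?thesis using k by (auto intro!: image_eqI[of _ _ "nat (- k)"])
      qed
    qed
    then show "finite (offsets \<omega> x)" using elim x by (elim finite_subset) auto
  qed
qed

text \<open>The patterns of finite clusters, seen from their first points.\<close>

definition shapes :: "int set set" where
  "shapes = {J. finite J \<and> J \<noteq> {} \<and> Min J = 0}"

definition roots :: "int set \<Rightarrow> 'w \<Rightarrow> 'a set" where
  "roots J \<omega> = {x \<in> points \<omega>. offsets \<omega> x = J}"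

lemma countable_shapes: "countable shapes"
proof (rule countable_subset)
  show "shapes \<subseteq> {J. finite J}" by (auto simp: shapes_def)
  show "countable {J :: int set. finite J}" using countable_Collect_finite by simp
qed

lemma factor_set_roots: "factor_set (roots J)"
  unfolding roots_def
proof (rule factor_set_offsets)
  fix x :: "'w \<Rightarrow> 'a" assume [measurable]: "x \<in> P \<rightarrow>\<^sub>M borel"
  have "{\<omega> \<in> space P. k \<in> offsets \<omega> (x \<omega>) \<longleftrightarrow> k \<in> J} \<in> sets P" for k
    using offset_measurable[of x k] sets.sets_Collect_neg[OF offset_measurable[of x k]]
    by (cases "k \<in> J") auto
  then have "{\<omega> \<in> space P. \<forall>k. k \<in> offsets \<omega> (x \<omega>) \<longleftrightarrow> k \<in> J} \<in> sets P"
    by (rule sets.sets_Collect_countable_All)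
  moreover have "{\<omega> \<in> space P. \<forall>k. k \<in> offsets \<omega> (x \<omega>) \<longleftrightarrow> k \<in> J} = {\<omega> \<in> space P. offsets \<omega> (x \<omega>) = J}"
    by auto
  ultimately show "{\<omega> \<in> space P. offsets \<omega> (x \<omega>) = J} \<in> sets P" by simp
qed

lemma Min_offsets_it:
  assumes "finite (offsets \<omega> x)" "offsets \<omega> x \<noteq> {}"
  shows "Min (offsets \<omega> (it m x)) = Min (offsets \<omega> x) - m"
proof -
  have "mono (\<lambda>k::int. k - m)" by (auto simp: mono_def)
  from mono_Min_commute[OF this assms] show ?thesis by (simp add: offsets_it)
qed

text \<open>Moving the point of view by \<open>k\<close> shifts the minimum of the pattern by \<open>- k\<close>, so a cluster has
  only one root.\<close>

lemma roots_orbit: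
  assumes "J \<in> shapes" "J' \<in> shapes" "x \<in> roots J \<omega>" "it k x \<in> roots J' \<omega>"
  shows "k = 0" "J = J'"
proof -
  have "Min (offsets \<omega> (it k x)) = Min (offsets \<omega> x) - k"
    using assms by (intro Min_offsets_it) (auto simp: roots_def shapes_def)
  then show "k = 0" using assms by (auto simp: roots_def shapes_def)
  then show "J = J'" using assms by (auto simp: roots_def)
qed

lemma roots_disjoint: "J \<noteq> J' \<Longrightarrow> roots J \<omega> \<inter> roots J' \<omega> = {}"
  by (auto simp: roots_def)

text \<open>Each point is obtained from the first point of its cluster, in a unique way.\<close>

lemma points_decomposition:
  assumes fin: "\<forall>x\<in>points \<omega>. finite (offsets \<omega> x)"
  shows "points \<omega> = (\<Union>(J, j)\<in>Sigma shapes (\<lambda>J. J). it j ` roots J \<omega>)"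
    and "disjoint_family_on (\<lambda>(J, j). it j ` roots J \<omega>) (Sigma shapes (\<lambda>J. J))"
proof -
  show "points \<omega> = (\<Union>(J, j)\<in>Sigma shapes (\<lambda>J. J). it j ` roots J \<omega>)"
  proof (intro equalityI subsetI)
    fix y assume y: "y \<in> points \<omega>"
    let ?O = "offsets \<omega> y"
    define m where "m = Min ?O"
    have O: "finite ?O" "0 \<in> ?O" using fin y by (auto simp: offsets_def)
    then have m: "m \<in> ?O" unfolding m_def by (intro Min_in) auto
    define J where "J = offsets \<omega> (it m y)"
    have "Min J = 0" unfolding J_def using O by (subst Min_offsets_it) (auto simp: m_def)
    moreover have "finite J" "- m \<in> J" using O by (auto simp: J_def offsets_it)
    ultimately have "J \<in> shapes" by (auto simp: shapes_def)
    moreover have "it m y \<in> roots J \<omega>" using m by (simp add: roots_def J_def offsets_def)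
    then have "y \<in> it (- m) ` roots J \<omega>" by (auto intro!: image_eqI[of _ _ "it m y"])
    ultimately show "y \<in> (\<Union>(J, j)\<in>Sigma shapes (\<lambda>J. J). it j ` roots J \<omega>)"
      using \<open>- m \<in> J\<close> by blast
  qed (auto simp: roots_def offsets_def)
  show "disjoint_family_on (\<lambda>(J, j). it j ` roots J \<omega>) (Sigma shapes (\<lambda>J. J))"
    unfolding disjoint_family_on_def
  proof (intro ballI impI equals0I)
    fix p q y
    assume pq: "p \<in> Sigma shapes (\<lambda>J. J)" "q \<in> Sigma shapes (\<lambda>J. J)" "p \<noteq> q"
      and y: "y \<in> (case p of (J, j) \<Rightarrow> it j ` roots J \<omega>) \<inter> (case q of (J, j) \<Rightarrow> it j ` roots J \<omega>)"
    obtain J j J' j' where pq': "p = (J, j)" "q = (J', j')" by (cases p, cases q)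
    obtain x x' where x: "x \<in> roots J \<omega>" "y = it j x" "x' \<in> roots J' \<omega>" "y = it j' x'"
      using y by (auto simp: pq')
    have J: "J \<in> shapes" "J' \<in> shapes" using pq by (auto simp: pq')
    have "x' = it (- j') (it j x)" using x by (metis it_minus_cancel(1))
    then have "x' = it (- j' + j) x" by (simp only: it_add)
    then show False using roots_orbit[OF J x(1), of "- j' + j"] x(3) pq pq' by auto
  qed
qed

end

section \<open>Factorial moments of the root processes\<close>

text \<open>If the last coordinate is confined to a set that is disjoint from the others, injectivity puts
  no condition on it and the counts multiply.\<close>

lemma tuples_Suc_bij:
  assumes disj: "\<And>i. i \<in> {1..n} \<Longrightarrow> A i \<inter> A (Suc n) = {}"
  shows "bij_betw (\<lambda>x. (restrict x {1..n}, x (Suc n)))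
    (tuples (Suc n) R \<omega> \<inter> PiE {1..Suc n} A)
    ((tuples n R \<omega> \<inter> PiE {1..n} A) \<times> (R (Suc n) \<omega> \<inter> A (Suc n)))"
proof (rule bij_betwI[where g = "\<lambda>(y, z). y(Suc n := z)"])
  have ins: "{1..Suc n} = insert (Suc n) {1..n}" by auto
  show "(\<lambda>x. (restrict x {1..n}, x (Suc n))) \<in> tuples (Suc n) R \<omega> \<inter> PiE {1..Suc n} A \<rightarrow>
    (tuples n R \<omega> \<inter> PiE {1..n} A) \<times> (R (Suc n) \<omega> \<inter> A (Suc n))"
  proof (rule funcsetI)
    fix x assume x: "x \<in> tuples (Suc n) R \<omega> \<inter> PiE {1..Suc n} A"
    have xA: "x i \<in> A i" if "i \<in> {1..Suc n}" for i
      using IntD2[OF x] that by (rule PiE_mem)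
    have xP: "x \<in> PiE {1..Suc n} (\<lambda>i. R i \<omega>)" and inj: "inj_on x {1..Suc n}"
      using x by (simp_all add: tuples_def)
    have xR: "x i \<in> R i \<omega>" if "i \<in> {1..Suc n}" for i
      using xP that by (rule PiE_mem)
    have "inj_on (restrict x {1..n}) {1..n}"
      unfolding inj_on_restrict_eq by (rule inj_on_subset[OF inj]) auto
    moreover have "restrict x {1..n} \<in> PiE {1..n} A" by (rule PiE_I) (use xA in auto)
    moreover have "restrict x {1..n} \<in> PiE {1..n} (\<lambda>i. R i \<omega>)" by (rule PiE_I) (use xR in auto)
    ultimately show "(restrict x {1..n}, x (Suc n)) \<in>
        (tuples n R \<omega> \<inter> PiE {1..n} A) \<times> (R (Suc n) \<omega> \<inter> A (Suc n))"
      using xA[of "Suc n"] xR[of "Suc n"] by (simp add: tuples_def)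
  qed
  show "(\<lambda>(y, z). y(Suc n := z)) \<in> (tuples n R \<omega> \<inter> PiE {1..n} A) \<times> (R (Suc n) \<omega> \<inter> A (Suc n)) \<rightarrow>
    tuples (Suc n) R \<omega> \<inter> PiE {1..Suc n} A"
  proof (rule funcsetI, clarify)
    fix y z assume y: "y \<in> tuples n R \<omega>" "y \<in> PiE {1..n} A" and z: "z \<in> R (Suc n) \<omega>" "z \<in> A (Suc n)"
    have yA: "y i \<in> A i" if "i \<in> {1..n}" for i using PiE_mem[OF y(2) that] .
    have "y \<in> PiE {1..n} (\<lambda>i. R i \<omega>)" using y(1) by (simp add: tuples_def)
    then have yR: "y i \<in> R i \<omega>" if "i \<in> {1..n}" for i using that by (rule PiE_mem)
    have yu: "y i = undefined" if "i \<notin> {1..n}" for i using PiE_arb[OF y(2) that] .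
    have yz: "y i \<noteq> z" if "i \<in> {1..n}" for i using yA[OF that] z disj[OF that] by blast
    have inj: "inj_on y {1..n}" using y(1) by (simp add: tuples_def)
    have "inj_on (y(Suc n := z)) {1..Suc n}"
    proof (rule inj_onI)
      fix i j assume ij: "i \<in> {1..Suc n}" "j \<in> {1..Suc n}" and eq: "(y(Suc n := z)) i = (y(Suc n := z)) j"
      have "i \<in> {1..n}" if "i \<noteq> Suc n" using that ij by simp
      moreover have "j \<in> {1..n}" if "j \<noteq> Suc n" using that ij by simp
      ultimately show "i = j"
        using eq yz[of i] yz[of j] inj_onD[OF inj, of i j] by (cases "i = Suc n"; cases "j = Suc n") simp_all
    qed
    moreover have "y(Suc n := z) \<in> PiE {1..Suc n} (\<lambda>i. R i \<omega>)" "y(Suc n := z) \<in> PiE {1..Suc n} A"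
    proof -
      have "(y(Suc n := z)) i \<in> R i \<omega> \<inter> A i" if "i \<in> {1..Suc n}" for i
        using that yA[of i] yR[of i] z by (cases "i = Suc n") auto
      moreover have "(y(Suc n := z)) i = undefined" if "i \<notin> {1..Suc n}" for i
        using that yu[of i] by auto
      ultimately show "y(Suc n := z) \<in> PiE {1..Suc n} (\<lambda>i. R i \<omega>)" "y(Suc n := z) \<in> PiE {1..Suc n} A"
        by (auto intro!: PiE_I simp del: fun_upd_apply)
    qed
    ultimately show "y(Suc n := z) \<in> tuples (Suc n) R \<omega> \<inter> PiE {1..Suc n} A"
      unfolding tuples_def Int_iff mem_Collect_eq by (intro conjI)
  qed
  show "(\<lambda>(y, z). y(Suc n := z)) (restrict x {1..n}, x (Suc n)) = x"
    if "x \<in> tuples (Suc n) R \<omega> \<inter> PiE {1..Suc n} A" for x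
  proof
    fix i
    have "x i = undefined" if "i \<notin> {1..Suc n}"
      using IntD2[OF \<open>x \<in> _\<close>] that by (rule PiE_arb)
    then show "(\<lambda>(y, z). y(Suc n := z)) (restrict x {1..n}, x (Suc n)) i = x i"
      by (cases "i \<in> {1..Suc n}") auto
  qed
  show "(\<lambda>x. (restrict x {1..n}, x (Suc n))) ((\<lambda>(y, z). y(Suc n := z)) p) = p"
    if p0: "p \<in> (tuples n R \<omega> \<inter> PiE {1..n} A) \<times> (R (Suc n) \<omega> \<inter> A (Suc n))" for p
  proof -
    obtain y z where p: "p = (y, z)" "y \<in> PiE {1..n} A" using p0 by (cases p) auto
    have "restrict (y(Suc n := z)) {1..n} = y"
    proof
      fix i show "restrict (y(Suc n := z)) {1..n} i = y i"
        using PiE_arb[OF p(2), of i] by (cases "i \<in> {1..n}") auto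
    qed
    then show ?thesis by (simp add: p)
  qed
qed

text \<open>A pair of points consists of distinct points or lies on the diagonal.\<close>

lemma ecard_product_two:
  "ecard (X \<inter> A) * ecard (X \<inter> B) =
     ecard (tuples 2 (\<lambda>_ _. X) \<omega> \<inter> PiE {1..2} (\<lambda>i. if i = 1 then A else B)) + ecard (X \<inter> (A \<inter> B))"
proof -
  let ?Q = "(X \<inter> A) \<times> (X \<inter> B)" and ?T = "tuples 2 (\<lambda>_ _. X) \<omega> \<inter> PiE {1..2} (\<lambda>i. if i = 1 then A else B)"
  have two: "{1..2::nat} = {1, 2}" by auto
  have "ecard ?Q = ecard ({p \<in> ?Q. fst p \<noteq> snd p} \<union> {p \<in> ?Q. fst p = snd p})"
    by (rule arg_cong[where f = ecard]) auto
  also have "\<dots> = ecard {p \<in> ?Q. fst p \<noteq> snd p} + ecard {p \<in> ?Q. fst p = snd p}"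
    by (rule ecard_Un_disjoint) auto
  also have "ecard {p \<in> ?Q. fst p = snd p} = ecard (X \<inter> (A \<inter> B))"
    by (rule ecard_bij_betw[of fst], rule bij_betwI[where g = "\<lambda>x. (x, x)"]) auto
  also have "ecard {p \<in> ?Q. fst p \<noteq> snd p} = ecard ?T"
  proof (rule ecard_bij_betw, rule bij_betwI)
    show "(\<lambda>p. \<lambda>i\<in>{1..2::nat}. if i = 1 then fst p else snd p) \<in> {p \<in> ?Q. fst p \<noteq> snd p} \<rightarrow> ?T"
      by (rule funcsetI) (auto simp: tuples_def two PiE_iff)
    show "(\<lambda>x. (x 1, x 2)) \<in> ?T \<rightarrow> {p \<in> ?Q. fst p \<noteq> snd p}"
      by (rule funcsetI) (auto simp: tuples_def two PiE_iff)
    show "(\<lambda>x. (x 1, x 2)) (\<lambda>i\<in>{1..2::nat}. if i = 1 then fst p else snd p) = p" for p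
      by (simp add: two)
    show "(\<lambda>i\<in>{1..2::nat}. if i = 1 then fst (x 1, x 2) else snd (x 1, x 2)) = x" if "x \<in> ?T" for x
    proof
      fix i show "(\<lambda>i\<in>{1..2::nat}. if i = 1 then fst (x 1, x 2) else snd (x 1, x 2)) i = x i"
        using that PiE_arb[of x "{1..2}" _ i] by (cases "i \<in> {1..2}") (auto simp: two)
    qed
  qed
  finally show ?thesis by (simp add: ecard_times)
qed

context ergodic_process
begin

text \<open>Ergodicity concerns strictly invariant sets. The set of points that visit \<open>A\<close> infinitely often
  is strictly invariant, and it agrees with \<open>A\<close> almost surely.\<close>

lemma zero_one:
  assumes A [measurable]: "A \<in> sets P" and inv: "AE \<omega> in P. S \<omega> \<in> A \<longleftrightarrow> \<omega> \<in> A"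
  shows "(AE \<omega> in P. \<omega> \<in> A) \<or> (AE \<omega> in P. \<omega> \<notin> A)"
proof -
  have Sn [measurable]: "(S ^^ k) \<in> P \<rightarrow>\<^sub>M P" for k by (rule measurable_compose_n) simp
  define B where "B = {\<omega> \<in> space P. \<forall>n. \<exists>k\<ge>n. (S ^^ k) \<omega> \<in> A}"
  have B [measurable]: "B \<in> sets P" unfolding B_def by measurable
  have "S -` B \<inter> space P = B"
  proof -
    have "(\<forall>n. \<exists>k\<ge>n. (S ^^ k) (S \<omega>) \<in> A) \<longleftrightarrow> (\<forall>n. \<exists>k\<ge>n. (S ^^ k) \<omega> \<in> A)" for \<omega>
    proof (intro iffI allI)
      fix n assume "\<forall>n. \<exists>k\<ge>n. (S ^^ k) (S \<omega>) \<in> A"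
      then obtain k where "k \<ge> n" "(S ^^ k) (S \<omega>) \<in> A" by blast
      then show "\<exists>k\<ge>n. (S ^^ k) \<omega> \<in> A" by (intro exI[of _ "Suc k"]) (simp add: funpow_swap1)
    next
      fix n assume "\<forall>n. \<exists>k\<ge>n. (S ^^ k) \<omega> \<in> A"
      then obtain k where "k \<ge> Suc n" "(S ^^ k) \<omega> \<in> A" by blast
      then show "\<exists>k\<ge>n. (S ^^ k) (S \<omega>) \<in> A"
        by (intro exI[of _ "k - 1"]) (cases k; simp add: funpow_swap1)
    qed
    then show ?thesis using measurable_space[OF S_measurable] by (auto simp: B_def)
  qed
  then have "emeasure P B = 0 \<or> emeasure P (space P - B) = 0"
    using S_ergodic B by (auto simp: ergodic_def)
  then have "(AE \<omega> in P. \<omega> \<notin> B) \<or> (AE \<omega> in P. \<omega> \<in> B)"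
  proof
    assume "emeasure P B = 0"
    then have "AE \<omega> in P. \<omega> \<notin> B" by (intro AE_I'[of B]) (auto simp: null_sets_def)
    then show ?thesis ..
  next
    assume "emeasure P (space P - B) = 0"
    then have "AE \<omega> in P. \<omega> \<in> B" by (intro AE_I'[of "space P - B"]) (auto simp: null_sets_def)
    then show ?thesis ..
  qed
  moreover have "AE \<omega> in P. \<omega> \<in> B \<longleftrightarrow> \<omega> \<in> A"
  proof -
    have "AE \<omega> in P. (S ^^ k) \<omega> \<in> A \<longleftrightarrow> \<omega> \<in> A" for k
    proof (induction k)
      case (Suc k)
      from AE_S[OF this] inv show ?case by eventually_elim (simp add: funpow_swap1)
    qed simp
    then have "AE \<omega> in P. \<forall>k. (S ^^ k) \<omega> \<in> A \<longleftrightarrow> \<omega> \<in> A" by (simp add: AE_all_countable)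
    then show ?thesis using AE_space by eventually_elim (auto simp: B_def)
  qed
  ultimately show ?thesis
  proof (elim disjE)
    assume "AE \<omega> in P. \<omega> \<notin> B" "AE \<omega> in P. \<omega> \<in> B \<longleftrightarrow> \<omega> \<in> A"
    then have "AE \<omega> in P. \<omega> \<notin> A" by eventually_elim simp
    then show ?thesis ..
  next
    assume "AE \<omega> in P. \<omega> \<in> B" "AE \<omega> in P. \<omega> \<in> B \<longleftrightarrow> \<omega> \<in> A"
    then have "AE \<omega> in P. \<omega> \<in> A" by eventually_elim simp
    then show ?thesis ..
  qed
qed

text \<open>The sets \<open>{Z \<le> q}\<close> with rational \<open>q\<close> are trivial, and they determine the value of \<open>Z\<close>.\<close>

lemma invariant_AE_constant:
  fixes Z :: "'w \<Rightarrow> real"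
  assumes Z [measurable]: "Z \<in> borel_measurable P" and inv: "AE \<omega> in P. Z (S \<omega>) = Z \<omega>"
  obtains z where "AE \<omega> in P. Z \<omega> = z"
proof -
  have "\<exists>b. AE \<omega> in P. Z \<omega> \<le> of_rat q \<longleftrightarrow> b" for q
  proof -
    have "AE \<omega> in P. S \<omega> \<in> {\<omega> \<in> space P. Z \<omega> \<le> of_rat q} \<longleftrightarrow> \<omega> \<in> {\<omega> \<in> space P. Z \<omega> \<le> of_rat q}"
      using inv AE_space by eventually_elim (auto dest: measurable_space[OF S_measurable])
    then have "(AE \<omega> in P. \<omega> \<in> {\<omega> \<in> space P. Z \<omega> \<le> of_rat q}) \<or> (AE \<omega> in P. \<omega> \<notin> {\<omega> \<in> space P. Z \<omega> \<le> of_rat q})"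
      by (rule zero_one[rotated]) measurable
    then show ?thesis
    proof
      assume "AE \<omega> in P. \<omega> \<in> {\<omega> \<in> space P. Z \<omega> \<le> of_rat q}"
      then have "AE \<omega> in P. Z \<omega> \<le> of_rat q \<longleftrightarrow> True" by eventually_elim simp
      then show ?thesis by blast
    next
      assume "AE \<omega> in P. \<omega> \<notin> {\<omega> \<in> space P. Z \<omega> \<le> of_rat q}"
      then have "AE \<omega> in P. Z \<omega> \<le> of_rat q \<longleftrightarrow> False" using AE_space by eventually_elim auto
      then show ?thesis by blast
    qed
  qed
  then have "\<exists>b. \<forall>q. AE \<omega> in P. Z \<omega> \<le> of_rat q \<longleftrightarrow> b q" by (intro choice allI)
  then obtain b where "\<And>q. AE \<omega> in P. Z \<omega> \<le> of_rat q \<longleftrightarrow> b q" by blast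
  then have b: "AE \<omega> in P. \<forall>q. Z \<omega> \<le> of_rat q \<longleftrightarrow> b q" by (simp add: AE_all_countable)
  have "\<exists>\<omega>. \<forall>q. Z \<omega> \<le> of_rat q \<longleftrightarrow> b q"
  proof (rule ccontr)
    assume n: "\<nexists>\<omega>. \<forall>q. Z \<omega> \<le> of_rat q \<longleftrightarrow> b q"
    have "AE \<omega> in P. False" using b by eventually_elim (use n in blast)
    then show False by simp
  qed
  then obtain \<omega>0 where \<omega>0: "\<And>q. Z \<omega>0 \<le> of_rat q \<longleftrightarrow> b q" by blast
  have "AE \<omega> in P. Z \<omega> = Z \<omega>0"
    using b
  proof eventually_elim
    case (elim \<omega>)
    then have eq: "Z \<omega> \<le> of_rat q \<longleftrightarrow> Z \<omega>0 \<le> of_rat q" for q using \<omega>0 by simp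
    show ?case
    proof (rule antisym; rule ccontr)
      assume "\<not> Z \<omega> \<le> Z \<omega>0"
      then obtain q where "Z \<omega>0 < of_rat q" "of_rat q < Z \<omega>" using of_rat_dense[of "Z \<omega>0" "Z \<omega>"] by auto
      then show False using eq[of q] by linarith
    next
      assume "\<not> Z \<omega>0 \<le> Z \<omega>"
      then obtain q where "Z \<omega> < of_rat q" "of_rat q < Z \<omega>0" using of_rat_dense[of "Z \<omega>" "Z \<omega>0"] by auto
      then show False using eq[of q] by linarith
    qed
  qed
  then show ?thesis by (rule that)
qed

definition root_intensity :: "int set \<Rightarrow> real" where
  "root_intensity J = enn2real (SOME c. c < \<infinity> \<and>
     (\<forall>A\<in>sets borel. (\<integral>\<^sup>+ \<omega>. ecard (roots J \<omega> \<inter> A) \<partial>P) = c * emeasure \<mu> A))"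

lemma root_intensity_nonneg: "0 \<le> root_intensity J"
  by (simp add: root_intensity_def)

lemma root_intensity:
  "A \<in> sets borel \<Longrightarrow> (\<integral>\<^sup>+ \<omega>. ecard (roots J \<omega> \<inter> A) \<partial>P) = ennreal (root_intensity J) * emeasure \<mu> A"
proof -
  have "\<exists>c. c < \<infinity> \<and> (\<forall>A\<in>sets borel. (\<integral>\<^sup>+ \<omega>. ecard (roots J \<omega> \<inter> A) \<partial>P) = c * emeasure \<mu> A)"
    by (rule factor_set_intensity[OF factor_set_roots[of J]]) blast
  from someI_ex[OF this] show "A \<in> sets borel \<Longrightarrow> ?thesis"
    unfolding root_intensity_def by (auto simp: ennreal_enn2real_if)
qed

text \<open>Real-valued counts; the value is 0 in the null event that the count is infinite.\<close>

definition cnt :: "int set \<Rightarrow> 'a set \<Rightarrow> 'w \<Rightarrow> real" where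
  "cnt J A \<omega> = enn2real (ecard (roots J \<omega> \<inter> A))"

lemma ecard_roots_measurable [measurable]:
  "A \<in> sets borel \<Longrightarrow> (\<lambda>\<omega>. ecard (roots J \<omega> \<inter> A)) \<in> borel_measurable P"
proof -
  show "A \<in> sets borel \<Longrightarrow> ?thesis"
    by (intro random_set_measurable factor_set_random factor_set_roots)
qed

lemma cnt_measurable [measurable]: "A \<in> sets borel \<Longrightarrow> cnt J A \<in> borel_measurable P"
  unfolding cnt_def by (intro borel_measurable_enn2real ecard_roots_measurable)

lemma cnt_nonneg [simp]: "0 \<le> cnt J A \<omega>"
  by (simp add: cnt_def)

lemma AE_finite_roots:
  assumes "A \<in> sets borel" "emeasure \<mu> A < \<infinity>"
  shows "AE \<omega> in P. finite (roots J \<omega> \<inter> A)"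
proof -
  have "(\<integral>\<^sup>+ \<omega>. ecard (roots J \<omega> \<inter> A) \<partial>P) \<noteq> \<infinity>"
    using assms by (simp add: root_intensity ennreal_mult_eq_top_iff)
  then have "AE \<omega> in P. ecard (roots J \<omega> \<inter> A) \<noteq> \<infinity>"
    by (rule nn_integral_PInf_AE[rotated]) (use assms in measurable)
  then show ?thesis
    by eventually_elim (simp add: less_top flip: ecard_finite_iff)
qed

lemma AE_cnt:
  assumes "A \<in> sets borel" "emeasure \<mu> A < \<infinity>"
  shows "AE \<omega> in P. ecard (roots J \<omega> \<inter> A) = ennreal (cnt J A \<omega>)"
  using AE_finite_roots[OF assms, of J]
  by eventually_elim (simp add: cnt_def ecard_finite ennreal_of_nat_eq_real_of_nat)

lemma emeasure_mu_eq: "emeasure \<mu> A < \<infinity> \<Longrightarrow> emeasure \<mu> A = ennreal (measure \<mu> A)"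
  by (intro emeasure_eq_ennreal_measure) (simp add: less_top)

lemma cnt_mean:
  assumes A: "A \<in> sets borel" "emeasure \<mu> A < \<infinity>"
  shows "has_bochner_integral P (cnt J A) (root_intensity J * measure \<mu> A)"
proof (rule has_bochner_integral_nn_integral)
  have "(\<integral>\<^sup>+ \<omega>. ennreal (cnt J A \<omega>) \<partial>P) = (\<integral>\<^sup>+ \<omega>. ecard (roots J \<omega> \<inter> A) \<partial>P)"
    using AE_cnt[OF A, of J] by (intro nn_integral_cong_AE) auto
  then show "(\<integral>\<^sup>+ \<omega>. ennreal (cnt J A \<omega>) \<partial>P) = ennreal (root_intensity J * measure \<mu> A)"
    using A by (simp add: root_intensity emeasure_mu_eq ennreal_mult' root_intensity_nonneg)
qed (use A in \<open>auto simp: root_intensity_nonneg\<close>)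

lemma roots_tuples_distinct_orbits:
  assumes f: "\<And>i. i \<in> {1..n} \<Longrightarrow> f i \<in> shapes"
  shows "\<forall>x\<in>tuples n (\<lambda>i. roots (f i)) \<omega>. \<not> meets_orbit_twice n x"
proof (intro ballI notI)
  fix x assume x: "x \<in> tuples n (\<lambda>i. roots (f i)) \<omega>" and "meets_orbit_twice n x"
  then obtain i j k where ij: "i \<in> {1..n}" "j \<in> {1..n}" "i \<noteq> j" "it k (x i) = x j"
    unfolding meets_orbit_twice_def by blast
  have xi: "x i \<in> roots (f i) \<omega>" and xj: "x j \<in> roots (f j) \<omega>"
    using x ij(1,2) by (auto simp: tuples_def)
  have "k = 0" using roots_orbit(1)[OF f[OF ij(1)] f[OF ij(2)] xi] xj ij(4) by simp
  then have "x i = x j" using ij by simp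
  moreover have "inj_on x {1..n}" using x by (simp add: tuples_def)
  ultimately show False using ij inj_onD by fastforce
qed

lemma roots_tuples_intensity:
  assumes n: "1 \<le> n" and f: "\<And>i. i \<in> {1..n} \<Longrightarrow> f i \<in> shapes"
  obtains c where "c < \<infinity>" "\<And>A. (\<And>i. i \<in> {1..n} \<Longrightarrow> A i \<in> sets borel) \<Longrightarrow>
    (\<integral>\<^sup>+ \<omega>. ecard (tuples n (\<lambda>i. roots (f i)) \<omega> \<inter> PiE {1..n} A) \<partial>P) = c * (\<Prod>i\<in>{1..n}. emeasure \<mu> (A i))"
proof (rule tuples_intensity[OF n, of "\<lambda>i. roots (f i)"])
  show "AE \<omega> in P. \<forall>x\<in>tuples n (\<lambda>i. roots (f i)) \<omega>. \<not> meets_orbit_twice n x"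
    by (rule AE_I2) (rule roots_tuples_distinct_orbits[OF f])
qed (auto intro: factor_set_roots that)

text \<open>Pairs of distinct roots have an intensity proportional to \<open>\<mu> \<otimes> \<mu>\<close>; the diagonal contributes
  the intensity of the roots in \<open>A \<inter> B\<close>.\<close>

lemma cnt_second_moment:
  assumes J: "J \<in> shapes"
  obtains c where "\<And>A B. A \<in> sets borel \<Longrightarrow> emeasure \<mu> A < \<infinity> \<Longrightarrow> B \<in> sets borel \<Longrightarrow> emeasure \<mu> B < \<infinity> \<Longrightarrow>
    has_bochner_integral P (\<lambda>\<omega>. cnt J A \<omega> * cnt J B \<omega>)
      (c * measure \<mu> A * measure \<mu> B + root_intensity J * measure \<mu> (A \<inter> B))"
proof -
  obtain c where c: "c < \<infinity>" "\<And>A. (\<And>i. i \<in> {1..2} \<Longrightarrow> A i \<in> sets borel) \<Longrightarrow>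
    (\<integral>\<^sup>+ \<omega>. ecard (tuples 2 (\<lambda>i. roots J) \<omega> \<inter> PiE {1..2} A) \<partial>P) = c * (\<Prod>i\<in>{1..2}. emeasure \<mu> (A i))"
    using roots_tuples_intensity[of 2 "\<lambda>_. J"] J by auto
  have two: "{1..2::nat} = {1, 2}" by auto
  show ?thesis
  proof (rule that)
    fix A B assume A: "A \<in> sets borel" "emeasure \<mu> A < \<infinity>" and B: "B \<in> sets borel" "emeasure \<mu> B < \<infinity>"
    note [measurable] = A(1) B(1)
    have AB: "emeasure \<mu> (A \<inter> B) < \<infinity>"
      by (rule le_less_trans[OF _ A(2)]) (auto intro: emeasure_mono)
    let ?F = "\<lambda>i::nat. if i = 1 then A else B"
    have meas: "(\<lambda>\<omega>. ecard (tuples 2 (\<lambda>i. roots J) \<omega> \<inter> PiE {1..2} ?F)) \<in> borel_measurable P"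
      by (intro tuples_measurable factor_set_random factor_set_roots sets_PiM_I_finite) auto
    have tup: "tuples 2 (\<lambda>_ _. roots J \<omega>) \<omega> = tuples 2 (\<lambda>i. roots J) \<omega>" for \<omega>
      by (simp add: tuples_def)
    have "(\<integral>\<^sup>+ \<omega>. ennreal (cnt J A \<omega> * cnt J B \<omega>) \<partial>P) =
        (\<integral>\<^sup>+ \<omega>. ecard (tuples 2 (\<lambda>i. roots J) \<omega> \<inter> PiE {1..2} ?F) + ecard (roots J \<omega> \<inter> (A \<inter> B)) \<partial>P)"
    proof (rule nn_integral_cong_AE)
      show "AE \<omega> in P. ennreal (cnt J A \<omega> * cnt J B \<omega>) =
        ecard (tuples 2 (\<lambda>i. roots J) \<omega> \<inter> PiE {1..2} ?F) + ecard (roots J \<omega> \<inter> (A \<inter> B))"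
        using AE_cnt[OF A, of J] AE_cnt[OF B, of J]
      proof eventually_elim
        case (elim \<omega>)
        show ?case
          unfolding ennreal_mult[OF cnt_nonneg cnt_nonneg] elim[symmetric]
          using ecard_product_two[of "roots J \<omega>" A B \<omega>] by (simp only: tup)
      qed
    qed
    also have "\<dots> = c * (emeasure \<mu> A * emeasure \<mu> B) + ennreal (root_intensity J) * emeasure \<mu> (A \<inter> B)"
    proof -
      have "(\<integral>\<^sup>+ \<omega>. ecard (tuples 2 (\<lambda>i. roots J) \<omega> \<inter> PiE {1..2} ?F) \<partial>P) = c * (emeasure \<mu> A * emeasure \<mu> B)"
        using c(2)[of ?F] by (simp add: two)
      then show ?thesis using meas by (subst nn_integral_add) (simp_all add: root_intensity)
    qed
    also have "\<dots> = ennreal (enn2real c * measure \<mu> A * measure \<mu> B + root_intensity J * measure \<mu> (A \<inter> B))"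
    proof -
      have "c = ennreal (enn2real c)" using c(1) by (simp add: ennreal_enn2real_if less_top)
      then show ?thesis
        unfolding emeasure_mu_eq[OF A(2)] emeasure_mu_eq[OF B(2)] emeasure_mu_eq[OF AB]
        by (subst \<open>c = _\<close>) (simp add: ennreal_mult root_intensity_nonneg mult.assoc)
    qed
    finally show "has_bochner_integral P (\<lambda>\<omega>. cnt J A \<omega> * cnt J B \<omega>)
      (enn2real c * measure \<mu> A * measure \<mu> B + root_intensity J * measure \<mu> (A \<inter> B))"
      by (intro has_bochner_integral_nn_integral) (auto simp: root_intensity_nonneg)
  qed
qed

text \<open>The unknown constant of the second moment cancels in the quadratic distance of normalised
  counts.\<close>

lemma cnt_distance:
  assumes J: "J \<in> shapes"
    and A: "A \<in> sets borel" "emeasure \<mu> A < \<infinity>" "0 < measure \<mu> A"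
    and B: "B \<in> sets borel" "emeasure \<mu> B < \<infinity>" "0 < measure \<mu> B"
  shows "(\<integral>\<^sup>+ \<omega>. ennreal ((cnt J A \<omega> / measure \<mu> A - cnt J B \<omega> / measure \<mu> B)\<^sup>2) \<partial>P)
    \<le> ennreal (root_intensity J / measure \<mu> A + root_intensity J / measure \<mu> B)"
proof -
  obtain c where c: "\<And>A B. A \<in> sets borel \<Longrightarrow> emeasure \<mu> A < \<infinity> \<Longrightarrow> B \<in> sets borel \<Longrightarrow> emeasure \<mu> B < \<infinity> \<Longrightarrow>
    has_bochner_integral P (\<lambda>\<omega>. cnt J A \<omega> * cnt J B \<omega>)
      (c * measure \<mu> A * measure \<mu> B + root_intensity J * measure \<mu> (A \<inter> B))"
    using cnt_second_moment[OF J] by blast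
  let ?a = "measure \<mu> A" and ?b = "measure \<mu> B" and ?\<alpha> = "root_intensity J" and ?d = "measure \<mu> (A \<inter> B)"
  have "has_bochner_integral P (\<lambda>\<omega>. cnt J A \<omega> * cnt J A \<omega> * (1 / ?a\<^sup>2) + cnt J B \<omega> * cnt J B \<omega> * (1 / ?b\<^sup>2)
      - cnt J A \<omega> * cnt J B \<omega> * (2 / (?a * ?b)))
    ((c * ?a * ?a + ?\<alpha> * measure \<mu> (A \<inter> A)) * (1 / ?a\<^sup>2) + (c * ?b * ?b + ?\<alpha> * measure \<mu> (B \<inter> B)) * (1 / ?b\<^sup>2)
      - (c * ?a * ?b + ?\<alpha> * ?d) * (2 / (?a * ?b)))"
    by (intro has_bochner_integral_add has_bochner_integral_diff has_bochner_integral_mult_left c A B)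
  also have "(\<lambda>\<omega>. cnt J A \<omega> * cnt J A \<omega> * (1 / ?a\<^sup>2) + cnt J B \<omega> * cnt J B \<omega> * (1 / ?b\<^sup>2)
      - cnt J A \<omega> * cnt J B \<omega> * (2 / (?a * ?b))) = (\<lambda>\<omega>. (cnt J A \<omega> / ?a - cnt J B \<omega> / ?b)\<^sup>2)"
    using A B by (auto simp: fun_eq_iff power2_eq_square field_simps)
  finally have hb: "has_bochner_integral P (\<lambda>\<omega>. (cnt J A \<omega> / ?a - cnt J B \<omega> / ?b)\<^sup>2)
    ((c * ?a * ?a + ?\<alpha> * measure \<mu> (A \<inter> A)) * (1 / ?a\<^sup>2) + (c * ?b * ?b + ?\<alpha> * measure \<mu> (B \<inter> B)) * (1 / ?b\<^sup>2)
      - (c * ?a * ?b + ?\<alpha> * ?d) * (2 / (?a * ?b)))" (is "has_bochner_integral P _ ?v") .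
  have "?v = ?\<alpha> / ?a + ?\<alpha> / ?b - ?\<alpha> * ?d * 2 / (?a * ?b)"
    using A B by (simp add: field_simps power2_eq_square)
  also have "\<dots> \<le> ?\<alpha> / ?a + ?\<alpha> / ?b" using A B by (simp add: root_intensity_nonneg)
  finally have "?v \<le> ?\<alpha> / ?a + ?\<alpha> / ?b" .
  moreover have "(\<integral>\<^sup>+ \<omega>. ennreal ((cnt J A \<omega> / ?a - cnt J B \<omega> / ?b)\<^sup>2) \<partial>P) = ennreal ?v"
    using hb by (subst nn_integral_eq_integral) (auto simp: has_bochner_integral_iff)
  ultimately show ?thesis by (simp add: ennreal_leI)
qed

lemma cnt_S:
  shows "AE \<omega> in P. \<forall>m::nat. cnt J (A m) (S \<omega>) = cnt J (T -` A m) \<omega>"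
  using factor_set_S[OF factor_set_roots[of J]]
proof eventually_elim
  case (elim \<omega>)
  have "roots J (S \<omega>) \<inter> B = T ` (roots J \<omega> \<inter> T -` B)" for B unfolding elim by auto
  moreover have "inj_on T X" for X using bij_is_inj[OF bij_T] by (rule inj_on_subset) simp
  ultimately show ?case by (simp add: cnt_def ecard_image)
qed

end

lemma abs_le_weighted_square:
  fixes d :: real shows "\<bar>d\<bar> \<le> 2 ^ m * d\<^sup>2 + (1/2) ^ m"
proof (cases "\<bar>d\<bar> \<le> (1/2) ^ m")
  case True
  moreover have "0 \<le> 2 ^ m * d\<^sup>2" by simp
  ultimately show ?thesis by linarith
next
  case False
  then have "(1/2) ^ m \<le> \<bar>d\<bar>" by linarith
  then have "\<bar>d\<bar> * (1/2) ^ m \<le> \<bar>d\<bar> * \<bar>d\<bar>" by (rule mult_left_mono) simp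
  then have "2 ^ m * (\<bar>d\<bar> * (1/2) ^ m) \<le> 2 ^ m * (\<bar>d\<bar> * \<bar>d\<bar>)" by (rule mult_left_mono) simp
  then have "\<bar>d\<bar> \<le> 2 ^ m * d\<^sup>2" by (simp add: power2_eq_square power_divide abs_mult_self_eq)
  then show ?thesis by (simp add: add_increasing2)
qed

context ergodic_process
begin

text \<open>By \<open>cnt_distance\<close> the normalised counts form a Cauchy sequence in quadratic mean, fast enough
  for almost sure convergence. The same estimate compares the count in \<open>A m\<close> with the count in its
  preimage under \<open>T\<close>, which is the count in \<open>A m\<close> at \<open>S \<omega>\<close>. Thus the limit is invariant, hence
  constant, and Fatou's lemma carries the Cauchy estimate over to the limit.\<close>

lemma law_of_large_numbers:
  fixes A :: "nat \<Rightarrow> 'a set"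
  assumes J: "J \<in> shapes" and A: "\<And>m. A m \<in> sets borel" "\<And>m. emeasure \<mu> (A m) < \<infinity>"
    and large: "\<And>m. 4 ^ m \<le> measure \<mu> (A m)"
  shows "(\<integral>\<^sup>+ \<omega>. ennreal ((cnt J (A m) \<omega> / measure \<mu> (A m) - root_intensity J)\<^sup>2) \<partial>P)
    \<le> ennreal (2 * root_intensity J / 4 ^ m)"
proof -
  let ?\<alpha> = "root_intensity J"
  define a where "a m = measure \<mu> (A m)" for m
  define X where "X m \<omega> = cnt J (A m) \<omega> / a m" for m \<omega>
  define X' where "X' m \<omega> = cnt J (T -` A m) \<omega> / a m" for m \<omega>
  have a_pos: "0 < a m" for m
    unfolding a_def by (rule less_le_trans[OF _ large]) simp
  have X [measurable]: "X m \<in> borel_measurable P" "X' m \<in> borel_measurable P" for m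
    unfolding X_def[abs_def] X'_def[abs_def]
    by (intro borel_measurable_divide cnt_measurable A T_vimage_sets borel_measurable_const)+
  have div_le: "?\<alpha> / a k \<le> ?\<alpha> / 4 ^ m" if "m \<le> k" for m k
  proof (rule divide_left_mono)
    have "(4::real) ^ m \<le> 4 ^ k" using that by (intro power_increasing) auto
    from order_trans[OF this large] show "4 ^ m \<le> a k" by (simp add: a_def)
  qed (auto simp: root_intensity_nonneg a_pos)
  have dist: "(\<integral>\<^sup>+ \<omega>. ennreal ((X m \<omega> - X k \<omega>)\<^sup>2) \<partial>P) \<le> ennreal (2 * ?\<alpha> / 4 ^ m)" if "m \<le> k" for m k
  proof -
    have "(\<integral>\<^sup>+ \<omega>. ennreal ((X m \<omega> - X k \<omega>)\<^sup>2) \<partial>P) \<le> ennreal (?\<alpha> / a m + ?\<alpha> / a k)"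
      unfolding X_def a_def using a_pos by (intro cnt_distance[OF J] A) (auto simp: a_def)
    also have "\<dots> \<le> ennreal (2 * ?\<alpha> / 4 ^ m)"
      using div_le[OF that] div_le[of m m] by (intro ennreal_leI) simp
    finally show ?thesis .
  qed
  have dist': "(\<integral>\<^sup>+ \<omega>. ennreal ((X m \<omega> - X' m \<omega>)\<^sup>2) \<partial>P) \<le> ennreal (2 * ?\<alpha> / 4 ^ m)" for m
  proof -
    have mT: "measure \<mu> (T -` A m) = a m" and eT: "emeasure \<mu> (T -` A m) < \<infinity>"
      using emeasure_T_vimage[OF A(1)[of m]] A(2)[of m] by (simp_all add: a_def measure_def)
    have "(\<integral>\<^sup>+ \<omega>. ennreal ((X m \<omega> - X' m \<omega>)\<^sup>2) \<partial>P) \<le> ennreal (?\<alpha> / a m + ?\<alpha> / a m)"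
      using cnt_distance[OF J A(1) A(2) _ T_vimage_sets[OF A(1)] eT, of m] a_pos[of m]
      unfolding mT a_def[symmetric] X_def X'_def by simp
    also have "\<dots> \<le> ennreal (2 * ?\<alpha> / 4 ^ m)"
      using div_le[of m m] by (intro ennreal_leI) simp
    finally show ?thesis .
  qed
  have geo: "(\<Sum>m. ennreal (2 * ?\<alpha> * (1/2) ^ m)) < \<infinity>"
  proof -
    have "(\<Sum>m. ennreal (2 * ?\<alpha> * (1/2) ^ m)) = ennreal (\<Sum>m. 2 * ?\<alpha> * (1/2) ^ m)"
      by (rule suminf_ennreal2) (auto simp: root_intensity_nonneg intro!: summable_mult)
    then show ?thesis by simp
  qed
  \<comment> \<open>The weights \<open>2 ^ m\<close> turn summability of squares into summability of increments.\<close>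
  have "AE \<omega> in P. summable (\<lambda>m. 2 ^ m * (X (Suc m) \<omega> - X m \<omega>)\<^sup>2)"
  proof -
    have "(\<integral>\<^sup>+ \<omega>. (\<Sum>m. ennreal (2 ^ m * (X (Suc m) \<omega> - X m \<omega>)\<^sup>2)) \<partial>P)
        = (\<Sum>m. \<integral>\<^sup>+ \<omega>. ennreal (2 ^ m * (X (Suc m) \<omega> - X m \<omega>)\<^sup>2) \<partial>P)"
      by (rule nn_integral_suminf) measurable
    also have "\<dots> \<le> (\<Sum>m. ennreal (2 * ?\<alpha> * (1/2) ^ m))"
    proof (rule suminf_le)
      fix m
      have "(\<integral>\<^sup>+ \<omega>. ennreal (2 ^ m * (X (Suc m) \<omega> - X m \<omega>)\<^sup>2) \<partial>P)
          = (\<integral>\<^sup>+ \<omega>. ennreal (2 ^ m) * ennreal ((X m \<omega> - X (Suc m) \<omega>)\<^sup>2) \<partial>P)"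
        by (simp add: ennreal_mult power2_commute)
      also have "\<dots> = ennreal (2 ^ m) * (\<integral>\<^sup>+ \<omega>. ennreal ((X m \<omega> - X (Suc m) \<omega>)\<^sup>2) \<partial>P)"
        by (rule nn_integral_cmult) measurable
      also have "\<dots> \<le> ennreal (2 ^ m) * ennreal (2 * ?\<alpha> / 4 ^ m)"
        by (intro mult_left_mono dist) auto
      also have "\<dots> = ennreal (2 ^ m * (2 * ?\<alpha> / 4 ^ m))"
        by (rule ennreal_mult[symmetric]) (auto simp: root_intensity_nonneg)
      also have "2 ^ m * (2 * ?\<alpha> / 4 ^ m) = 2 * ?\<alpha> * (1/2) ^ m"
      proof -
        have "(4::real) ^ m = 2 ^ m * 2 ^ m" by (simp flip: power_mult_distrib)
        then show ?thesis by (simp add: power_divide)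
      qed
      finally show "(\<integral>\<^sup>+ \<omega>. ennreal (2 ^ m * (X (Suc m) \<omega> - X m \<omega>)\<^sup>2) \<partial>P) \<le> ennreal (2 * ?\<alpha> * (1/2) ^ m)" .
    qed auto
    finally have "(\<integral>\<^sup>+ \<omega>. (\<Sum>m. ennreal (2 ^ m * (X (Suc m) \<omega> - X m \<omega>)\<^sup>2)) \<partial>P) \<noteq> \<infinity>"
      using geo by (auto simp: top_unique)
    then have "AE \<omega> in P. (\<Sum>m. ennreal (2 ^ m * (X (Suc m) \<omega> - X m \<omega>)\<^sup>2)) \<noteq> \<infinity>"
      by (rule nn_integral_PInf_AE[rotated]) measurable
    then show ?thesis by eventually_elim (rule summable_suminf_not_top, auto)
  qed
  then have conv: "AE \<omega> in P. convergent (\<lambda>m. X m \<omega>)"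
  proof eventually_elim
    case (elim \<omega>)
    have "summable (\<lambda>m. 2 ^ m * (X (Suc m) \<omega> - X m \<omega>)\<^sup>2 + (1/2) ^ m)"
      by (intro summable_add elim summable_geometric) simp
    then have "summable (\<lambda>m. X (Suc m) \<omega> - X m \<omega>)"
      by (rule summable_comparison_test'[where N = 0]) (simp only: real_norm_def abs_le_weighted_square)
    then have "(\<lambda>n. \<Sum>m<n. X (Suc m) \<omega> - X m \<omega>) \<longlonglongrightarrow> (\<Sum>m. X (Suc m) \<omega> - X m \<omega>)"
      by (rule summable_LIMSEQ)
    then have "(\<lambda>n. X n \<omega> - X 0 \<omega>) \<longlonglongrightarrow> (\<Sum>m. X (Suc m) \<omega> - X m \<omega>)"
      by (simp only: sum_lessThan_telescope[of "\<lambda>m. X m \<omega>"])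
    then have "(\<lambda>n. (X n \<omega> - X 0 \<omega>) + X 0 \<omega>) \<longlonglongrightarrow> (\<Sum>m. X (Suc m) \<omega> - X m \<omega>) + X 0 \<omega>"
      by (intro tendsto_add tendsto_const)
    then show ?case by (auto simp: convergent_def)
  qed
  have "AE \<omega> in P. summable (\<lambda>m. (X m \<omega> - X' m \<omega>)\<^sup>2)"
  proof -
    have "(\<integral>\<^sup>+ \<omega>. (\<Sum>m. ennreal ((X m \<omega> - X' m \<omega>)\<^sup>2)) \<partial>P)
        = (\<Sum>m. \<integral>\<^sup>+ \<omega>. ennreal ((X m \<omega> - X' m \<omega>)\<^sup>2) \<partial>P)"
      by (rule nn_integral_suminf) measurable
    also have "\<dots> \<le> (\<Sum>m. ennreal (2 * ?\<alpha> * (1/2) ^ m))"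
    proof (rule suminf_le)
      fix m
      have "(2::real) ^ m \<le> 4 ^ m" by (intro power_mono) auto
      then have "2 * ?\<alpha> / 4 ^ m \<le> 2 * ?\<alpha> / 2 ^ m"
        by (intro divide_left_mono) (auto simp: root_intensity_nonneg)
      then have "2 * ?\<alpha> / 4 ^ m \<le> 2 * ?\<alpha> * (1/2) ^ m" by (simp add: power_divide)
      then show "(\<integral>\<^sup>+ \<omega>. ennreal ((X m \<omega> - X' m \<omega>)\<^sup>2) \<partial>P) \<le> ennreal (2 * ?\<alpha> * (1/2) ^ m)"
        by (intro order_trans[OF dist'] ennreal_leI)
    qed auto
    finally have "(\<integral>\<^sup>+ \<omega>. (\<Sum>m. ennreal ((X m \<omega> - X' m \<omega>)\<^sup>2)) \<partial>P) \<noteq> \<infinity>"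
      using geo by (auto simp: top_unique)
    then have "AE \<omega> in P. (\<Sum>m. ennreal ((X m \<omega> - X' m \<omega>)\<^sup>2)) \<noteq> \<infinity>"
      by (rule nn_integral_PInf_AE[rotated]) measurable
    then show ?thesis by eventually_elim (rule summable_suminf_not_top, auto)
  qed
  then have conv0: "AE \<omega> in P. (\<lambda>m. X' m \<omega> - X m \<omega>) \<longlonglongrightarrow> 0"
  proof eventually_elim
    case (elim \<omega>)
    then have "(\<lambda>m. sqrt ((X m \<omega> - X' m \<omega>)\<^sup>2)) \<longlonglongrightarrow> sqrt 0"
      by (intro tendsto_real_sqrt summable_LIMSEQ_zero)
    then show ?case by (simp add: tendsto_rabs_zero_iff abs_minus_commute)
  qed
  define Z where "Z \<omega> = lim (\<lambda>m. X m \<omega>)" for \<omega>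
  have [measurable]: "Z \<in> borel_measurable P" unfolding Z_def[abs_def] by measurable
  have lim: "AE \<omega> in P. (\<lambda>m. X m \<omega>) \<longlonglongrightarrow> Z \<omega>"
    using conv by eventually_elim (simp add: Z_def convergent_LIMSEQ_iff)
  have "AE \<omega> in P. Z (S \<omega>) = Z \<omega>"
    using lim conv0 cnt_S[of J A]
  proof eventually_elim
    case (elim \<omega>)
    have "(\<lambda>m. (X' m \<omega> - X m \<omega>) + X m \<omega>) \<longlonglongrightarrow> 0 + Z \<omega>"
      using elim by (intro tendsto_add)
    then have "(\<lambda>m. X m (S \<omega>)) \<longlonglongrightarrow> Z \<omega>" using elim(3) by (simp add: X_def X'_def)
    then show ?case unfolding Z_def[of "S \<omega>"] by (rule limI)
  qed
  then obtain z where z: "AE \<omega> in P. Z \<omega> = z"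
    by (rule invariant_AE_constant[rotated]) measurable
  have bound: "(\<integral>\<^sup>+ \<omega>. ennreal ((X m \<omega> - z)\<^sup>2) \<partial>P) \<le> ennreal (2 * ?\<alpha> / 4 ^ m)" for m
  proof -
    have "(\<integral>\<^sup>+ \<omega>. ennreal ((X m \<omega> - z)\<^sup>2) \<partial>P) = (\<integral>\<^sup>+ \<omega>. liminf (\<lambda>k. ennreal ((X m \<omega> - X k \<omega>)\<^sup>2)) \<partial>P)"
    proof (rule nn_integral_cong_AE)
      show "AE \<omega> in P. ennreal ((X m \<omega> - z)\<^sup>2) = liminf (\<lambda>k. ennreal ((X m \<omega> - X k \<omega>)\<^sup>2))"
        using lim z
      proof eventually_elim
        case (elim \<omega>)
        then have "(\<lambda>k. ennreal ((X m \<omega> - X k \<omega>)\<^sup>2)) \<longlonglongrightarrow> ennreal ((X m \<omega> - z)\<^sup>2)"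
          by (intro tendsto_ennrealI tendsto_power tendsto_diff tendsto_const) simp
        then show ?case by (intro lim_imp_Liminf[symmetric]) auto
      qed
    qed
    also have "\<dots> \<le> liminf (\<lambda>k. \<integral>\<^sup>+ \<omega>. ennreal ((X m \<omega> - X k \<omega>)\<^sup>2) \<partial>P)"
      by (rule nn_integral_liminf) measurable
    also have "\<dots> \<le> liminf (\<lambda>k::nat. ennreal (2 * ?\<alpha> / 4 ^ m))"
      by (rule Liminf_mono) (use dist in \<open>auto intro: eventually_sequentiallyI[of m]\<close>)
    also have "\<dots> = ennreal (2 * ?\<alpha> / 4 ^ m)" by (rule Liminf_const) simp
    finally show ?thesis .
  qed
  \<comment> \<open>The mean minimises the quadratic distance to constants.\<close>
  obtain c where c: "\<And>A B. A \<in> sets borel \<Longrightarrow> emeasure \<mu> A < \<infinity> \<Longrightarrow> B \<in> sets borel \<Longrightarrow> emeasure \<mu> B < \<infinity> \<Longrightarrow>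
    has_bochner_integral P (\<lambda>\<omega>. cnt J A \<omega> * cnt J B \<omega>)
      (c * measure \<mu> A * measure \<mu> B + root_intensity J * measure \<mu> (A \<inter> B))"
    using cnt_second_moment[OF J] by blast
  obtain q where q: "has_bochner_integral P (\<lambda>\<omega>. X m \<omega> * X m \<omega>) q"
  proof -
    have "has_bochner_integral P (\<lambda>\<omega>. cnt J (A m) \<omega> * cnt J (A m) \<omega> * (1 / (a m * a m)))
        ((c * measure \<mu> (A m) * measure \<mu> (A m) + ?\<alpha> * measure \<mu> (A m \<inter> A m)) * (1 / (a m * a m)))"
      by (intro has_bochner_integral_mult_left c A)
    then show ?thesis using that by (simp add: X_def)
  qed
  have mean: "has_bochner_integral P (X m) ?\<alpha>"
  proof -
    have "has_bochner_integral P (\<lambda>\<omega>. cnt J (A m) \<omega> * (1 / a m)) (?\<alpha> * measure \<mu> (A m) * (1 / a m))"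
      by (intro has_bochner_integral_mult_left cnt_mean A)
    then show ?thesis using a_pos[of m] by (simp add: X_def[abs_def] a_def)
  qed
  have sq: "has_bochner_integral P (\<lambda>\<omega>. (X m \<omega> - y)\<^sup>2) (q - 2 * y * ?\<alpha> + y\<^sup>2)" for y
  proof -
    have "has_bochner_integral P (\<lambda>\<omega>. X m \<omega> * X m \<omega> - (2 * y) * X m \<omega> + y\<^sup>2) (q - (2 * y) * ?\<alpha> + y\<^sup>2)"
      by (intro has_bochner_integral_add has_bochner_integral_diff has_bochner_integral_mult_right q mean)
        (simp add: has_bochner_integral_iff prob_space)
    moreover have "(\<lambda>\<omega>. X m \<omega> * X m \<omega> - (2 * y) * X m \<omega> + y\<^sup>2) = (\<lambda>\<omega>. (X m \<omega> - y)\<^sup>2)"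
      by (simp add: fun_eq_iff power2_eq_square algebra_simps)
    ultimately show ?thesis by simp
  qed
  have nn: "(\<integral>\<^sup>+ \<omega>. ennreal ((X m \<omega> - y)\<^sup>2) \<partial>P) = ennreal (q - 2 * y * ?\<alpha> + y\<^sup>2)" for y
    using sq[of y] by (subst nn_integral_eq_integral) (auto simp: has_bochner_integral_iff)
  have "q - 2 * ?\<alpha> * ?\<alpha> + ?\<alpha>\<^sup>2 \<le> q - 2 * z * ?\<alpha> + z\<^sup>2"
  proof -
    have "0 \<le> (z - ?\<alpha>)\<^sup>2" by simp
    then show ?thesis by (simp add: power2_eq_square algebra_simps)
  qed
  then have "(\<integral>\<^sup>+ \<omega>. ennreal ((X m \<omega> - ?\<alpha>)\<^sup>2) \<partial>P) \<le> (\<integral>\<^sup>+ \<omega>. ennreal ((X m \<omega> - z)\<^sup>2) \<partial>P)"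
    unfolding nn by (rule ennreal_leI)
  also have "\<dots> \<le> ennreal (2 * ?\<alpha> / 4 ^ m)" by (rule bound)
  finally show ?thesis by (simp add: X_def a_def)
qed

text \<open>The constant for \<open>n + 1\<close> points can be computed with any sets. The first \<open>n\<close> points are kept
  in a fixed cell and the last one is placed in disjoint sets of growing measure, where by the law of
  large numbers its normalised count converges to the intensity in quadratic mean. So the constant
  gains the factor \<open>root_intensity (f (Suc n))\<close>.\<close>

lemma factorial_moment:
  assumes "\<And>i. i \<in> {1..n} \<Longrightarrow> f i \<in> shapes" "\<And>i. i \<in> {1..n} \<Longrightarrow> A i \<in> sets borel"
  shows "(\<integral>\<^sup>+ \<omega>. ecard (tuples n (\<lambda>i. roots (f i)) \<omega> \<inter> PiE {1..n} A) \<partial>P)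
    = (\<Prod>i\<in>{1..n}. ennreal (root_intensity (f i))) * (\<Prod>i\<in>{1..n}. emeasure \<mu> (A i))"
  using assms
proof (induction n arbitrary: A)
  case 0
  have "tuples 0 (\<lambda>i. roots (f i)) \<omega> \<inter> PiE {1..0} A = {\<lambda>_. undefined}" for \<omega>
    by (auto simp: tuples_def)
  then show ?case by (simp add: emeasure_space_1)
next
  case (Suc n)
  let ?R = "\<lambda>i. roots (f i)" and ?J = "f (Suc n)"
  let ?\<alpha> = "root_intensity ?J"
  have J: "?J \<in> shapes" using Suc.prems by simp
  have f: "f i \<in> shapes" if "i \<in> {1..n}" for i using Suc.prems that by simp
  obtain c where c: "c < \<infinity>" "\<And>A. (\<And>i. i \<in> {1..Suc n} \<Longrightarrow> A i \<in> sets borel) \<Longrightarrow>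
    (\<integral>\<^sup>+ \<omega>. ecard (tuples (Suc n) ?R \<omega> \<inter> PiE {1..Suc n} A) \<partial>P) = c * (\<Prod>i\<in>{1..Suc n}. emeasure \<mu> (A i))"
    by (rule roots_tuples_intensity[of "Suc n" f]) (use Suc.prems in auto)
  obtain b where b: "0 < emeasure \<mu> (cell b)" "emeasure \<mu> (cell b) < \<infinity>"
    by (rule ex_finite_positive)
  let ?B = "cell b :: 'a set"
  define \<beta> where "\<beta> = measure \<mu> ?B"
  have \<beta>: "emeasure \<mu> ?B = ennreal \<beta>" "0 < \<beta>"
    using b emeasure_mu_eq[of ?B] by (auto simp: \<beta>_def)
  \<comment> \<open>Sets of large measure that avoid the reference set.\<close>
  have "\<exists>D. D \<in> sets borel \<and> D \<inter> ?B = {} \<and> emeasure \<mu> D < \<infinity> \<and> 4 ^ m \<le> measure \<mu> D" for m :: nat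
  proof -
    have "emeasure \<mu> UNIV \<le> emeasure \<mu> ?B + emeasure \<mu> (- ?B)"
      using emeasure_subadditive[of ?B \<mu> "- ?B"] by (simp add: Compl_partition)
    then have "emeasure \<mu> (- ?B) = \<top>" using mu_UNIV b by (auto simp: top_unique)
    then obtain D where D: "D \<in> sets borel" "D \<subseteq> - ?B" "ennreal (2 * 4 ^ m / 2) \<le> emeasure \<mu> D"
      "emeasure \<mu> D \<le> ennreal (2 * 4 ^ m)"
      using subset_of_measure[of "- ?B" "2 * 4 ^ m"] by auto
    have "emeasure \<mu> D < \<infinity>" using D(4) by (rule order_le_less_trans) simp
    moreover from emeasure_mu_eq[OF this] have "4 ^ m \<le> measure \<mu> D"
      using D(3) by (simp add: ennreal_le_iff)
    ultimately show ?thesis using D by blast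
  qed
  then have "\<exists>D. \<forall>m. D m \<in> sets borel \<and> D m \<inter> ?B = {} \<and> emeasure \<mu> (D m) < \<infinity> \<and> 4 ^ m \<le> measure \<mu> (D m)"
    by (intro choice allI)
  then obtain D where D [measurable]: "\<And>m::nat. D m \<in> sets borel" and DB: "\<And>m. D m \<inter> ?B = {}"
    and Dfin: "\<And>m. emeasure \<mu> (D m) < \<infinity>" and Dlarge: "\<And>m. 4 ^ m \<le> measure \<mu> (D m)" by blast
  define d where "d m = measure \<mu> (D m)" for m
  have d: "0 < d m" for m
    unfolding d_def by (rule less_le_trans[OF _ Dlarge]) simp
  define Y where "Y \<omega> = ecard (tuples n ?R \<omega> \<inter> PiE {1..n} (\<lambda>_. ?B))" for \<omega>
  define y where "y \<omega> = enn2real (Y \<omega>)" for \<omega>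
  have Y [measurable]: "Y \<in> borel_measurable P"
    unfolding Y_def[abs_def]
    by (intro tuples_measurable factor_set_random factor_set_roots sets_PiM_I_finite) auto
  have y [measurable]: "y \<in> borel_measurable P" unfolding y_def[abs_def] by measurable
  have y0: "0 \<le> y \<omega>" for \<omega> by (simp add: y_def)
  have Yle: "Y \<omega> \<le> ecard (points \<omega> \<inter> ?B) ^ n" and Yfin: "Y \<omega> = ennreal (y \<omega>)" if \<omega>: "\<omega> \<in> space P" for \<omega>
  proof -
    have "bounded ?B" by (rule bounded_cell)
    then have fin: "finite (points \<omega> \<inter> ?B)"
      using random_set_locally_finite[OF random_set_points \<omega>] by (simp add: locally_finite_def)
    show *: "Y \<omega> \<le> ecard (points \<omega> \<inter> ?B) ^ n"
      unfolding Y_def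
    proof (rule ecard_tuples_le[OF _ _ fin])
      show "?R i \<omega> \<subseteq> points \<omega>" for i by (auto simp: roots_def)
      show "x i \<in> ?B" if "x \<in> PiE {1..n} (\<lambda>_. ?B)" "i \<in> {1..n}" for x i by (rule PiE_mem[OF that])
    qed
    note *
    also have "\<dots> < \<top>" using fin by (simp add: power_less_top_ennreal ecard_finite_iff)
    finally show "Y \<omega> = ennreal (y \<omega>)" by (simp add: y_def ennreal_enn2real_if less_top)
  qed
  define p where "p = (\<Prod>i\<in>{1..n}. root_intensity (f i))"
  have p: "0 \<le> p" unfolding p_def by (intro prod_nonneg) (simp add: root_intensity_nonneg)
  have "(\<integral>\<^sup>+ \<omega>. ennreal (y \<omega>) \<partial>P) = (\<integral>\<^sup>+ \<omega>. Y \<omega> \<partial>P)"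
    by (intro nn_integral_cong) (simp add: Yfin)
  also have "\<dots> = (\<Prod>i\<in>{1..n}. ennreal (root_intensity (f i))) * (\<Prod>i\<in>{1..n}. emeasure \<mu> ?B)"
    unfolding Y_def by (rule Suc.IH[OF f]) auto
  also have "\<dots> = ennreal (p * \<beta> ^ n)"
    using p \<beta> by (simp add: prod_ennreal p_def root_intensity_nonneg ennreal_power ennreal_mult)
  finally have Ey: "has_bochner_integral P y (p * \<beta> ^ n)"
    using p \<beta> by (intro has_bochner_integral_nn_integral) (auto simp: y_def)
  define c' where "c' = enn2real c"
  have c': "c = ennreal c'" "0 \<le> c'" using c(1) by (simp_all add: c'_def ennreal_enn2real_if less_top)
  define X where "X m \<omega> = cnt ?J (D m) \<omega> / d m" for m \<omega>
  have X [measurable]: "X m \<in> borel_measurable P" for m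
    unfolding X_def[abs_def] by (intro borel_measurable_divide cnt_measurable D borel_measurable_const)
  have X0: "0 \<le> X m \<omega>" for m \<omega> using d[of m] by (simp add: X_def)
  have EyX: "has_bochner_integral P (\<lambda>\<omega>. y \<omega> * X m \<omega>) (c' * \<beta> ^ n)" for m
  proof -
    let ?A = "\<lambda>i. if i = Suc n then D m else ?B"
    have ins: "{1..Suc n} = insert (Suc n) {1..n}" by auto
    have "(\<integral>\<^sup>+ \<omega>. ennreal (y \<omega> * cnt ?J (D m) \<omega>) \<partial>P) =
        (\<integral>\<^sup>+ \<omega>. ecard (tuples (Suc n) ?R \<omega> \<inter> PiE {1..Suc n} ?A) \<partial>P)"
    proof (rule nn_integral_cong_AE)
      show "AE \<omega> in P. ennreal (y \<omega> * cnt ?J (D m) \<omega>) = ecard (tuples (Suc n) ?R \<omega> \<inter> PiE {1..Suc n} ?A)"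
        using AE_cnt[OF D Dfin, of ?J m] AE_space
      proof eventually_elim
        case (elim \<omega>)
        have PA: "PiE {1..n} ?A = PiE {1..n} (\<lambda>_. ?B)" by (rule PiE_cong) auto
        have "?A i \<inter> ?A (Suc n) = {}" if "i \<in> {1..n}" for i using that DB[of m] by auto
        then have "ecard (tuples (Suc n) ?R \<omega> \<inter> PiE {1..Suc n} ?A) =
          ecard ((tuples n ?R \<omega> \<inter> PiE {1..n} ?A) \<times> (?R (Suc n) \<omega> \<inter> ?A (Suc n)))"
          by (intro ecard_bij_betw[OF tuples_Suc_bij]) auto
        also have "\<dots> = Y \<omega> * ecard (roots ?J \<omega> \<inter> D m)"
          unfolding PA by (simp add: ecard_times Y_def)
        also have "\<dots> = ennreal (y \<omega> * cnt ?J (D m) \<omega>)"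
          using elim by (simp add: Yfin ennreal_mult y0)
        finally show ?case by simp
      qed
    qed
    also have "\<dots> = c * (\<Prod>i\<in>{1..Suc n}. emeasure \<mu> (?A i))" by (rule c(2)) auto
    also have "(\<Prod>i\<in>{1..Suc n}. emeasure \<mu> (?A i)) = emeasure \<mu> (D m) * emeasure \<mu> ?B ^ n"
    proof -
      have "(\<Prod>i\<in>{1..n}. emeasure \<mu> (?A i)) = (\<Prod>i\<in>{1..n}. emeasure \<mu> ?B)" by (rule prod.cong) auto
      then show ?thesis unfolding ins by simp
    qed
    also have "c * \<dots> = ennreal (c' * \<beta> ^ n * d m)"
      unfolding c'(1) \<beta>(1) emeasure_mu_eq[OF Dfin] using c'(2) \<beta>(2) d[of m]
      by (simp add: ennreal_power ennreal_mult d_def mult_ac)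
    finally have "has_bochner_integral P (\<lambda>\<omega>. y \<omega> * cnt ?J (D m) \<omega>) (c' * \<beta> ^ n * d m)"
      using c'(2) \<beta>(2) d[of m] by (intro has_bochner_integral_nn_integral) (auto simp: y_def)
    then have "has_bochner_integral P (\<lambda>\<omega>. y \<omega> * cnt ?J (D m) \<omega> * (1 / d m)) (c' * \<beta> ^ n * d m * (1 / d m))"
      by (rule has_bochner_integral_mult_left)
    then show ?thesis using d[of m] by (simp add: X_def)
  qed
  define M where "M = (\<integral>\<^sup>+ \<omega>. ennreal (y \<omega>) ^ 2 \<partial>P)"
  have M: "M < \<infinity>"
  proof -
    have "M \<le> (\<integral>\<^sup>+ \<omega>. ecard (points \<omega> \<inter> ?B) ^ (n * 2) \<partial>P)"
      unfolding M_def power_mult using Yle by (intro nn_integral_mono power_mono) (auto simp flip: Yfin)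
    also have "\<dots> < \<infinity>" using b by (intro moment_finite) auto
    finally show ?thesis .
  qed
  then obtain M' where M': "M = ennreal M'" "0 \<le> M'" by (cases M) auto
  have le: "(c' * \<beta> ^ n - ?\<alpha> * (p * \<beta> ^ n))\<^sup>2 \<le> M' * (2 * ?\<alpha>) * (1 / 4) ^ m" for m
  proof -
    let ?D = "c' * \<beta> ^ n - ?\<alpha> * (p * \<beta> ^ n)"
    have "has_bochner_integral P (\<lambda>\<omega>. y \<omega> * X m \<omega> - ?\<alpha> * y \<omega>) ?D"
      by (intro has_bochner_integral_diff has_bochner_integral_mult_right EyX Ey)
    then have int: "integrable P (\<lambda>\<omega>. y \<omega> * X m \<omega> - ?\<alpha> * y \<omega>)" and Deq: "?D = (\<integral>\<omega>. y \<omega> * X m \<omega> - ?\<alpha> * y \<omega> \<partial>P)"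
      by (simp_all add: has_bochner_integral_iff)
    have "ennreal \<bar>?D\<bar> \<le> (\<integral>\<^sup>+ \<omega>. ennreal \<bar>y \<omega> * X m \<omega> - ?\<alpha> * y \<omega>\<bar> \<partial>P)"
      using integral_norm_bound_ennreal[OF int] Deq by simp
    also have "\<dots> = (\<integral>\<^sup>+ \<omega>. ennreal (y \<omega>) * ennreal \<bar>X m \<omega> - ?\<alpha>\<bar> \<partial>P)"
    proof (rule nn_integral_cong)
      fix \<omega>
      have "y \<omega> * X m \<omega> - ?\<alpha> * y \<omega> = y \<omega> * (X m \<omega> - ?\<alpha>)" by (simp add: algebra_simps)
      then show "ennreal \<bar>y \<omega> * X m \<omega> - ?\<alpha> * y \<omega>\<bar> = ennreal (y \<omega>) * ennreal \<bar>X m \<omega> - ?\<alpha>\<bar>"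
        by (simp add: abs_mult ennreal_mult y_def)
    qed
    finally have "(ennreal \<bar>?D\<bar>)\<^sup>2 \<le> (\<integral>\<^sup>+ \<omega>. ennreal (y \<omega>) * ennreal \<bar>X m \<omega> - ?\<alpha>\<bar> \<partial>P)\<^sup>2"
      by (rule power_mono) simp
    also have "\<dots> \<le> M * (\<integral>\<^sup>+ \<omega>. (ennreal \<bar>X m \<omega> - ?\<alpha>\<bar>)\<^sup>2 \<partial>P)"
      unfolding M_def by (rule Cauchy_Schwarz_nn_integral) measurable
    also have "(\<integral>\<^sup>+ \<omega>. (ennreal \<bar>X m \<omega> - ?\<alpha>\<bar>)\<^sup>2 \<partial>P) = (\<integral>\<^sup>+ \<omega>. ennreal ((X m \<omega> - ?\<alpha>)\<^sup>2) \<partial>P)"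
      by (simp add: ennreal_power)
    also have "M * \<dots> \<le> M * ennreal (2 * ?\<alpha> / 4 ^ m)"
      unfolding X_def d_def by (intro mult_left_mono law_of_large_numbers[OF J D Dfin Dlarge]) simp
    also have "\<dots> = ennreal (M' * (2 * ?\<alpha>) * (1 / 4) ^ m)"
      using M' by (simp add: ennreal_mult[symmetric] root_intensity_nonneg power_divide)
    finally have "ennreal (?D\<^sup>2) \<le> ennreal (M' * (2 * ?\<alpha>) * (1 / 4) ^ m)"
      by (simp add: ennreal_power)
    then show ?thesis using M' by (subst (asm) ennreal_le_iff) (auto simp: root_intensity_nonneg)
  qed
  have "(\<lambda>m. M' * (2 * ?\<alpha>) * (1 / 4) ^ m) \<longlonglongrightarrow> M' * (2 * ?\<alpha>) * 0"
    by (intro tendsto_mult_left LIMSEQ_power_zero) simp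
  then have "(c' * \<beta> ^ n - ?\<alpha> * (p * \<beta> ^ n))\<^sup>2 \<le> M' * (2 * ?\<alpha>) * 0"
    by (rule LIMSEQ_le_const) (use le in auto)
  then have "c' * \<beta> ^ n = ?\<alpha> * p * \<beta> ^ n" by simp
  then have "c' = ?\<alpha> * p" using \<beta>(2) by simp
  then have "c = (\<Prod>i\<in>{1..Suc n}. ennreal (root_intensity (f i)))"
    using p by (simp add: c'(1) p_def ennreal_mult root_intensity_nonneg prod_ennreal prod_nonneg mult.commute)
  then show ?case using c(2)[of A] Suc.prems(2) by simp
qed

end

section \<open>From factorial moments to Poisson laws\<close>

lemma Suc_times_choose_Suc: "Suc q * (z choose Suc q) = (z - q) * (z choose q)"
  by (simp only: binomial_absorption binomial_absorb_comp)

text \<open>The sets \<open>F l\<close> are disjoint, so a new coordinate with label \<open>l\<close> only has to avoid the earlier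
  ones with label \<open>l\<close>. Each factor is a falling factorial.\<close>

lemma card_labelled_injections:
  assumes I: "finite I" and L: "finite L" and g: "\<And>i. i \<in> I \<Longrightarrow> g i \<in> L"
    and F: "\<And>l. l \<in> L \<Longrightarrow> finite (F l)" and disj: "disjoint_family_on F L"
  shows "card {x \<in> PiE I (\<lambda>i. F (g i)). inj_on x I} =
    (\<Prod>l\<in>L. fact (card {i \<in> I. g i = l}) * (card (F l) choose card {i \<in> I. g i = l}))"
  using I g
proof (induction I)
  case empty
  have "{x \<in> PiE {} (\<lambda>i. F (g i)). inj_on x {}} = {\<lambda>_. undefined}" by auto
  then show ?case by simp
next
  case (insert a I)
  let ?S = "{x \<in> PiE I (\<lambda>i. F (g i)). inj_on x I}"
  let ?q = "\<lambda>l. card {i \<in> I. g i = l}"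
  have ga: "g a \<in> L" using insert.prems by simp
  have IH: "card ?S = (\<Prod>l\<in>L. fact (?q l) * (card (F l) choose ?q l))"
    using insert by simp
  have finS: "finite ?S"
    by (rule finite_subset[of _ "PiE I (\<lambda>i. F (g i))"]) (use insert F in \<open>auto intro!: finite_PiE\<close>)
  let ?h = "\<lambda>(x, z). x(a := z)"
  have bij: "bij_betw ?h (SIGMA x:?S. F (g a) - x ` I) {x \<in> PiE (insert a I) (\<lambda>i. F (g i)). inj_on x (insert a I)}"
  proof (rule bij_betwI[where g = "\<lambda>x. (restrict x I, x a)"])
    show "?h \<in> (SIGMA x:?S. F (g a) - x ` I) \<rightarrow> {x \<in> PiE (insert a I) (\<lambda>i. F (g i)). inj_on x (insert a I)}"
    proof (rule funcsetI, clarify)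
      fix x z assume x: "x \<in> PiE I (\<lambda>i. F (g i))" "inj_on x I" and z: "z \<in> F (g a)" "z \<notin> x ` I"
      have "x(a := z) \<in> PiE (insert a I) (\<lambda>i. F (g i))"
        using x z by (auto simp: PiE_iff extensional_def)
      moreover have "inj_on (x(a := z)) (insert a I)"
        using x(2) z insert.hyps by (auto simp: inj_on_def)
      ultimately show "x(a := z) \<in> PiE (insert a I) (\<lambda>i. F (g i)) \<and> inj_on (x(a := z)) (insert a I)" ..
    qed
    show "(\<lambda>x. (restrict x I, x a)) \<in> {x \<in> PiE (insert a I) (\<lambda>i. F (g i)). inj_on x (insert a I)} \<rightarrow>
        (SIGMA x:?S. F (g a) - x ` I)"
    proof (rule funcsetI)
      fix x assume "x \<in> {x \<in> PiE (insert a I) (\<lambda>i. F (g i)). inj_on x (insert a I)}"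
      then have x: "x \<in> PiE (insert a I) (\<lambda>i. F (g i))" "inj_on x (insert a I)" by auto
      have "restrict x I \<in> PiE I (\<lambda>i. F (g i))" using x by (auto simp: PiE_iff)
      moreover have "inj_on (restrict x I) I" using x by (simp add: inj_on_restrict_eq inj_on_insert)
      moreover have "x a \<in> F (g a)" using x by (auto simp: PiE_iff)
      moreover have "x a \<notin> restrict x I ` I" using x insert.hyps by (auto simp: inj_on_def)
      ultimately show "(restrict x I, x a) \<in> (SIGMA x:?S. F (g a) - x ` I)" by simp
    qed
    show "(\<lambda>x. (restrict x I, x a)) (?h p) = p" if "p \<in> (SIGMA x:?S. F (g a) - x ` I)" for p
    proof -
      obtain x z where p: "p = (x, z)" by (cases p)
      with that have x: "x \<in> PiE I (\<lambda>i. F (g i))" by simp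
      have "restrict (x(a := z)) I = x"
      proof
        fix i show "restrict (x(a := z)) I i = x i"
          using PiE_arb[OF x, of i] insert.hyps by (cases "i \<in> I") auto
      qed
      then show ?thesis by (simp add: p)
    qed
    show "?h ((\<lambda>x. (restrict x I, x a)) x) = x"
      if "x \<in> {x \<in> PiE (insert a I) (\<lambda>i. F (g i)). inj_on x (insert a I)}" for x
    proof
      fix i
      have "x \<in> PiE (insert a I) (\<lambda>i. F (g i))" using that by simp
      then show "?h ((\<lambda>x. (restrict x I, x a)) x) i = x i"
        using PiE_arb[of x "insert a I" _ i] by (cases "i \<in> insert a I") auto
    qed
  qed
  have fibre: "card (F (g a) - x ` I) = card (F (g a)) - ?q (g a)" if x: "x \<in> ?S" for x
  proof -
    have mem: "x i \<in> F (g i)" if "i \<in> I" for i using x that by (auto simp: PiE_iff)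
    have "F (g a) \<inter> x ` I = x ` {i \<in> I. g i = g a}"
    proof (intro equalityI subsetI)
      fix y assume "y \<in> F (g a) \<inter> x ` I"
      then obtain i where i: "i \<in> I" "y = x i" "x i \<in> F (g a)" by auto
      have "g i = g a"
      proof (rule ccontr)
        assume "g i \<noteq> g a"
        moreover have "g i \<in> L" using i insert.prems by simp
        ultimately have "F (g i) \<inter> F (g a) = {}" using disj ga by (auto simp: disjoint_family_on_def)
        then show False using mem[OF i(1)] i(3) by blast
      qed
      then show "y \<in> x ` {i \<in> I. g i = g a}" using i by auto
    next
      fix y assume "y \<in> x ` {i \<in> I. g i = g a}"
      then obtain i where "i \<in> I" "g i = g a" "y = x i" by auto
      then show "y \<in> F (g a) \<inter> x ` I" using mem[of i] by auto
    qed
    moreover have "card (x ` {i \<in> I. g i = g a}) = ?q (g a)"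
      using x by (intro card_image) (auto intro: inj_on_subset)
    moreover have "card (F (g a) - x ` I) = card (F (g a)) - card (F (g a) \<inter> x ` I)"
      using F[OF ga] by (subst card_Diff_subset_Int) auto
    ultimately show ?thesis by simp
  qed
  have "card {x \<in> PiE (insert a I) (\<lambda>i. F (g i)). inj_on x (insert a I)} = card (SIGMA x:?S. F (g a) - x ` I)"
    using bij by (rule bij_betw_same_card[symmetric])
  also have "\<dots> = (\<Sum>x\<in>?S. card (F (g a) - x ` I))"
    using finS F[OF ga] by (intro card_SigmaI) auto
  also have "\<dots> = (\<Sum>x\<in>?S. card (F (g a)) - ?q (g a))"
    by (rule sum.cong[OF refl]) (rule fibre)
  also have "\<dots> = card ?S * (card (F (g a)) - ?q (g a))" by simp
  also have "\<dots> = (\<Prod>l\<in>L. fact (card {i \<in> insert a I. g i = l}) * (card (F l) choose card {i \<in> insert a I. g i = l}))"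
  proof -
    let ?q' = "\<lambda>l. card {i \<in> insert a I. g i = l}"
    have q'a: "?q' (g a) = Suc (?q (g a))"
    proof -
      have "{i \<in> insert a I. g i = g a} = insert a {i \<in> I. g i = g a}" by auto
      then show ?thesis using insert.hyps by simp
    qed
    have q'l: "?q' l = ?q l" if "l \<noteq> g a" for l
      by (rule arg_cong[where f = card]) (use that in auto)
    have "(\<Prod>l\<in>L. fact (?q' l) * (card (F l) choose ?q' l)) =
      fact (?q' (g a)) * (card (F (g a)) choose ?q' (g a)) * (\<Prod>l\<in>L - {g a}. fact (?q' l) * (card (F l) choose ?q' l))"
      using L ga by (rule prod.remove)
    also have "(\<Prod>l\<in>L - {g a}. fact (?q' l) * (card (F l) choose ?q' l)) = (\<Prod>l\<in>L - {g a}. fact (?q l) * (card (F l) choose ?q l))"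
    proof (rule prod.cong[OF refl])
      fix l assume "l \<in> L - {g a}"
      then have "?q' l = ?q l" by (intro q'l) simp
      then show "fact (?q' l) * (card (F l) choose ?q' l) = fact (?q l) * (card (F l) choose ?q l)"
        by (simp only:)
    qed
    also have "fact (?q' (g a)) * (card (F (g a)) choose ?q' (g a)) =
        fact (?q (g a)) * (Suc (?q (g a)) * (card (F (g a)) choose Suc (?q (g a))))"
      unfolding q'a by (simp add: algebra_simps)
    also have "\<dots> = fact (?q (g a)) * (card (F (g a)) choose ?q (g a)) * (card (F (g a)) - ?q (g a))"
      unfolding Suc_times_choose_Suc by (simp only: mult_ac)
    also have "\<dots> * (\<Prod>l\<in>L - {g a}. fact (?q l) * (card (F l) choose ?q l)) = card ?S * (card (F (g a)) - ?q (g a))"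
      unfolding IH prod.remove[OF L ga] by (simp only: mult_ac)
    finally show ?thesis by simp
  qed
  finally show ?case .
qed

lemma binomial_inversion:
  "(\<lambda>q. (-1) ^ q * real (q + n choose n) * real (z choose (q + n))) sums of_bool (z = n)"
proof (cases "n \<le> z")
  case True
  have "(\<lambda>q. (-1) ^ q * real (q + n choose n) * real (z choose (q + n))) sums
      (\<Sum>q\<le>z - n. (-1) ^ q * real (q + n choose n) * real (z choose (q + n)))"
    by (rule sums_finite) (auto intro: binomial_eq_0)
  also have "(\<Sum>q\<le>z - n. (-1) ^ q * real (q + n choose n) * real (z choose (q + n))) =
      (\<Sum>q\<le>z - n. real (z choose n) * ((-1) ^ q * real (z - n choose q)))"
  proof (rule sum.cong[OF refl])
    fix q assume "q \<in> {..z - n}"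
    then have "(z choose (q + n)) * (q + n choose n) = (z choose n) * (z - n choose q)"
      using choose_mult[of n "q + n" z] True by simp
    then have "real (z choose (q + n)) * real (q + n choose n) = real (z choose n) * real (z - n choose q)"
      by (simp flip: of_nat_mult)
    then show "(-1) ^ q * real (q + n choose n) * real (z choose (q + n)) = real (z choose n) * ((-1) ^ q * real (z - n choose q))"
      by (simp add: mult_ac)
  qed
  also have "\<dots> = real (z choose n) * (\<Sum>q\<le>z - n. (-1) ^ q * real (z - n choose q))"
    by (rule sum_distrib_left[symmetric])
  also have "\<dots> = of_bool (z = n)"
    using choose_alternating_sum[of "z - n", where 'a = real] True by (cases "z = n") auto
  finally show ?thesis .
next
  case False
  then have 0: "z choose (q + n) = 0" for q by (simp add: binomial_eq_0)
  from False have "z \<noteq> n" by simp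
  then show ?thesis by (simp only: 0) simp
qed

text \<open>The alternating series of \<open>binomial_inversion\<close> may be integrated term by term, because Poisson
  factorial moments make it absolutely convergent in mean. The weight \<open>W\<close> allows the counts of a family
  to be treated one at a time.\<close>

lemma factorial_moment_inversion:
  fixes Z :: "'w \<Rightarrow> nat" and W :: "'w \<Rightarrow> real"
  assumes W: "\<And>\<omega>. 0 \<le> W \<omega>" and l: "0 \<le> l"
    and mom: "\<And>q. has_bochner_integral M (\<lambda>\<omega>. W \<omega> * real (Z \<omega> choose q)) (w * (l ^ q / fact q))"
  shows "has_bochner_integral M (\<lambda>\<omega>. W \<omega> * of_bool (Z \<omega> = n)) (w * (l ^ n / fact n * exp (- l)))"
proof -
  define f where "f q \<omega> = ((-1) ^ q * real (q + n choose n)) * (W \<omega> * real (Z \<omega> choose (q + n)))" for q \<omega>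
  have coeff: "real (q + n choose n) * (l ^ (q + n) / fact (q + n)) = l ^ n / fact n * (l ^ q / fact q)" for q
    by (simp add: binomial_fact power_add field_simps)
  have fi: "has_bochner_integral M (f q) (w * (l ^ n / fact n) * ((- l) ^ q / fact q))" for q
  proof -
    have "has_bochner_integral M (f q) ((-1) ^ q * real (q + n choose n) * (w * (l ^ (q + n) / fact (q + n))))"
      unfolding f_def[abs_def] by (intro has_bochner_integral_mult_right mom)
    also have "(-1) ^ q * real (q + n choose n) * (w * (l ^ (q + n) / fact (q + n))) =
        (-1) ^ q * w * (real (q + n choose n) * (l ^ (q + n) / fact (q + n)))" by (simp only: mult_ac)
    also have "\<dots> = w * (l ^ n / fact n) * ((- l) ^ q / fact q)"
      unfolding coeff by (simp add: power_minus[of l])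
    finally show ?thesis .
  qed
  have fn: "has_bochner_integral M (\<lambda>\<omega>. norm (f q \<omega>)) (w * (l ^ n / fact n) * (l ^ q / fact q))" for q
  proof -
    have "has_bochner_integral M (\<lambda>\<omega>. real (q + n choose n) * (W \<omega> * real (Z \<omega> choose (q + n))))
        (real (q + n choose n) * (w * (l ^ (q + n) / fact (q + n))))"
      by (intro has_bochner_integral_mult_right mom)
    moreover have "real (q + n choose n) * (w * (l ^ (q + n) / fact (q + n))) = w * (l ^ n / fact n) * (l ^ q / fact q)"
      using coeff[of q] by (simp only: mult.left_commute[of "real (q + n choose n)"] mult.assoc)
    moreover have "norm (f q \<omega>) = real (q + n choose n) * (W \<omega> * real (Z \<omega> choose (q + n)))" for \<omega>
      using W[of \<omega>] by (simp add: f_def abs_mult)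
    ultimately show ?thesis by simp
  qed
  have sums: "(\<lambda>q. f q \<omega>) sums (W \<omega> * of_bool (Z \<omega> = n))" for \<omega>
    using sums_mult[OF binomial_inversion[of n "Z \<omega>"], of "W \<omega>"] by (simp add: f_def mult_ac)
  have exps: "(\<lambda>q. x ^ q / fact q) sums exp x" for x :: real
    using exp_converges[of x] by (simp add: divide_inverse mult.commute scaleR_conv_of_real)
  have int: "integrable M (f q)" for q using fi by (simp add: has_bochner_integral_iff)
  have ae: "AE \<omega> in M. summable (\<lambda>q. norm (f q \<omega>))"
  proof (rule AE_I2)
    fix \<omega> show "summable (\<lambda>q. norm (f q \<omega>))"
      by (rule summable_finite[of "{..Z \<omega>}"]) (auto simp: f_def binomial_eq_0)
  qed
  have "(\<integral>\<omega>. norm (f q \<omega>) \<partial>M) = w * (l ^ n / fact n) * (l ^ q / fact q)" for q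
    using fn by (simp only: has_bochner_integral_iff)
  then have sn: "summable (\<lambda>q. \<integral>\<omega>. norm (f q \<omega>) \<partial>M)"
    using sums_summable[OF exps[of l]] by (simp only: summable_mult)
  have "integrable M (\<lambda>\<omega>. \<Sum>q. f q \<omega>)" by (rule integrable_suminf[OF int ae sn])
  moreover have "(\<integral>\<omega>. (\<Sum>q. f q \<omega>) \<partial>M) = w * (l ^ n / fact n * exp (- l))"
  proof -
    have "(\<integral>\<omega>. (\<Sum>q. f q \<omega>) \<partial>M) = (\<Sum>q. \<integral>\<omega>. f q \<omega> \<partial>M)" by (rule integral_suminf[OF int ae sn])
    also have "(\<lambda>q. \<integral>\<omega>. f q \<omega> \<partial>M) = (\<lambda>q. w * (l ^ n / fact n) * ((- l) ^ q / fact q))"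
      using fi by (simp only: has_bochner_integral_iff)
    also have "suminf \<dots> = w * (l ^ n / fact n) * exp (- l)"
      using sums_mult[OF exps[of "- l"], of "w * (l ^ n / fact n)"] by (rule sums_unique[symmetric])
    finally show ?thesis by (simp only: mult.assoc)
  qed
  moreover have "(\<lambda>\<omega>. \<Sum>q. f q \<omega>) = (\<lambda>\<omega>. W \<omega> * of_bool (Z \<omega> = n))"
    by (rule ext) (rule sums_unique[OF sums, symmetric])
  ultimately show ?thesis by (simp add: has_bochner_integral_iff)
qed

context ergodic_process
begin

text \<open>Up to factorials, the product of the binomial coefficients is the number of injective tuples with
  \<open>q l\<close> coordinates in the set with label \<open>l\<close>.\<close>

lemma joint_factorial_moment:
  fixes J :: "'l \<Rightarrow> int set" and A :: "'l \<Rightarrow> 'a set" and q :: "'l \<Rightarrow> nat"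
  assumes L: "finite L" and J: "\<And>l. l \<in> L \<Longrightarrow> J l \<in> shapes"
    and A: "\<And>l. l \<in> L \<Longrightarrow> A l \<in> sets borel" "\<And>l. l \<in> L \<Longrightarrow> emeasure \<mu> (A l) < \<infinity>"
    and disj: "\<And>l l'. l \<in> L \<Longrightarrow> l' \<in> L \<Longrightarrow> l \<noteq> l' \<Longrightarrow> J l \<noteq> J l' \<or> A l \<inter> A l' = {}"
  shows "has_bochner_integral P (\<lambda>\<omega>. \<Prod>l\<in>L. real (card (roots (J l) \<omega> \<inter> A l) choose q l))
    (\<Prod>l\<in>L. (root_intensity (J l) * measure \<mu> (A l)) ^ q l / fact (q l))"
proof -
  let ?\<Sigma> = "SIGMA l:L. {..<q l}"
  define n where "n = card ?\<Sigma>"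
  have "finite ?\<Sigma>" using L by auto
  then obtain h where h: "bij_betw h {1..n} ?\<Sigma>"
    using ex_bij_betw_nat_finite_1[of ?\<Sigma>] unfolding n_def by blast
  define g where "g i = fst (h i)" for i
  have g: "g i \<in> L" if "i \<in> {1..n}" for i
    using bij_betw_apply[OF h that] by (auto simp: g_def)
  have qg: "card {i \<in> {1..n}. g i = l} = q l" if l: "l \<in> L" for l
  proof -
    have "bij_betw h {i \<in> {1..n}. g i = l} ({l} \<times> {..<q l})"
      unfolding bij_betw_def
    proof
      show "inj_on h {i \<in> {1..n}. g i = l}"
        using bij_betw_imp_inj_on[OF h] by (rule inj_on_subset) auto
      show "h ` {i \<in> {1..n}. g i = l} = {l} \<times> {..<q l}"
      proof (intro equalityI subsetI)
        fix p assume "p \<in> h ` {i \<in> {1..n}. g i = l}"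
        then obtain i where "i \<in> {1..n}" "g i = l" "p = h i" by auto
        then show "p \<in> {l} \<times> {..<q l}" using bij_betw_apply[OF h, of i] by (auto simp: g_def)
      next
        fix p assume p: "p \<in> {l} \<times> {..<q l}"
        then have "p \<in> ?\<Sigma>" using l by auto
        then obtain i where "i \<in> {1..n}" "p = h i" using bij_betw_imp_surj_on[OF h] by blast
        then show "p \<in> h ` {i \<in> {1..n}. g i = l}" using p by (auto simp: g_def)
      qed
    qed
    from bij_betw_same_card[OF this] show ?thesis by simp
  qed
  let ?F = "\<lambda>\<omega> l. roots (J l) \<omega> \<inter> A l"
  let ?l = "\<lambda>l. root_intensity (J l) * measure \<mu> (A l)"
  have l0: "0 \<le> ?l l" for l by (simp add: root_intensity_nonneg)
  have "AE \<omega> in P. \<forall>l\<in>L. finite (?F \<omega> l)"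
    using L A by (intro AE_finite_allI AE_finite_roots) auto
  then have count: "AE \<omega> in P. ennreal (\<Prod>l\<in>L. fact (q l) * real (card (?F \<omega> l) choose q l)) =
      ecard (tuples n (\<lambda>i. roots (J (g i))) \<omega> \<inter> PiE {1..n} (\<lambda>i. A (g i)))"
  proof eventually_elim
    case (elim \<omega>)
    have "tuples n (\<lambda>i. roots (J (g i))) \<omega> \<inter> PiE {1..n} (\<lambda>i. A (g i)) =
        {x \<in> PiE {1..n} (\<lambda>i. ?F \<omega> (g i)). inj_on x {1..n}}"
      by (auto simp: tuples_def PiE_iff extensional_def)
    moreover have "card {x \<in> PiE {1..n} (\<lambda>i. ?F \<omega> (g i)). inj_on x {1..n}} =
        (\<Prod>l\<in>L. fact (card {i \<in> {1..n}. g i = l}) * (card (?F \<omega> l) choose card {i \<in> {1..n}. g i = l}))"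
    proof (rule card_labelled_injections)
      show "disjoint_family_on (?F \<omega>) L"
        unfolding disjoint_family_on_def
      proof (intro ballI impI)
        fix l l' assume ll: "l \<in> L" "l' \<in> L" "l \<noteq> l'"
        show "?F \<omega> l \<inter> ?F \<omega> l' = {}"
          using disj[OF ll] roots_disjoint[of "J l" "J l'" \<omega>] by blast
      qed
    qed (use L g elim in auto)
    moreover have "\<dots> = (\<Prod>l\<in>L. fact (q l) * (card (?F \<omega> l) choose q l))"
      by (rule prod.cong[OF refl]) (simp only: qg)
    moreover have "finite {x \<in> PiE {1..n} (\<lambda>i. ?F \<omega> (g i)). inj_on x {1..n}}"
      by (rule finite_subset[of _ "PiE {1..n} (\<lambda>i. ?F \<omega> (g i))"]) (use elim g in \<open>auto intro!: finite_PiE\<close>)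
    ultimately have "ecard (tuples n (\<lambda>i. roots (J (g i))) \<omega> \<inter> PiE {1..n} (\<lambda>i. A (g i))) =
        of_nat (\<Prod>l\<in>L. fact (q l) * (card (?F \<omega> l) choose q l))"
      by (simp only: ecard_finite)
    also have "\<dots> = ennreal (\<Prod>l\<in>L. fact (q l) * real (card (?F \<omega> l) choose q l))"
      by (simp add: ennreal_of_nat_eq_real_of_nat of_nat_prod)
    finally show ?case by simp
  qed
  have meas: "(\<lambda>\<omega>. real (card (?F \<omega> l) choose k)) \<in> borel_measurable P" if "l \<in> L" for l k
  proof -
    have "(\<lambda>\<omega>. nat \<lfloor>cnt (J l) (A l) \<omega>\<rfloor>) \<in> P \<rightarrow>\<^sub>M count_space UNIV"
      using cnt_measurable[OF A(1)[OF that], of "J l"] by measurable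
    moreover have "nat \<lfloor>cnt (J l) (A l) \<omega>\<rfloor> = card (?F \<omega> l)" for \<omega>
      by (cases "finite (?F \<omega> l)") (auto simp: cnt_def ecard_finite ecard_infinite)
    ultimately have "(\<lambda>\<omega>. card (?F \<omega> l)) \<in> P \<rightarrow>\<^sub>M count_space UNIV" by simp
    then show ?thesis by (rule measurable_compose) simp
  qed
  have "(\<integral>\<^sup>+ \<omega>. ennreal (\<Prod>l\<in>L. fact (q l) * real (card (?F \<omega> l) choose q l)) \<partial>P) =
      (\<integral>\<^sup>+ \<omega>. ecard (tuples n (\<lambda>i. roots (J (g i))) \<omega> \<inter> PiE {1..n} (\<lambda>i. A (g i))) \<partial>P)"
    using count by (rule nn_integral_cong_AE)
  also have "\<dots> = (\<Prod>i\<in>{1..n}. ennreal (root_intensity (J (g i)))) * (\<Prod>i\<in>{1..n}. emeasure \<mu> (A (g i)))"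
    by (rule factorial_moment) (use g J A in auto)
  also have "\<dots> = (\<Prod>i\<in>{1..n}. ennreal (?l (g i)))"
    unfolding prod.distrib[symmetric]
  proof (rule prod.cong[OF refl])
    fix i assume "i \<in> {1..n}"
    then have "emeasure \<mu> (A (g i)) = ennreal (measure \<mu> (A (g i)))" using g A by (intro emeasure_mu_eq) auto
    then show "ennreal (root_intensity (J (g i))) * emeasure \<mu> (A (g i)) = ennreal (?l (g i))"
      by (simp add: ennreal_mult root_intensity_nonneg)
  qed
  also have "\<dots> = ennreal (\<Prod>i\<in>{1..n}. ?l (g i))" using l0 by (simp add: prod_ennreal)
  also have "(\<Prod>i\<in>{1..n}. ?l (g i)) = (\<Prod>p\<in>?\<Sigma>. ?l (fst p))"
    unfolding g_def by (rule prod.reindex_bij_betw[OF h])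
  also have "\<dots> = (\<Prod>l\<in>L. \<Prod>k\<in>{..<q l}. ?l l)"
    using L by (subst prod.Sigma) (auto simp: case_prod_beta)
  also have "\<dots> = (\<Prod>l\<in>L. ?l l ^ q l)" by simp
  finally have "has_bochner_integral P (\<lambda>\<omega>. \<Prod>l\<in>L. fact (q l) * real (card (?F \<omega> l) choose q l)) (\<Prod>l\<in>L. ?l l ^ q l)"
    using l0 by (intro has_bochner_integral_nn_integral borel_measurable_prod borel_measurable_times meas)
      (auto intro!: prod_nonneg)
  then have "has_bochner_integral P (\<lambda>\<omega>. (\<Prod>l\<in>L. fact (q l) * real (card (?F \<omega> l) choose q l)) * (1 / (\<Prod>l\<in>L. fact (q l))))
      ((\<Prod>l\<in>L. ?l l ^ q l) * (1 / (\<Prod>l\<in>L. fact (q l))))"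
    by (rule has_bochner_integral_mult_left)
  moreover have "(\<Prod>l\<in>L. fact (q l)) \<noteq> (0::real)" using L by simp
  ultimately show ?thesis by (simp add: prod.distrib prod_dividef)
qed

lemma joint_poisson_law:
  fixes J :: "'l \<Rightarrow> int set" and A :: "'l \<Rightarrow> 'a set" and k :: "'l \<Rightarrow> nat"
  assumes L: "finite L" and J: "\<And>l. l \<in> L \<Longrightarrow> J l \<in> shapes"
    and A: "\<And>l. l \<in> L \<Longrightarrow> A l \<in> sets borel" "\<And>l. l \<in> L \<Longrightarrow> emeasure \<mu> (A l) < \<infinity>"
    and disj: "\<And>l l'. l \<in> L \<Longrightarrow> l' \<in> L \<Longrightarrow> l \<noteq> l' \<Longrightarrow> J l \<noteq> J l' \<or> A l \<inter> A l' = {}"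
  shows "prob {\<omega> \<in> space P. \<forall>l\<in>L. ecard (roots (J l) \<omega> \<inter> A l) = of_nat (k l)} =
    (\<Prod>l\<in>L. (root_intensity (J l) * measure \<mu> (A l)) ^ k l / fact (k l) *
      exp (- (root_intensity (J l) * measure \<mu> (A l))))"
proof -
  let ?Z = "\<lambda>l \<omega>. card (roots (J l) \<omega> \<inter> A l)"
  let ?l = "\<lambda>l. root_intensity (J l) * measure \<mu> (A l)"
  have l0: "0 \<le> ?l l" for l by (simp add: root_intensity_nonneg)
  \<comment> \<open>Binomial moments are replaced by point probabilities for one index after the other.\<close>
  have partial: "has_bochner_integral P
      (\<lambda>\<omega>. (\<Prod>l\<in>K. of_bool (?Z l \<omega> = k l)) * (\<Prod>l\<in>L - K. real (?Z l \<omega> choose q l)))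
      ((\<Prod>l\<in>K. ?l l ^ k l / fact (k l) * exp (- ?l l)) * (\<Prod>l\<in>L - K. ?l l ^ q l / fact (q l)))"
    if "finite K" "K \<subseteq> L" for K q
    using that
  proof (induction K arbitrary: q rule: finite_subset_induct')
    case empty
    then show ?case using joint_factorial_moment[OF L J A disj, where q = q] by simp
  next
    case (insert a K)
    have LK: "finite (L - K)" "a \<in> L - K" using L insert by auto
    have LaK: "L - K - {a} = L - insert a K" by auto
    let ?W = "\<lambda>\<omega>. (\<Prod>l\<in>K. of_bool (?Z l \<omega> = k l)) * (\<Prod>l\<in>L - insert a K. real (?Z l \<omega> choose q l))"
    let ?w = "(\<Prod>l\<in>K. ?l l ^ k l / fact (k l) * exp (- ?l l)) * (\<Prod>l\<in>L - insert a K. ?l l ^ q l / fact (q l))"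
    have "has_bochner_integral P (\<lambda>\<omega>. ?W \<omega> * real (?Z a \<omega> choose j)) (?w * (?l a ^ j / fact j))" for j
    proof -
      have 1: "(\<Prod>l\<in>L - K. real (?Z l \<omega> choose (q(a := j)) l)) =
          real (?Z a \<omega> choose j) * (\<Prod>l\<in>L - insert a K. real (?Z l \<omega> choose q l))" for \<omega>
        unfolding prod.remove[OF LK] LaK
        by (intro arg_cong2[where f = "(*)"] prod.cong) auto
      have 2: "(\<Prod>l\<in>L - K. ?l l ^ (q(a := j)) l / fact ((q(a := j)) l)) =
          (?l a ^ j / fact j) * (\<Prod>l\<in>L - insert a K. ?l l ^ q l / fact (q l))"
        unfolding prod.remove[OF LK] LaK
        by (intro arg_cong2[where f = "(*)"] prod.cong) auto
      show ?thesis using insert.IH[of "q(a := j)"] unfolding 1 2 by (simp only: mult_ac)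
    qed
    then have "has_bochner_integral P (\<lambda>\<omega>. ?W \<omega> * of_bool (?Z a \<omega> = k a)) (?w * (?l a ^ k a / fact (k a) * exp (- ?l a)))"
      using l0 by (intro factorial_moment_inversion) (auto intro!: mult_nonneg_nonneg prod_nonneg)
    then show ?case
      using insert.hyps by (simp add: mult_ac)
  qed
  have fin: "AE \<omega> in P. \<forall>l\<in>L. finite (roots (J l) \<omega> \<inter> A l)"
    using L A by (intro AE_finite_allI AE_finite_roots) auto
  let ?E = "{\<omega> \<in> space P. \<forall>l\<in>L. ecard (roots (J l) \<omega> \<inter> A l) = of_nat (k l)}"
  have E: "?E \<in> events"
  proof (rule sets.sets_Collect_finite_All[OF _ L])
    fix l assume "l \<in> L"
    then have "(\<lambda>\<omega>. ecard (roots (J l) \<omega> \<inter> A l)) \<in> borel_measurable P" using A by (intro ecard_roots_measurable)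
    then show "{\<omega> \<in> space P. ecard (roots (J l) \<omega> \<inter> A l) = of_nat (k l)} \<in> events" by measurable
  qed
  have "prob ?E = (\<integral>\<omega>. indicator ?E \<omega> \<partial>P)" using E by simp
  also have "\<dots> = (\<integral>\<omega>. (\<Prod>l\<in>L. of_bool (?Z l \<omega> = k l)) \<partial>P)"
  proof (rule integral_cong_AE)
    show "AE \<omega> in P. indicator ?E \<omega> = (\<Prod>l\<in>L. of_bool (?Z l \<omega> = k l) :: real)"
      using fin AE_space
    proof eventually_elim
      case (elim \<omega>)
      have "\<omega> \<in> ?E \<longleftrightarrow> (\<forall>l\<in>L. ?Z l \<omega> = k l)"
        using elim by (auto simp: ecard_finite)
      moreover have "(\<Prod>l\<in>L. of_bool (?Z l \<omega> = k l) :: real) = of_bool (\<forall>l\<in>L. ?Z l \<omega> = k l)"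
      proof (cases "\<forall>l\<in>L. ?Z l \<omega> = k l")
        case False
        then show ?thesis using L by (auto intro!: prod_zero)
      qed simp
      ultimately show ?case by (simp add: indicator_def)
    qed
    show "(\<lambda>\<omega>. \<Prod>l\<in>L. of_bool (?Z l \<omega> = k l) :: real) \<in> borel_measurable P"
      using partial[of L] L by (simp add: has_bochner_integral_iff borel_measurable_integrable)
  qed (use E in simp)
  also have "\<dots> = (\<Prod>l\<in>L. ?l l ^ k l / fact (k l) * exp (- ?l l))"
    using partial[of L] L by (simp add: has_bochner_integral_iff)

  finally show ?thesis .
qed

end

section \<open>Independence from void probabilities\<close>

text \<open>Finitely many points can be separated by disjoint cells, so the number of points is determined
  by the cells that contain a point.\<close>

lemma ecard_le_iff_cells:
  fixes R :: "'a::polish_space set"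
  shows "of_nat n \<le> ecard R \<longleftrightarrow>
    (\<exists>F. finite F \<and> card F = n \<and> disjoint_family_on (cell :: nat \<Rightarrow> 'a set) F \<and> (\<forall>j\<in>F. R \<inter> cell j \<noteq> {}))"
proof
  assume n: "of_nat n \<le> ecard R"
  obtain Q where Q: "Q \<subseteq> R" "finite Q" "card Q = n"
  proof (cases "finite R")
    case True
    then have "n \<le> card R" using n by (simp add: ecard_finite)
    then show ?thesis using obtain_subset_with_card_n that by metis
  next
    case False
    then show ?thesis using infinite_arbitrarily_large[OF False, of n] that by metis
  qed
  have "\<exists>d>0. \<forall>y\<in>Q. y \<noteq> x \<longrightarrow> d \<le> dist x y" for x using finite_set_avoid[OF Q(2)] by blast
  then obtain d where d: "\<And>x. 0 < d x" "\<And>x y. y \<in> Q \<Longrightarrow> y \<noteq> x \<Longrightarrow> d x \<le> dist x y" by metis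
  have "\<exists>j. x \<in> cell j \<and> cell j \<subseteq> ball x (d x / 2)" for x
    using cell_base[of "ball x (d x / 2)" x] d(1)[of x] by simp
  then obtain c where c: "\<And>x. x \<in> cell (c x)" "\<And>x. cell (c x) \<subseteq> ball x (d x / 2)" by metis
  have disj: "(cell (c x) \<inter> cell (c y) :: 'a set) = {}" if "x \<in> Q" "y \<in> Q" "x \<noteq> y" for x y
  proof (rule equals0I)
    fix z :: 'a assume "z \<in> cell (c x) \<inter> cell (c y)"
    then have "z \<in> ball x (d x / 2)" "z \<in> ball y (d y / 2)" using c(2)[of x] c(2)[of y] by blast+
    then have "dist x z < d x / 2" "dist y z < d y / 2" by simp_all
    moreover have "d x \<le> dist x y" "d y \<le> dist x y"
      using d(2)[of y x] d(2)[of x y] that by (simp_all add: dist_commute)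
    moreover have "dist x y \<le> dist x z + dist y z" by (rule dist_triangle2)
    ultimately show False by linarith
  qed
  have inj: "inj_on c Q"
  proof (rule inj_onI)
    fix x y assume "x \<in> Q" "y \<in> Q" "c x = c y"
    then show "x = y" using disj[of x y] c(1)[of x] by auto
  qed
  show "\<exists>F. finite F \<and> card F = n \<and> disjoint_family_on (cell :: nat \<Rightarrow> 'a set) F \<and> (\<forall>j\<in>F. R \<inter> cell j \<noteq> {})"
  proof (intro exI[of _ "c ` Q"] conjI ballI)
    show "disjoint_family_on (cell :: nat \<Rightarrow> 'a set) (c ` Q)"
      using disj by (auto simp: disjoint_family_on_def)
    show "card (c ` Q) = n" using card_image[OF inj] Q by simp
  qed (use Q c in auto)
next
  assume "\<exists>F. finite F \<and> card F = n \<and> disjoint_family_on (cell :: nat \<Rightarrow> 'a set) F \<and> (\<forall>j\<in>F. R \<inter> cell j \<noteq> {})"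
  then obtain F where F: "finite F" "card F = n" "disjoint_family_on (cell :: nat \<Rightarrow> 'a set) F" "\<And>j. j \<in> F \<Longrightarrow> R \<inter> cell j \<noteq> {}"
    by blast
  have "of_nat n = (\<Sum>j\<in>F. (1::ennreal))" using F by simp
  also have "\<dots> \<le> (\<Sum>j\<in>F. ecard (R \<inter> cell j))"
  proof (rule sum_mono)
    fix j assume "j \<in> F"
    then obtain x where "{x} \<subseteq> R \<inter> cell j" using F(4) by blast
    from ecard_mono[OF this] show "1 \<le> ecard (R \<inter> cell j)" by simp
  qed
  also have "\<dots> = ecard (\<Union>j\<in>F. R \<inter> cell j)"
    using F(1,3) by (intro ecard_UN_disjoint_finite[symmetric]) (auto simp: disjoint_family_on_def)
  also have "\<dots> \<le> ecard R" by (rule ecard_mono) auto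
  finally show "of_nat n \<le> ecard R" .
qed

definition void_events :: "'w measure \<Rightarrow> ('w \<Rightarrow> 'a::polish_space set) \<Rightarrow> 'w set set" where
  "void_events M R = {{\<omega> \<in> space M. R \<omega> \<inter> A = {}} |A. A \<in> sets borel \<and> bounded A}"

lemma Int_stable_void_events: "Int_stable (void_events M R)"
  unfolding Int_stable_def void_events_def
proof (clarify)
  fix A B :: "'b set" assume "A \<in> sets borel" "bounded A" "B \<in> sets borel" "bounded B"
  moreover have "{\<omega> \<in> space M. R \<omega> \<inter> A = {}} \<inter> {\<omega> \<in> space M. R \<omega> \<inter> B = {}} = {\<omega> \<in> space M. R \<omega> \<inter> (A \<union> B) = {}}"
    by auto
  ultimately show "\<exists>C. {\<omega> \<in> space M. R \<omega> \<inter> A = {}} \<inter> {\<omega> \<in> space M. R \<omega> \<inter> B = {}} = {\<omega> \<in> space M. R \<omega> \<inter> C = {}} \<and>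
      C \<in> sets borel \<and> bounded C"
    by (intro exI[of _ "A \<union> B"]) auto
qed

lemma count_in_sigma_void:
  fixes R :: "'w \<Rightarrow> 'a::polish_space set"
  assumes R: "random_set M R" and A: "A \<in> sets borel" "bounded A"
  shows "{\<omega> \<in> space M. ecard (R \<omega> \<inter> A) \<in> B} \<in> sigma_sets (space M) (void_events M R)"
proof -
  let ?G = "void_events M R"
  have G: "?G \<subseteq> Pow (space M)" by (auto simp: void_events_def)
  interpret S: sigma_algebra "space M" "sigma_sets (space M) ?G"
    by (rule sigma_algebra_sigma_sets[OF G])
  have hit: "{\<omega> \<in> space M. R \<omega> \<inter> A \<inter> cell j \<noteq> {}} \<in> sigma_sets (space M) ?G" for j
  proof -
    have "A \<inter> cell j \<in> sets borel" "bounded (A \<inter> cell j)"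
      using A by (auto intro: bounded_subset)
    then have "{\<omega> \<in> space M. R \<omega> \<inter> (A \<inter> cell j) = {}} \<in> ?G"
      unfolding void_events_def by blast
    then have "space M - {\<omega> \<in> space M. R \<omega> \<inter> (A \<inter> cell j) = {}} \<in> sigma_sets (space M) ?G"
      by (intro S.compl_sets sigma_sets.Basic)
    moreover have "space M - {\<omega> \<in> space M. R \<omega> \<inter> (A \<inter> cell j) = {}} = {\<omega> \<in> space M. R \<omega> \<inter> A \<inter> cell j \<noteq> {}}"
      by auto
    ultimately show ?thesis by simp
  qed
  have ge: "{\<omega> \<in> space M. of_nat n \<le> ecard (R \<omega> \<inter> A)} \<in> sigma_sets (space M) ?G" for n
  proof -
    let ?C = "{F. finite F \<and> card F = n \<and> disjoint_family_on (cell :: nat \<Rightarrow> 'a set) F}"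
    have "countable ?C"
      by (rule countable_subset[OF _ countable_Collect_finite]) auto
    moreover have "{\<omega> \<in> space M. \<forall>j\<in>F. R \<omega> \<inter> A \<inter> cell j \<noteq> {}} \<in> sigma_sets (space M) ?G" if "F \<in> ?C" for F
      using that hit by (intro S.sets_Collect_finite_All) auto
    ultimately have "(\<Union>F\<in>?C. {\<omega> \<in> space M. \<forall>j\<in>F. R \<omega> \<inter> A \<inter> cell j \<noteq> {}}) \<in> sigma_sets (space M) ?G"
      by (intro S.countable_UN'') auto
    moreover have "(\<Union>F\<in>?C. {\<omega> \<in> space M. \<forall>j\<in>F. R \<omega> \<inter> A \<inter> cell j \<noteq> {}}) = {\<omega> \<in> space M. of_nat n \<le> ecard (R \<omega> \<inter> A)}"
      unfolding ecard_le_iff_cells by blast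
    ultimately show ?thesis by simp
  qed
  have eq: "{\<omega> \<in> space M. card (R \<omega> \<inter> A) = n} \<in> sigma_sets (space M) ?G" for n
  proof -
    have "{\<omega> \<in> space M. card (R \<omega> \<inter> A) = n} =
        {\<omega> \<in> space M. of_nat n \<le> ecard (R \<omega> \<inter> A)} - {\<omega> \<in> space M. of_nat (Suc n) \<le> ecard (R \<omega> \<inter> A)}"
    proof (intro Collect_eqI set_eqI)
      fix \<omega>
      have "\<omega> \<in> space M \<Longrightarrow> finite (R \<omega> \<inter> A)"
        using random_set_locally_finite[OF R] A by (auto simp: locally_finite_def)
      then have "\<omega> \<in> space M \<Longrightarrow> ecard (R \<omega> \<inter> A) = of_nat (card (R \<omega> \<inter> A))" by (rule ecard_finite)
      moreover have "card (R \<omega> \<inter> A) = n \<longleftrightarrow> (of_nat n :: ennreal) \<le> of_nat (card (R \<omega> \<inter> A)) \<and> \<not> (of_nat (Suc n) :: ennreal) \<le> of_nat (card (R \<omega> \<inter> A))"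
        unfolding of_nat_le_iff by linarith
      ultimately show "\<omega> \<in> {\<omega> \<in> space M. card (R \<omega> \<inter> A) = n} \<longleftrightarrow>
        \<omega> \<in> {\<omega> \<in> space M. of_nat n \<le> ecard (R \<omega> \<inter> A)} - {\<omega> \<in> space M. of_nat (Suc n) \<le> ecard (R \<omega> \<inter> A)}"
        by auto
    qed
    then show ?thesis using ge by (simp only: S.Diff)
  qed
  have "{\<omega> \<in> space M. ecard (R \<omega> \<inter> A) \<in> B} = (\<Union>n\<in>{n. of_nat n \<in> B}. {\<omega> \<in> space M. card (R \<omega> \<inter> A) = n})"
  proof (intro set_eqI)
    fix \<omega>
    have "\<omega> \<in> space M \<Longrightarrow> finite (R \<omega> \<inter> A)"
      using random_set_locally_finite[OF R] A by (auto simp: locally_finite_def)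
    then show "\<omega> \<in> {\<omega> \<in> space M. ecard (R \<omega> \<inter> A) \<in> B} \<longleftrightarrow>
        \<omega> \<in> (\<Union>n\<in>{n. of_nat n \<in> B}. {\<omega> \<in> space M. card (R \<omega> \<inter> A) = n})"
      by (auto simp: ecard_finite)
  qed
  also have "\<dots> \<in> sigma_sets (space M) ?G" using eq by (intro S.countable_UN'') auto
  finally show ?thesis .
qed

lemma counting_measure_configuration:
  assumes R: "locally_finite R" shows "counting_measure R \<in> configurations"
proof -
  have "emeasure (counting_measure R) A < \<infinity>" if "A \<in> sets borel" "bounded A" for A
    using that R by (simp add: emeasure_counting locally_finite_def ecard_finite_iff)
  then have "boundedly_finite (counting_measure R)"
    unfolding boundedly_finite_def by (simp add: counting_measure_def)
  then show ?thesis using locally_finite_countable[OF R] by (auto simp: configurations_def)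
qed

abbreviation configuration_generators :: "'a::polish_space measure set set" where
  "configuration_generators \<equiv> {{\<xi> \<in> configurations. emeasure \<xi> A \<in> B} |A B.
     A \<in> {A \<in> sets borel. bounded A} \<and> B \<in> sets (borel :: ennreal measure)}"

lemma counting_measure_vimage:
  fixes R :: "'w \<Rightarrow> 'a::polish_space set"
  assumes R: "random_set M R" and B: "B \<in> sets configuration_space"
  shows "(\<lambda>\<omega>. counting_measure (R \<omega>)) -` B \<inter> space M \<in> sigma_sets (space M) (void_events M R)"
proof -
  let ?G = "void_events M R" and ?X = "\<lambda>\<omega>. counting_measure (R \<omega>)"
  have G: "?G \<subseteq> Pow (space M)" by (auto simp: void_events_def)
  have gens: "configuration_generators \<subseteq> Pow (configurations :: 'a measure set)" by auto
  have "?X \<in> measurable (sigma (space M) ?G) configuration_space"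
    unfolding configuration_space_def evaluation_space_def
  proof (rule measurable_measure_of[OF gens])
    show "?X \<in> space (sigma (space M) ?G) \<rightarrow> configurations"
      using random_set_locally_finite[OF R] G by (auto intro: counting_measure_configuration)
    fix Y :: "'a measure set" assume "Y \<in> configuration_generators"
    then obtain A and B :: "ennreal set" where A: "A \<in> sets borel" "bounded A"
      and Y: "Y = {\<xi> \<in> configurations. emeasure \<xi> A \<in> B}" by auto
    have "?X -` Y \<inter> space M = {\<omega> \<in> space M. ecard (R \<omega> \<inter> A) \<in> B}"
      using random_set_locally_finite[OF R] A
      by (auto simp: Y emeasure_counting counting_measure_configuration)
    then show "?X -` Y \<inter> space (sigma (space M) ?G) \<in> sets (sigma (space M) ?G)"
      using G count_in_sigma_void[OF R A, of B] by simp
  qed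
  from measurable_sets[OF this B] show ?thesis using G by simp
qed

lemma void_events_sets: "random_set M R \<Longrightarrow> void_events M R \<subseteq> sets M"
proof
  fix E assume R: "random_set M R" and "E \<in> void_events M R"
  then obtain A where A: "A \<in> sets borel" and E: "E = {\<omega> \<in> space M. ecard (R \<omega> \<inter> A) = 0}"
    by (auto simp: void_events_def)
  show "E \<in> sets M" unfolding E using random_set_measurable[OF R A] by measurable
qed

lemma counting_measure_measurable:
  assumes R: "random_set M R"
  shows "(\<lambda>\<omega>. counting_measure (R \<omega>)) \<in> M \<rightarrow>\<^sub>M configuration_space"
proof (rule measurableI)
  fix \<omega> assume "\<omega> \<in> space M"
  then show "counting_measure (R \<omega>) \<in> space configuration_space"
    using counting_measure_configuration[OF random_set_locally_finite[OF R]]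
    by (simp add: configuration_space_def evaluation_space_def space_measure_of_conv)
next
  fix B :: "'b measure set" assume "B \<in> sets configuration_space"
  then have "(\<lambda>\<omega>. counting_measure (R \<omega>)) -` B \<inter> space M \<in> sigma_sets (space M) (void_events M R)"
    by (rule counting_measure_vimage[OF R])
  also have "\<dots> \<subseteq> sets M" by (rule sets.sigma_sets_subset[OF void_events_sets[OF R]])
  finally show "(\<lambda>\<omega>. counting_measure (R \<omega>)) -` B \<inter> space M \<in> sets M" .
qed

context prob_space
begin

text \<open>Void events are closed under intersection, and by \<open>counting_measure_vimage\<close> they generate the
  events that are observable from the configuration.\<close>

lemma indep_counting_measures:
  assumes R: "\<And>i. i \<in> I \<Longrightarrow> random_set M (R i)"
    and void: "\<And>K A. K \<subseteq> I \<Longrightarrow> finite K \<Longrightarrow> K \<noteq> {} \<Longrightarrow> (\<And>i. i \<in> K \<Longrightarrow> A i \<in> sets borel \<and> bounded (A i)) \<Longrightarrow>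
      prob {\<omega> \<in> space M. \<forall>i\<in>K. R i \<omega> \<inter> A i = {}} = (\<Prod>i\<in>K. prob {\<omega> \<in> space M. R i \<omega> \<inter> A i = {}})"
  shows "indep_vars (\<lambda>_. configuration_space) (\<lambda>i \<omega>. counting_measure (R i \<omega>)) I"
  unfolding indep_vars_def2
proof (intro conjI ballI)
  show "random_variable configuration_space (\<lambda>\<omega>. counting_measure (R i \<omega>))" if "i \<in> I" for i
    using counting_measure_measurable[OF R[OF that]] .
  have "indep_sets (\<lambda>i. void_events M (R i)) I"
  proof (rule indep_setsI)
    show "void_events M (R i) \<subseteq> events" if "i \<in> I" for i using void_events_sets[OF R[OF that]] .
    fix E K assume K: "K \<noteq> {}" "K \<subseteq> I" "finite K" and E: "\<forall>j\<in>K. E j \<in> void_events M (R j)"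
    have "\<exists>A. j \<in> K \<longrightarrow> A \<in> sets borel \<and> bounded A \<and> E j = {\<omega> \<in> space M. R j \<omega> \<inter> A = {}}" for j
      using E unfolding void_events_def by blast
    then have "\<exists>A. \<forall>j. j \<in> K \<longrightarrow> A j \<in> sets borel \<and> bounded (A j) \<and> E j = {\<omega> \<in> space M. R j \<omega> \<inter> A j = {}}"
      by (intro choice allI)
    then obtain A where A: "\<And>j. j \<in> K \<Longrightarrow> A j \<in> sets borel \<and> bounded (A j) \<and> E j = {\<omega> \<in> space M. R j \<omega> \<inter> A j = {}}"
      by blast
    have "(\<Inter>j\<in>K. E j) = {\<omega> \<in> space M. \<forall>i\<in>K. R i \<omega> \<inter> A i = {}}" using A K(1) by auto
    then show "prob (\<Inter>j\<in>K. E j) = (\<Prod>j\<in>K. prob (E j))" using void[OF K(2,3,1), of A] A by simp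
  qed
  then have "indep_sets (\<lambda>i. sigma_sets (space M) (void_events M (R i))) I"
    by (rule indep_sets_sigma) (rule Int_stable_void_events)
  then show "indep_sets (\<lambda>i. {(\<lambda>\<omega>. counting_measure (R i \<omega>)) -` A \<inter> space M |A. A \<in> sets configuration_space}) I"
    by (rule indep_sets_mono_sets) (use counting_measure_vimage R in blast)
qed

text \<open>The level sets, together with the empty set, are closed under intersection and generate.\<close>

lemma indep_vars_discrete:
  fixes X :: "'i \<Rightarrow> 'a \<Rightarrow> ennreal"
  assumes X: "\<And>i. i \<in> I \<Longrightarrow> random_variable borel (X i)" and V: "countable V"
    and XV: "\<And>i \<omega>. i \<in> I \<Longrightarrow> \<omega> \<in> space M \<Longrightarrow> X i \<omega> \<in> V"
    and point: "\<And>K v. K \<subseteq> I \<Longrightarrow> finite K \<Longrightarrow> K \<noteq> {} \<Longrightarrow> (\<And>i. i \<in> K \<Longrightarrow> v i \<in> V) \<Longrightarrow>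
      prob {\<omega> \<in> space M. \<forall>i\<in>K. X i \<omega> = v i} = (\<Prod>i\<in>K. prob {\<omega> \<in> space M. X i \<omega> = v i})"
  shows "indep_vars (\<lambda>_. borel) X I"
  unfolding indep_vars_def2
proof (intro conjI ballI X)
  define G where "G i = insert {} {{\<omega> \<in> space M. X i \<omega> = v} |v. v \<in> V}" for i
  have Gs: "G i \<subseteq> Pow (space M)" for i by (auto simp: G_def)
  have "indep_sets G I"
  proof (rule indep_setsI)
    show "G i \<subseteq> events" if "i \<in> I" for i
      using X[OF that] by (auto simp: G_def)
    fix E K assume K: "K \<noteq> {}" "K \<subseteq> I" "finite K" and E: "\<forall>j\<in>K. E j \<in> G j"
    show "prob (\<Inter>j\<in>K. E j) = (\<Prod>j\<in>K. prob (E j))"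
    proof (cases "\<exists>j\<in>K. E j = {}")
      case True
      then have "(\<Inter>j\<in>K. E j) = {}" by blast
      moreover have "\<exists>j\<in>K. prob (E j) = 0" using True by (metis measure_empty)
      with K have "(\<Prod>j\<in>K. prob (E j)) = 0" by (intro prod_zero)
      ultimately show ?thesis by simp
    next
      case False
      then have "\<exists>v. j \<in> K \<longrightarrow> v \<in> V \<and> E j = {\<omega> \<in> space M. X j \<omega> = v}" for j
        using E unfolding G_def by blast
      then obtain v where v: "\<And>j. j \<in> K \<Longrightarrow> v j \<in> V \<and> E j = {\<omega> \<in> space M. X j \<omega> = v j}" by metis
      have "(\<Inter>j\<in>K. E j) = {\<omega> \<in> space M. \<forall>i\<in>K. X i \<omega> = v i}" using v K(1) by auto
      then show ?thesis using point[OF K(2,3,1), of v] v by simp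
    qed
  qed
  moreover have "Int_stable (G i)" for i
    unfolding Int_stable_def
  proof (intro ballI)
    fix a b assume ab: "a \<in> G i" "b \<in> G i"
    then have "a \<inter> b = {} \<or> a = b" by (auto simp: G_def)
    then show "a \<inter> b \<in> G i" using ab by (auto simp: G_def)
  qed
  ultimately have "indep_sets (\<lambda>i. sigma_sets (space M) (G i)) I" by (rule indep_sets_sigma)
  then show "indep_sets (\<lambda>i. {X i -` A \<inter> space M |A. A \<in> sets borel}) I"
  proof (rule indep_sets_mono_sets)
    fix i assume i: "i \<in> I"
    interpret S: sigma_algebra "space M" "sigma_sets (space M) (G i)"
      by (rule sigma_algebra_sigma_sets[OF Gs])
    show "{X i -` A \<inter> space M |A. A \<in> sets borel} \<subseteq> sigma_sets (space M) (G i)"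
    proof clarify
      fix A :: "ennreal set"
      have "X i -` A \<inter> space M = (\<Union>v\<in>V \<inter> A. {\<omega> \<in> space M. X i \<omega> = v})" using XV[OF i] by auto
      also have "\<dots> \<in> sigma_sets (space M) (G i)"
        using V by (intro S.countable_UN'' sigma_sets.Basic) (auto simp: G_def)
      finally show "X i -` A \<inter> space M \<in> sigma_sets (space M) (G i)" .
    qed
  qed
qed

end

lemma ecard_UN_infsum:
  fixes E :: "nat \<Rightarrow> 'b set"
  assumes disj: "disjoint_family_on E I"
  shows "ecard (\<Union>i\<in>I. E i) = (\<Sum>\<^sub>\<infinity>i\<in>I. ecard (E i))"
proof -
  have fin: "(\<Sum>i\<in>F. ecard (E i)) = ecard (\<Union>i\<in>F. E i)" if "finite F" "F \<subseteq> I" for F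
    using that disjoint_family_on_mono[OF that(2) disj] by (intro ecard_UN_disjoint_finite[symmetric])
  have "(\<Sum>\<^sub>\<infinity>i\<in>I. ecard (E i)) = (SUP F\<in>{F. finite F \<and> F \<subseteq> I}. \<Sum>i\<in>F. ecard (E i))"
    by (rule nonneg_infsum_complete) simp
  also have "\<dots> = ecard (\<Union>i\<in>I. E i)"
  proof (rule antisym)
    show "(SUP F\<in>{F. finite F \<and> F \<subseteq> I}. \<Sum>i\<in>F. ecard (E i)) \<le> ecard (\<Union>i\<in>I. E i)"
      by (rule SUP_least) (auto simp: fin intro!: ecard_mono)
    let ?U = "\<lambda>n. \<Union>i\<in>I \<inter> {..<n}. E i"
    have "(SUP n. ecard (?U n)) = ecard (\<Union>n. ?U n)"
      unfolding ecard_def by (rule SUP_emeasure_incseq) (auto simp: incseq_def)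
    moreover have "(\<Union>n. ?U n) = (\<Union>i\<in>I. E i)" by (auto intro: lessI)
    moreover have "ecard (?U n) \<le> (SUP F\<in>{F. finite F \<and> F \<subseteq> I}. \<Sum>i\<in>F. ecard (E i))" for n
      by (subst fin[symmetric]) (auto intro!: SUP_upper2[of "I \<inter> {..<n}"])
    then have "(SUP n. ecard (?U n)) \<le> (SUP F\<in>{F. finite F \<and> F \<subseteq> I}. \<Sum>i\<in>F. ecard (E i))"
      by (intro SUP_least)
    ultimately show "ecard (\<Union>i\<in>I. E i) \<le> (SUP F\<in>{F. finite F \<and> F \<subseteq> I}. \<Sum>i\<in>F. ecard (E i))"
      by simp
  qed
  finally show ?thesis by simp
qed

context ergodic_process
begin

section \<open>Assembling the superposition\<close>

definition root_process :: "int set \<Rightarrow> 'w \<Rightarrow> 'a measure" where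
  "root_process J \<omega> = counting_measure (roots J \<omega>)"

lemma emeasure_root_process:
  "A \<in> sets borel \<Longrightarrow> emeasure (root_process J \<omega>) A = ecard (roots J \<omega> \<inter> A)"
  by (simp add: root_process_def emeasure_counting)

lemma random_set_roots: "random_set P (roots J)"
  by (rule factor_set_random[OF factor_set_roots])

lemma root_process_T_point_process: "T_point_process \<mu> T P S (root_process J)"
  unfolding T_point_process_def
proof (intro conjI ballI impI)
  show "root_process J \<in> P \<rightarrow>\<^sub>M configuration_space"
    unfolding root_process_def[abs_def] by (rule counting_measure_measurable[OF random_set_roots])
  show "AE \<omega> in P. emeasure (root_process J \<omega>) A = 0" if "A \<in> sets borel" "emeasure \<mu> A = 0" for A
    using points_null[OF that]
    by eventually_elim (use that in \<open>auto simp: emeasure_root_process roots_def\<close>)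
  show "AE \<omega> in P. \<forall>A\<in>sets borel. emeasure (root_process J (S \<omega>)) A = emeasure (root_process J \<omega>) (T -` A)"
    using factor_set_S[OF factor_set_roots[of J]]
  proof eventually_elim
    case (elim \<omega>)
    show ?case
    proof
      fix A :: "'a set" assume A: "A \<in> sets borel"
      have "roots J (S \<omega>) \<inter> A = T ` (roots J \<omega> \<inter> T -` A)" unfolding elim by auto
      moreover have "inj_on T X" for X using bij_is_inj[OF bij_T] by (rule inj_on_subset) simp
      ultimately show "emeasure (root_process J (S \<omega>)) A = emeasure (root_process J \<omega>) (T -` A)"
        using A by (simp add: emeasure_root_process ecard_image)
    qed
  qed
qed

lemma single_poisson_law:
  assumes "J \<in> shapes" "A \<in> sets borel" "emeasure \<mu> A < \<infinity>"
  shows "prob {\<omega> \<in> space P. ecard (roots J \<omega> \<inter> A) = of_nat k} =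
    (root_intensity J * measure \<mu> A) ^ k / fact k * exp (- (root_intensity J * measure \<mu> A))"
  using joint_poisson_law[of "{()}" "\<lambda>_. J" "\<lambda>_. A" "\<lambda>_. k"] assms by simp

lemma prob_infinite_count:
  assumes A: "A \<in> sets borel" "emeasure \<mu> A < \<infinity>" and E: "E \<in> events"
    and sub: "E \<subseteq> {\<omega> \<in> space P. ecard (roots J \<omega> \<inter> A) = \<infinity>}"
  shows "prob E = 0"
proof -
  have "AE \<omega> in P. \<omega> \<notin> E"
    using AE_finite_roots[OF A, of J] by eventually_elim (use sub in \<open>auto simp: ecard_finite\<close>)
  then show ?thesis using E by (simp add: prob_eq_0)
qed

lemma ecard_values: "ecard X \<in> insert \<infinity> (range of_nat)"
  by (cases "finite X") (auto simp: ecard_finite ecard_infinite)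

text \<open>Counts in sets of finite measure are finite only almost surely. Therefore \<open>\<infinity>\<close> is admitted as a
  level in the proof of independence, with probability 0.\<close>

lemma root_process_poisson:
  assumes J: "J \<in> shapes" and pos: "0 < root_intensity J"
  shows "poisson_process \<mu> P (root_intensity J) (root_process J)"
  unfolding poisson_process_def
proof (intro conjI allI impI pos)
  fix k :: nat and A :: "nat \<Rightarrow> 'a set"
  assume conj: "(\<forall>i\<in>{1..k}. A i \<in> finite_pos_sets \<mu>) \<and> disjoint_family_on A {1..k}"
  then have A: "\<forall>i\<in>{1..k}. A i \<in> finite_pos_sets \<mu>" and disj: "disjoint_family_on A {1..k}"
    by simp_all
  have A': "A i \<in> sets borel" "0 < emeasure \<mu> (A i)" "emeasure \<mu> (A i) < \<infinity>" if "i \<in> {1..k}" for i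
    using A that by (auto simp: finite_pos_sets_def)
  define X where "X i \<omega> = ecard (roots J \<omega> \<inter> A i)" for i \<omega>
  have X: "(\<lambda>\<omega>. emeasure (root_process J \<omega>) (A i)) = X i" if "i \<in> {1..k}" for i
    using A'[OF that] by (simp add: X_def[abs_def] emeasure_root_process)
  have Xm: "X i \<in> borel_measurable P" if "i \<in> {1..k}" for i
    unfolding X_def[abs_def] using A'[OF that] by (intro ecard_roots_measurable)
  have "indep_vars (\<lambda>_. borel) X {1..k}"
  proof (rule indep_vars_discrete[where V = "insert \<infinity> (range of_nat)"])
    fix K and v :: "nat \<Rightarrow> ennreal"
    assume K: "K \<subseteq> {1..k}" "finite K" "K \<noteq> {}" and v: "\<And>i. i \<in> K \<Longrightarrow> v i \<in> insert \<infinity> (range of_nat)"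
    have ev: "{\<omega> \<in> space P. X i \<omega> = v i} \<in> events" if "i \<in> K" for i
      using Xm K that by (intro borel_measurable_eq) auto
    have Ev: "{\<omega> \<in> space P. \<forall>i\<in>K. X i \<omega> = v i} \<in> events"
      using K ev by (intro sets.sets_Collect_finite_All) auto
    show "prob {\<omega> \<in> space P. \<forall>i\<in>K. X i \<omega> = v i} = (\<Prod>i\<in>K. prob {\<omega> \<in> space P. X i \<omega> = v i})"
    proof (cases "\<exists>i\<in>K. v i = \<infinity>")
      case True
      then obtain i where i: "i \<in> K" "v i = \<infinity>" by blast
      then have ik: "i \<in> {1..k}" using K by auto
      have "prob {\<omega> \<in> space P. X i \<omega> = v i} = 0"
        by (rule prob_infinite_count[OF A'(1,3)[OF ik] ev[OF i(1)]]) (auto simp: X_def i)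
      with i(1) have "\<exists>i\<in>K. prob {\<omega> \<in> space P. X i \<omega> = v i} = 0" by blast
      with K(2) have "(\<Prod>i\<in>K. prob {\<omega> \<in> space P. X i \<omega> = v i}) = 0" by (rule prod_zero)
      moreover have "prob {\<omega> \<in> space P. \<forall>i\<in>K. X i \<omega> = v i} = 0"
        by (rule prob_infinite_count[OF A'(1,3)[OF ik] Ev]) (use i in \<open>auto simp: X_def\<close>)
      ultimately show ?thesis by simp
    next
      case False
      then have "\<exists>n. i \<in> K \<longrightarrow> v i = of_nat n" for i using v[of i] by blast
      then have "\<exists>n. \<forall>i. i \<in> K \<longrightarrow> v i = of_nat (n i)" by (intro choice allI)
      then obtain n where n: "\<And>i. i \<in> K \<Longrightarrow> v i = of_nat (n i)" by blast
      have "prob {\<omega> \<in> space P. \<forall>i\<in>K. X i \<omega> = v i} = prob {\<omega> \<in> space P. \<forall>i\<in>K. ecard (roots J \<omega> \<inter> A i) = of_nat (n i)}"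
        by (simp add: X_def n cong: ball_cong)
      also have "\<dots> = (\<Prod>i\<in>K. (root_intensity J * measure \<mu> (A i)) ^ n i / fact (n i) * exp (- (root_intensity J * measure \<mu> (A i))))"
        using K A' J disj by (intro joint_poisson_law) (auto simp: disjoint_family_on_def subset_iff)
      also have "\<dots> = (\<Prod>i\<in>K. prob {\<omega> \<in> space P. X i \<omega> = v i})"
      proof (rule prod.cong[OF refl])
        fix i assume i: "i \<in> K"
        then have ik: "i \<in> {1..k}" using K by auto
        show "(root_intensity J * measure \<mu> (A i)) ^ n i / fact (n i) * exp (- (root_intensity J * measure \<mu> (A i))) =
            prob {\<omega> \<in> space P. X i \<omega> = v i}"
          unfolding X_def n[OF i] by (rule single_poisson_law[OF J A'(1,3)[OF ik], symmetric])
      qed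
      finally show ?thesis .
    qed
  qed (use Xm ecard_values in \<open>auto simp: X_def\<close>)
  moreover have "indep_vars (\<lambda>_. borel) X {1..k} \<longleftrightarrow>
      indep_vars (\<lambda>_. borel) (\<lambda>i \<omega>. emeasure (root_process J \<omega>) (A i)) {1..k}"
    by (rule indep_vars_cong) (use X in auto)
  ultimately show "indep_vars (\<lambda>_. borel) (\<lambda>i \<omega>. emeasure (root_process J \<omega>) (A i)) {1..k}" by simp
  show "\<forall>i\<in>{1..k}. distr P borel (\<lambda>\<omega>. emeasure (root_process J \<omega>) (A i)) =
           distr (measure_pmf (poisson_pmf (root_intensity J * measure \<mu> (A i)))) borel (of_nat :: nat \<Rightarrow> ennreal)"
  proof
    fix i assume i: "i \<in> {1..k}"
    define r where "r = root_intensity J * measure \<mu> (A i)"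
    have "0 < measure \<mu> (A i)" using A'[OF i] emeasure_mu_eq[of "A i"] by auto
    then have r: "0 < r" using pos by (simp add: r_def)
    define Z where "Z \<omega> = nat \<lfloor>cnt J (A i) \<omega>\<rfloor>" for \<omega>
    have Z [measurable]: "Z \<in> P \<rightarrow>\<^sub>M count_space UNIV"
      unfolding Z_def[abs_def] using cnt_measurable[OF A'(1)[OF i], of J] by measurable
    have XZ: "AE \<omega> in P. X i \<omega> = of_nat (Z \<omega>)"
      using AE_finite_roots[OF A'(1,3)[OF i], of J]
      by eventually_elim (simp add: X_def Z_def cnt_def ecard_finite)
    have Zlaw: "distr P (count_space UNIV) Z = measure_pmf (poisson_pmf r)"
    proof (rule measure_eqI_countable[where A = UNIV])
      fix n :: nat
      have "emeasure (distr P (count_space UNIV) Z) {n} = emeasure P {\<omega> \<in> space P. Z \<omega> = n}"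
        by (subst emeasure_distr) (auto intro: arg_cong[where f = "emeasure P"])
      also have "\<dots> = emeasure P {\<omega> \<in> space P. ecard (roots J \<omega> \<inter> A i) = of_nat n}"
      proof (rule emeasure_eq_AE)
        show "AE \<omega> in P. \<omega> \<in> {\<omega> \<in> space P. Z \<omega> = n} \<longleftrightarrow> \<omega> \<in> {\<omega> \<in> space P. ecard (roots J \<omega> \<inter> A i) = of_nat n}"
          using XZ by eventually_elim (simp add: X_def)
        show "{\<omega> \<in> space P. ecard (roots J \<omega> \<inter> A i) = of_nat n} \<in> events"
          using ecard_roots_measurable[OF A'(1)[OF i], of J] by measurable
      qed measurable
      also have "\<dots> = ennreal (pmf (poisson_pmf r) n)"
        unfolding emeasure_eq_measure single_poisson_law[OF J A'(1,3)[OF i]] using r by (simp add: r_def)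
      finally show "emeasure (distr P (count_space UNIV) Z) {n} = emeasure (measure_pmf (poisson_pmf r)) {n}"
        by (simp add: emeasure_pmf_single)
    qed auto
    have "distr P borel (\<lambda>\<omega>. emeasure (root_process J \<omega>) (A i)) = distr P borel (\<lambda>\<omega>. of_nat (Z \<omega>) :: ennreal)"
      unfolding X[OF i] using XZ Xm[OF i] by (intro distr_cong_AE) auto
    also have "\<dots> = distr (distr P (count_space UNIV) Z) borel (of_nat :: nat \<Rightarrow> ennreal)"
      by (subst distr_distr) (auto simp: comp_def)
    finally show "distr P borel (\<lambda>\<omega>. emeasure (root_process J \<omega>) (A i)) =
           distr (measure_pmf (poisson_pmf (root_intensity J * measure \<mu> (A i)))) borel (of_nat :: nat \<Rightarrow> ennreal)"
      by (simp add: Zlaw r_def)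
  qed
qed

lemma roots_independent:
  fixes Sh :: "'i \<Rightarrow> int set"
  assumes Sh: "\<And>i. i \<in> I \<Longrightarrow> Sh i \<in> shapes" and inj: "inj_on Sh I"
  shows "indep_vars (\<lambda>_. configuration_space) (\<lambda>i. root_process (Sh i)) I"
  unfolding root_process_def[abs_def]
proof (rule indep_counting_measures[OF random_set_roots])
  fix K and A :: "'i \<Rightarrow> 'a set"
  assume K: "K \<subseteq> I" "finite K" "K \<noteq> {}" and A: "\<And>i. i \<in> K \<Longrightarrow> A i \<in> sets borel \<and> bounded (A i)"
  have A': "A i \<in> sets borel" "emeasure \<mu> (A i) < \<infinity>" if "i \<in> K" for i using A[OF that] mu_bounded by auto
  have "prob {\<omega> \<in> space P. \<forall>i\<in>K. roots (Sh i) \<omega> \<inter> A i = {}} = prob {\<omega> \<in> space P. \<forall>i\<in>K. ecard (roots (Sh i) \<omega> \<inter> A i) = of_nat 0}"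
    by simp
  also have "\<dots> = (\<Prod>i\<in>K. (root_intensity (Sh i) * measure \<mu> (A i)) ^ 0 / fact 0 * exp (- (root_intensity (Sh i) * measure \<mu> (A i))))"
    using K A' Sh inj by (intro joint_poisson_law) (auto simp: inj_on_def subset_iff)
  also have "\<dots> = (\<Prod>i\<in>K. prob {\<omega> \<in> space P. ecard (roots (Sh i) \<omega> \<inter> A i) = of_nat 0})"
    using K Sh A' by (intro prod.cong refl single_poisson_law[symmetric]) auto
  finally show "prob {\<omega> \<in> space P. \<forall>i\<in>K. roots (Sh i) \<omega> \<inter> A i = {}} = (\<Prod>i\<in>K. prob {\<omega> \<in> space P. roots (Sh i) \<omega> \<inter> A i = {}})"
    by simp
qed

lemma AE_roots_empty:
  assumes "root_intensity J = 0" shows "AE \<omega> in P. roots J \<omega> = {}"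
proof -
  have "AE \<omega> in P. roots J \<omega> \<inter> cell b = {}" for b
  proof -
    have "(\<integral>\<^sup>+ \<omega>. ecard (roots J \<omega> \<inter> cell b) \<partial>P) = 0" by (simp add: root_intensity assms)
    then have "AE \<omega> in P. ecard (roots J \<omega> \<inter> cell b) = 0"
      by (subst (asm) nn_integral_0_iff_AE) (auto intro: ecard_roots_measurable)
    then show ?thesis by eventually_elim simp
  qed
  then have "AE \<omega> in P. \<forall>b. roots J \<omega> \<inter> cell b = {}" by (simp add: AE_all_countable)
  then show ?thesis by eventually_elim (use UN_cell in blast)
qed

text \<open>The shapes are numbered by natural numbers. A Poisson process has positive intensity by
  definition, so the index set is restricted to the shapes of positive intensity; almost surely there
  are no roots of the other shapes.\<close>

lemma superposition: "SuShi \<mu> T P S N"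
proof -
  define Sh where "Sh = from_nat_into shapes"
  define I where "I = to_nat_on shapes ` {J \<in> shapes. 0 < root_intensity J}"
  have Sh_code: "Sh (to_nat_on shapes J) = J" if "J \<in> shapes" for J
    unfolding Sh_def using countable_shapes that by (rule from_nat_into_to_nat_on)
  have Sh: "Sh i \<in> shapes" "0 < root_intensity (Sh i)" if "i \<in> I" for i
    using that by (auto simp: I_def Sh_code)
  have inj: "inj_on Sh I"
  proof (rule inj_onI)
    fix i j assume "i \<in> I" "j \<in> I" "Sh i = Sh j"
    then show "i = j" by (auto simp: I_def Sh_code)
  qed
  have fin: "finite (Sh i)" if "i \<in> I" for i using Sh(1)[OF that] by (simp add: shapes_def)
  let ?E = "\<lambda>\<omega> A i. \<Union>j\<in>Sh i. it j ` roots (Sh i) \<omega> \<inter> A"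
  have shift: "ecard (it j ` roots J \<omega> \<inter> A) = ecard (roots J \<omega> \<inter> it j -` A)" for j J \<omega> A
  proof -
    have "it j ` roots J \<omega> \<inter> A = it j ` (roots J \<omega> \<inter> it j -` A)" by auto
    then show ?thesis by (simp add: ecard_image inj_on_def)
  qed
  have disj: "disjoint_family_on (?E \<omega> A) I" and
    cluster: "\<And>i. i \<in> I \<Longrightarrow> ecard (?E \<omega> A i) = (\<Sum>j\<in>Sh i. ecard (roots (Sh i) \<omega> \<inter> it j -` A))"
    if o: "\<forall>x\<in>points \<omega>. finite (offsets \<omega> x)" for \<omega> A
  proof -
    note d = points_decomposition(2)[OF o]
    have sep: "it j ` roots (Sh i) \<omega> \<inter> it j' ` roots (Sh i') \<omega> = {}"
      if "i \<in> I" "i' \<in> I" "j \<in> Sh i" "j' \<in> Sh i'" "(i, j) \<noteq> (i', j')" for i i' j j'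
    proof -
      have "(Sh i, j) \<noteq> (Sh i', j')" using that inj by (auto simp: inj_on_def)
      then show ?thesis
        using disjoint_family_onD[OF d, of "(Sh i, j)" "(Sh i', j')"] that Sh by auto
    qed
    show "disjoint_family_on (?E \<omega> A) I"
      unfolding disjoint_family_on_def
    proof (intro ballI impI equals0I)
      fix i i' x assume "i \<in> I" "i' \<in> I" "i \<noteq> i'" "x \<in> ?E \<omega> A i \<inter> ?E \<omega> A i'"
      then obtain j j' where "j \<in> Sh i" "j' \<in> Sh i'" "x \<in> it j ` roots (Sh i) \<omega> \<inter> it j' ` roots (Sh i') \<omega>" by blast
      then show False using sep[of i i' j j'] \<open>i \<in> I\<close> \<open>i' \<in> I\<close> \<open>i \<noteq> i'\<close> by simp
    qed
    fix i assume i: "i \<in> I"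
    have "ecard (?E \<omega> A i) = (\<Sum>j\<in>Sh i. ecard (it j ` roots (Sh i) \<omega> \<inter> A))"
    proof (rule ecard_UN_disjoint_finite[OF fin[OF i]])
      show "disjoint_family_on (\<lambda>j. it j ` roots (Sh i) \<omega> \<inter> A) (Sh i)"
        unfolding disjoint_family_on_def
      proof (intro ballI impI)
        fix j j' assume "j \<in> Sh i" "j' \<in> Sh i" "j \<noteq> j'"
        then show "it j ` roots (Sh i) \<omega> \<inter> A \<inter> (it j' ` roots (Sh i) \<omega> \<inter> A) = {}"
          using sep[of i i j j'] i by blast
      qed
    qed
    then show "ecard (?E \<omega> A i) = (\<Sum>j\<in>Sh i. ecard (roots (Sh i) \<omega> \<inter> it j -` A))" by (simp only: shift)
  qed
  have "AE \<omega> in P. \<forall>J\<in>shapes. root_intensity J = 0 \<longrightarrow> roots J \<omega> = {}"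
  proof (subst AE_ball_countable[OF countable_shapes], intro ballI)
    fix J show "AE \<omega> in P. root_intensity J = 0 \<longrightarrow> roots J \<omega> = {}"
      by (cases "root_intensity J = 0") (simp_all add: AE_roots_empty)
  qed
  then have super: "AE \<omega> in P. \<forall>A\<in>sets borel. emeasure (N \<omega>) A =
      (\<Sum>\<^sub>\<infinity>i\<in>I. \<Sum>j\<in>Sh i. emeasure (distr (root_process (Sh i) \<omega>) borel (int_iterate T j)) A)"
    using AE_finite_offsets AE_space
  proof eventually_elim
    case (elim \<omega>)
    show ?case
    proof
      fix A :: "'a set" assume A: "A \<in> sets borel"
      have "points \<omega> \<inter> A = (\<Union>i\<in>I. ?E \<omega> A i)"
      proof (intro equalityI subsetI)
        fix x assume x: "x \<in> points \<omega> \<inter> A"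
        then obtain J j where Jj: "J \<in> shapes" "j \<in> J" "x \<in> it j ` roots J \<omega>"
          using points_decomposition(1)[OF elim(2)] by blast
        then have "root_intensity J \<noteq> 0" using elim(1) by auto
        then have "0 < root_intensity J" using root_intensity_nonneg[of J] by linarith
        then have "to_nat_on shapes J \<in> I" using Jj by (simp add: I_def)
        then show "x \<in> (\<Union>i\<in>I. ?E \<omega> A i)" using Jj x Sh_code[OF Jj(1)] by fastforce
      next
        fix x assume "x \<in> (\<Union>i\<in>I. ?E \<omega> A i)"
        then show "x \<in> points \<omega> \<inter> A" using points_decomposition(1)[OF elim(2)] Sh by blast
      qed
      then have "emeasure (N \<omega>) A = ecard (\<Union>i\<in>I. ?E \<omega> A i)" using A elim(3) by (simp add: emeasure_N)
      also have "\<dots> = (\<Sum>\<^sub>\<infinity>i\<in>I. ecard (?E \<omega> A i))" by (rule ecard_UN_infsum[OF disj[OF elim(2)]])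
      also have "\<dots> = (\<Sum>\<^sub>\<infinity>i\<in>I. \<Sum>j\<in>Sh i. emeasure (distr (root_process (Sh i) \<omega>) borel (int_iterate T j)) A)"
      proof (rule infsum_cong)
        fix i assume i: "i \<in> I"
        have meas: "int_iterate T j \<in> root_process (Sh i) \<omega> \<rightarrow>\<^sub>M borel" for j
          using it_measurable[of j] by (simp add: root_process_def counting_measure_def cong: measurable_cong_sets)
        have sp: "space (root_process (Sh i) \<omega>) = UNIV" by (simp add: root_process_def counting_measure_def)
        have "emeasure (distr (root_process (Sh i) \<omega>) borel (int_iterate T j)) A = ecard (roots (Sh i) \<omega> \<inter> it j -` A)" for j
          using A by (simp add: emeasure_distr[OF meas] sp emeasure_root_process)
        then show "ecard (?E \<omega> A i) = (\<Sum>j\<in>Sh i. emeasure (distr (root_process (Sh i) \<omega>) borel (int_iterate T j)) A)"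
          using cluster[OF elim(2) i, of A] by simp
      qed
      finally show "emeasure (N \<omega>) A =
        (\<Sum>\<^sub>\<infinity>i\<in>I. \<Sum>j\<in>Sh i. emeasure (distr (root_process (Sh i) \<omega>) borel (int_iterate T j)) A)" .
    qed
  qed
  have summable: "(\<lambda>i. root_intensity (Sh i) * real (card (Sh i))) summable_on I"
  proof -
    obtain b where b: "0 < emeasure \<mu> (cell b)" "emeasure \<mu> (cell b) < \<infinity>"
      by (rule ex_finite_positive)
    let ?B = "cell b :: 'a set"
    have mB: "emeasure \<mu> ?B = ennreal (measure \<mu> ?B)" "0 < measure \<mu> ?B"
      using b emeasure_mu_eq[of ?B] by auto
    have "(\<integral>\<^sup>+ \<omega>. ecard (points \<omega> \<inter> ?B) \<partial>P) < \<infinity>"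
      using moment_finite[OF cell_borel b(2), of 1] by simp
    then obtain C where C: "(\<integral>\<^sup>+ \<omega>. ecard (points \<omega> \<inter> ?B) \<partial>P) = ennreal C" "0 \<le> C"
      by (cases "(\<integral>\<^sup>+ \<omega>. ecard (points \<omega> \<inter> ?B) \<partial>P)") auto
    have "(\<Sum>i\<in>F. root_intensity (Sh i) * real (card (Sh i))) \<le> C / measure \<mu> ?B" if F: "finite F" "F \<subseteq> I" for F
    proof -
      have "ennreal ((\<Sum>i\<in>F. root_intensity (Sh i) * real (card (Sh i))) * measure \<mu> ?B)
          = (\<Sum>i\<in>F. \<Sum>j\<in>Sh i. ennreal (root_intensity (Sh i)) * emeasure \<mu> (it j -` ?B))"
      proof -
        have "(\<Sum>j\<in>Sh i. ennreal (root_intensity (Sh i)) * emeasure \<mu> (it j -` ?B)) =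
            ennreal (root_intensity (Sh i) * real (card (Sh i)) * measure \<mu> ?B)" for i
          by (simp add: emeasure_it_vimage mB(1) ennreal_mult root_intensity_nonneg
              ennreal_of_nat_eq_real_of_nat mult_ac)
        then show ?thesis by (simp add: sum_distrib_right root_intensity_nonneg)
      qed
      also have "\<dots> = (\<Sum>i\<in>F. \<Sum>j\<in>Sh i. \<integral>\<^sup>+ \<omega>. ecard (roots (Sh i) \<omega> \<inter> it j -` ?B) \<partial>P)"
        by (simp add: root_intensity)
      also have "\<dots> = (\<integral>\<^sup>+ \<omega>. (\<Sum>i\<in>F. \<Sum>j\<in>Sh i. ecard (roots (Sh i) \<omega> \<inter> it j -` ?B)) \<partial>P)"
        by (simp add: nn_integral_sum ecard_roots_measurable borel_measurable_sum)
      also have "\<dots> \<le> (\<integral>\<^sup>+ \<omega>. ecard (points \<omega> \<inter> ?B) \<partial>P)"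
      proof (rule nn_integral_mono_AE)
        show "AE \<omega> in P. (\<Sum>i\<in>F. \<Sum>j\<in>Sh i. ecard (roots (Sh i) \<omega> \<inter> it j -` ?B)) \<le> ecard (points \<omega> \<inter> ?B)"
          using AE_finite_offsets
        proof eventually_elim
          case (elim \<omega>)
          have "(\<Sum>i\<in>F. \<Sum>j\<in>Sh i. ecard (roots (Sh i) \<omega> \<inter> it j -` ?B)) = (\<Sum>i\<in>F. ecard (?E \<omega> ?B i))"
            using F cluster[OF elim] by (intro sum.cong refl) auto
          also have "\<dots> = ecard (\<Union>i\<in>F. ?E \<omega> ?B i)"
            using F disjoint_family_on_mono[OF F(2) disj[OF elim]] by (intro ecard_UN_disjoint_finite[symmetric])
          also have "\<dots> \<le> ecard (points \<omega> \<inter> ?B)"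
            using F Sh by (intro ecard_mono) (subst points_decomposition(1)[OF elim], blast)
          finally show ?case .
        qed
      qed
      finally have "(\<Sum>i\<in>F. root_intensity (Sh i) * real (card (Sh i))) * measure \<mu> ?B \<le> C"
        unfolding C(1) using C(2) by (simp add: ennreal_le_iff)
      then show ?thesis using mB(2) by (simp add: field_simps)
    qed
    then show ?thesis
      by (intro nonneg_bdd_above_summable_on bdd_aboveI2) (auto simp: root_intensity_nonneg)
  qed
  show ?thesis
    unfolding SuShi_def
  proof (intro exI conjI ballI)
    show "indep_vars (\<lambda>_. configuration_space) (\<lambda>i. root_process (Sh i)) I"
      by (rule roots_independent[OF Sh(1) inj])
    show "(\<lambda>i. root_intensity (Sh i) * real (card (Sh i))) summable_on I" by (rule summable)
    show "AE \<omega> in P. \<forall>A\<in>sets borel. emeasure (N \<omega>) A =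
      (\<Sum>\<^sub>\<infinity>i\<in>I. \<Sum>j\<in>Sh i. emeasure (distr (root_process (Sh i) \<omega>) borel (int_iterate T j)) A)" by (rule super)
  qed (auto intro: root_process_T_point_process root_process_poisson Sh fin)
qed

end

theorem theorem3p4:
  fixes \<mu> :: "'a::polish_space measure" and T :: "'a \<Rightarrow> 'a"
    and P :: "'w measure" and S :: "'w \<Rightarrow> 'w" and N :: "'w \<Rightarrow> 'a measure"
  assumes "infinite_system \<mu> T" and "P1 \<mu> T" and "P2 \<mu> T"
    and "prob_space P" and "automorphism P S" and "ergodic P S"
    and "T_point_process \<mu> T P S N" and "all_moments \<mu> P N"
  shows "SuShi \<mu> T P S N"
proof -
  interpret prob_space P by fact
  interpret ergodic_process \<mu> T P S N
    by unfold_locales (use assms in auto)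
  show ?thesis by (rule superposition)
qed

end
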